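(* Let $k>1$, let $n_-$ be odd, let $n_+\ge 4$ be even, and let $\theta=\theta_1$ be one of the odd generating elements of the Grassmann algebra $\mathbb{G}^k$. Let $\zeta\in\mathbf{E}$ (a representative of an element of $\mathbf{S}=\mathbb{G}^k\otimes (E^{n_-}_{n_+}/Z^{n_-}_{n_+})$), $\eta\in\mathbf{D}$ and $h_1,h_2\in\mathbb{G}^k$ have parities $$\varepsilon(\zeta)=1,\qquad \varepsilon(\eta)=0,\qquad \varepsilon(h_1)=1,\qquad \varepsilon(h_2)=0,$$ and satisfy the relations $$\eta=-\theta h_1\, m_1(\zeta,\zeta)-\theta\,[\,2\mathcal{E}-(2+n_+-n_-)\,]\zeta-\bar\eta\,\zeta-\{\zeta,\zeta\}+h_2,$$ $$\theta\bar\eta=0,$$ $$\theta(1+n_+-n_-)h_2-\bar\eta h_2=0.$$ Then $$C=m_0+\theta h_1 m_1+\theta m_3+m_\zeta+\theta h_1 j_\zeta+\eta(z)\mu$$ is a deformation of the Poisson superalgebra $\mathbf{D}$ depending on the $k$ odd parameters. That is, $C$ is an even bilinear map $\mathbf{D}\times\mathbf{D}\to\mathbf{D}$, with leading term the Poisson bracket $m_0$, which is a Lie superbracket on $\mathbf{D}$: for all $f,g,h\in\mathbf{D}$ of definite parity, $$C(f,g)=-(-1)^{\varepsilon(f)\varepsilon(g)}C(g,f),$$ $$(-1)^{\varepsilon(f)\varepsilon(h)}C(f,C(g,h))+\mathrm{cycle}(f,g,h)=0.$$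
   Context: Let $\mathbb{K}=\mathbb{R}$ or $\mathbb{C}$. $\mathbb{G}^{m}$ denotes the Grassmann algebra over $\mathbb{K}$ with $m$ generators. Put $D^{n_-}_{n_+}=\mathcal{D}(\mathbb{R}^{n_+})\otimes\mathbb{G}^{n_-}$ and $E^{n_-}_{n_+}=C^\infty(\mathbb{R}^{n_+})\otimes\mathbb{G}^{n_-}$, where $\mathcal{D}(\mathbb{R}^{n_+})$ is the space of smooth compactly supported $\mathbb{K}$-valued functions. The generators of this $\mathbb{G}^{n_-}$ are $\xi_1,\dots,\xi_{n_-}$, the coordinates on $\mathbb{R}^{n_+}$ are $x_1,\dots,x_{n_+}$, and $z=(z_A)=(x_1,\dots,x_{n_+},\xi_1,\dots,\xi_{n_-})$. The $x_i$ are even ($\varepsilon_A=0$) and the $\xi_\alpha$ are odd ($\varepsilon_A=1$). Poisson bracket: $\{f,g\}(z)=\sum_{A,B}f(z)\frac{\overleftarrow{\partial}}{\partial z_A}\omega^{AB}\frac{\partial}{\partial z_B}g(z)$, with right and left derivatives acting on $f$ and $g$ respectively. Here $\omega^{AB}$ is the constant invertible block-diagonal matrix with blocks $\omega^{ij}$ (the canonical symplectic form on $\mathbb{R}^{n_+}$, so $n_+$ is even) and $\lambda_\alpha\delta^{\alpha\beta}$, $\lambda_\alpha=\pm1$. $Z^{n_-}_{n_+}=D^{n_-}_{n_+}\oplus\mathcal{C}_{D^{n_-}_{n_+}}(E^{n_-}_{n_+})$, where the second summand is the centralizer of $D^{n_-}_{n_+}$ in $E^{n_-}_{n_+}$ with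 respect to this bracket. Outer odd parameters: $\theta_1,\dots,\theta_k$ are odd generators of a separate Grassmann algebra $\mathbb{G}^k$. In particular, for $\theta=\theta_1$: $\theta^2=0$, and if $\theta y=0$ with $y\in\mathbb{G}^k$, then $y=\theta w$ for some $w\in\mathbb{G}^k$. Put $\mathbf{D}=\mathbb{G}^k\otimes D^{n_-}_{n_+}$, $\mathbf{E}=\mathbb{G}^k\otimes E^{n_-}_{n_+}$, $\mathbf{S}=\mathbb{G}^k\otimes(E^{n_-}_{n_+}/Z^{n_-}_{n_+})$. The parity $\varepsilon$ on these spaces is the total parity (sum of the parity in $\mathbb{G}^k$ and the parity in the second factor), with supercommutative products in $\mathbf{E}$ for the total parity (so the $\theta_i$ and $\xi_\alpha$ anticommute). The Poisson bracket, given by the same formula, makes $\mathbf{D}$ a Lie superalgebra for the total parity. Sign rule for multilinear forms: a form $M_n$ of parity $\varepsilon(M_n)$ satisfies $M_n(\theta f_1,f_2,\dots,f_n)=(-1)^{\varepsilon(\theta)\varepsilon(M_n)}\theta M_n(f_1,\dots,f_n)$ for $\theta\in\mathbb{G}^k$ of definite parity; also $M_n(f_1,\theta f_2,\dots,f_n)=M_n(f_1\theta,f_2,\dots,f_n)$, and similarly for the other arguments, and $M_n(f_1,\dots,f_n\theta)=M_n(f_1,\dots,f_n)\theta$. "Bilinear" is understood in this sense over $\mathbb{G}^k$. Integral: $\bar f=\int dz\,f(z)=\int_{\mathbb{R}^{n_+}}dx\int d\xi\,f(z)$, normalized by $\int d\xi\,\xi_1\cdots\xi_{n_-}=1$, and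 extended to $\mathbf{D}$ (with values in $\mathbb{G}^k$) as a linear form of parity $n_- \bmod 2$ according to the sign rule above. Bilinear maps, for $f,g$ of definite parity: - $m_0(f,g)=\{f,g\}$. - $m_1(f,g)=f\left(\sum_{A,B}\frac{\overleftarrow{\partial}}{\partial z_A}\omega^{AB}\frac{\partial}{\partial z_B}\right)^3 g$. The maps $m_0$ and $m_1$ are also applied to arguments in $\mathbf{E}$. - $\mathcal{E}=\mathcal{E}_z=1-\tfrac12\sum_A z_A\frac{\partial}{\partial z_A}$. - $m_3(f,g)=(-1)^{n_-\varepsilon(f)}(\mathcal{E}f)\,\bar g-(-1)^{\varepsilon(f)\varepsilon(g)+n_-\varepsilon(g)}(\mathcal{E}g)\,\bar f$. - $m_\zeta(f,g)=(-1)^{n_-\varepsilon(f)}\{\zeta,f\}\bar g-(-1)^{\varepsilon(f)\varepsilon(g)+n_-\varepsilon(g)}\{\zeta,g\}\bar f$. - $j_\zeta(f,g)=(-1)^{n_-\varepsilon(f)}m_1(\zeta,f)\bar g-(-1)^{\varepsilon(f)\varepsilon(g)+n_-\varepsilon(g)}m_1(\zeta,g)\bar f$. - $\mu(f,g)=(-1)^{\varepsilon(f)}\bar f\,\bar g$, with $\varepsilon(\mu)=0$.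
   Formalization: That the leading term is m_0 (C = m_0 when all θ_i = 0) is claimed only for ζ vanishing at θ = 0; it fails otherwise, e.g. for n_- = 3, ζ = φ(x)ξ_1ξ_2ξ_3, h_1 = h_2 = 0. All other conclusions hold for every ζ. *)

theory Defs
  imports "HOL-Analysis.Analysis"
begin

section \<open>Grassmann algebras\<close>

text \<open>
  The Grassmann algebra over a commutative ring with anticommuting generators indexed by the
  natural numbers. An element is the family of its coefficients with respect to the monomials
  \<open>e\<^sub>S = e\<^sub>i\<^sub>1 \<cdots> e\<^sub>i\<^sub>n\<close>, where \<open>S = {i\<^sub>1 < \<dots> < i\<^sub>n}\<close> is a finite set. Infinitely many coefficients
  may be nonzero, which makes coefficientwise operations total; the Grassmann algebras
  with finitely many generators are the subalgebras \<open>grassmann_on I\<close> below, with \<open>I\<close> finite.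
\<close>

typedef (overloaded) 'a grassmann = "{c :: nat set \<Rightarrow> 'a::zero. \<forall>S. infinite S \<longrightarrow> c S = 0}"
  morphisms gcoeff Abs_grassmann
  by (rule exI[of _ "\<lambda>_. 0"]) simp

definition grass :: "(nat set \<Rightarrow> 'a::zero) \<Rightarrow> 'a grassmann" where
  "grass c = Abs_grassmann (\<lambda>S. if finite S then c S else 0)"

lemma gcoeff_grass [simp]: "gcoeff (grass c) S = (if finite S then c S else 0)"
  unfolding grass_def by (subst Abs_grassmann_inverse) auto

lemma gcoeff_infinite [simp]: "infinite S \<Longrightarrow> gcoeff a S = 0"
  using gcoeff[of a] by auto

lemma grassmann_eqI: "(\<And>S. finite S \<Longrightarrow> gcoeff a S = gcoeff b S) \<Longrightarrow> a = b"
  by (metis gcoeff_infinite gcoeff_inject ext)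

definition inversions :: "nat set \<Rightarrow> nat set \<Rightarrow> nat" where
  "inversions S T = card {(i, j). i \<in> S \<and> j \<in> T \<and> j < i}"

lemma finite_inversions:
  "finite S \<Longrightarrow> finite T \<Longrightarrow> finite {(i, j). i \<in> S \<and> j \<in> T \<and> j < (i::nat)}"
  by (rule finite_subset[of _ "S \<times> T"]) auto

lemma inversions_empty [simp]: "inversions {} T = 0" "inversions S {} = 0"
  by (simp_all add: inversions_def)

lemma inversions_Un_left:
  assumes "finite S" "finite T" "finite U" "S \<inter> T = {}"
  shows "inversions (S \<union> T) U = inversions S U + inversions T U"
proof -
  have "{(i, j). i \<in> S \<union> T \<and> j \<in> U \<and> j < i} =
        {(i, j). i \<in> S \<and> j \<in> U \<and> j < i} \<union> {(i, j). i \<in> T \<and> j \<in> U \<and> j < i}"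
    by auto
  then show ?thesis
    unfolding inversions_def
    using assms by (simp only:) (rule card_Un_disjoint, auto simp: finite_inversions)
qed

lemma inversions_Un_right:
  assumes "finite S" "finite T" "finite U" "T \<inter> U = {}"
  shows "inversions S (T \<union> U) = inversions S T + inversions S U"
proof -
  have "{(i, j). i \<in> S \<and> j \<in> T \<union> U \<and> j < i} =
        {(i, j). i \<in> S \<and> j \<in> T \<and> j < i} \<union> {(i, j). i \<in> S \<and> j \<in> U \<and> j < i}"
    by auto
  then show ?thesis
    unfolding inversions_def
    using assms by (simp only:) (rule card_Un_disjoint, auto simp: finite_inversions)
qed

instantiation grassmann :: (comm_ring_1) ring_1
begin

definition "0 = grass (\<lambda>_. 0)"
definition "1 = grass (\<lambda>S. if S = {} then 1 else 0)"
definition "a + b = grass (\<lambda>S. gcoeff a S + gcoeff b S)"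
definition "- a = grass (\<lambda>S. - gcoeff a S)"
definition "a - b = grass (\<lambda>S. gcoeff a S - gcoeff b S)" for a b :: "'a grassmann"

text \<open>\<open>e\<^sub>T e\<^sub>U = (-1)\<^bsup>inversions T U\<^esup> e\<^sub>T\<^sub>\<union>\<^sub>U\<close> for disjoint \<open>T\<close> and \<open>U\<close>, and \<open>e\<^sub>T e\<^sub>U = 0\<close> otherwise.\<close>

definition "a * b = grass (\<lambda>S. \<Sum>T\<in>Pow S.
  (-1) ^ inversions T (S - T) * gcoeff a T * gcoeff b (S - T))"

lemma gcoeff_0 [simp]: "gcoeff 0 S = 0"
  and gcoeff_1: "gcoeff 1 S = (if S = {} then 1 else 0)"
  and gcoeff_add [simp]: "gcoeff (a + b) S = gcoeff a S + gcoeff b S"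
  and gcoeff_uminus [simp]: "gcoeff (- a) S = - gcoeff a S"
  and gcoeff_diff [simp]: "gcoeff (a - b) S = gcoeff a S - gcoeff b S"
  for a b :: "'a grassmann"
  by (simp_all add: zero_grassmann_def one_grassmann_def plus_grassmann_def
      uminus_grassmann_def minus_grassmann_def)

lemma gcoeff_mult:
  "gcoeff (a * b) S =
    (\<Sum>T\<in>Pow S. (-1) ^ inversions T (S - T) * gcoeff a T * gcoeff b (S - T))"
  if "finite S" for a b :: "'a grassmann"
  using that by (simp add: times_grassmann_def)

instance
proof
  fix a b c :: "'a grassmann"
  show "a * b * c = a * (b * c)"
  proof (rule grassmann_eqI)
    fix S :: "nat set" assume S: "finite S"
    let ?s = "\<lambda>T U. (-1) ^ inversions T U :: 'a"
    have fS: "finite T" if "T \<subseteq> S" for T using that S finite_subset by auto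
    have "gcoeff (a * b * c) S = (\<Sum>U\<in>Pow S. \<Sum>T\<in>Pow U.
        ?s U (S - U) * ?s T (U - T) * gcoeff a T * gcoeff b (U - T) * gcoeff c (S - U))"
      unfolding gcoeff_mult[OF S]
      by (rule sum.cong[OF refl])
        (simp add: gcoeff_mult fS sum_distrib_left sum_distrib_right mult.assoc)
    also have "\<dots> = (\<Sum>(U, T)\<in>Sigma (Pow S) Pow.
        ?s U (S - U) * ?s T (U - T) * gcoeff a T * gcoeff b (U - T) * gcoeff c (S - U))"
      using S fS by (subst sum.Sigma) auto
    also have "\<dots> = (\<Sum>(T, V)\<in>Sigma (Pow S) (\<lambda>T. Pow (S - T)).
        ?s T (S - T) * ?s V (S - T - V) * gcoeff a T * gcoeff b V * gcoeff c (S - T - V))"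
    proof (rule sum.reindex_bij_witness[of _ "\<lambda>(T, V). (T \<union> V, T)" "\<lambda>(U, T). (T, U - T)"],
        goal_cases)
      case (5 p)
      obtain U T where p: "p = (U, T)" and UT: "U \<subseteq> S" "T \<subseteq> U" using 5 by auto
      have e: "U = T \<union> (U - T)" "S - T = (U - T) \<union> (S - U)" "S - T - (U - T) = S - U"
        using UT by auto
      have f: "finite T" "finite (U - T)" "finite (S - U)" using fS UT S by auto
      have "inversions U (S - U) = inversions T (S - U) + inversions (U - T) (S - U)"
        by (subst e(1), rule inversions_Un_left) (use f in auto)
      moreover have "inversions T (S - T) = inversions T (U - T) + inversions T (S - U)"
        by (subst e(2), rule inversions_Un_right) (use f in auto)
      ultimately show ?case by (simp add: p e(3) power_add)
    qed auto
    also have "\<dots> = (\<Sum>T\<in>Pow S. \<Sum>V\<in>Pow (S - T).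
        ?s T (S - T) * ?s V (S - T - V) * gcoeff a T * gcoeff b V * gcoeff c (S - T - V))"
      using S by (subst sum.Sigma) auto
    also have "\<dots> = gcoeff (a * (b * c)) S"
      using S by (simp add: gcoeff_mult sum_distrib_left mult_ac)
    finally show "gcoeff (a * b * c) S = gcoeff (a * (b * c)) S" .
  qed
  show "1 * a = a"
  proof (rule grassmann_eqI)
    fix S :: "nat set" assume S: "finite S"
    have "gcoeff (1 * a) S = (\<Sum>T\<in>{{}}. (-1) ^ inversions T (S - T) * gcoeff 1 T * gcoeff a (S - T))"
      unfolding gcoeff_mult[OF S] by (rule sum.mono_neutral_right) (use S in \<open>auto simp: gcoeff_1\<close>)
    then show "gcoeff (1 * a) S = gcoeff a S" by (simp add: gcoeff_1)
  qed
  show "a * 1 = a"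
  proof (rule grassmann_eqI)
    fix S :: "nat set" assume S: "finite S"
    have "gcoeff (a * 1) S = (\<Sum>T\<in>{S}. (-1) ^ inversions T (S - T) * gcoeff a T * gcoeff 1 (S - T))"
      unfolding gcoeff_mult[OF S] by (rule sum.mono_neutral_right) (use S in \<open>auto simp: gcoeff_1\<close>)
    then show "gcoeff (a * 1) S = gcoeff a S" by (simp add: gcoeff_1)
  qed
  show "(0::'a grassmann) \<noteq> 1"
    by (metis gcoeff_0 gcoeff_1 zero_neq_one)
qed (rule grassmann_eqI; simp add: gcoeff_mult algebra_simps sum.distrib)+

end

definition gscalar :: "'a::comm_ring_1 \<Rightarrow> 'a grassmann" where
  "gscalar c = grass (\<lambda>S. if S = {} then c else 0)"

definition ggen :: "nat \<Rightarrow> 'a::comm_ring_1 grassmann" where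
  "ggen i = grass (\<lambda>S. if S = {i} then 1 else 0)"

definition grassmann_on :: "nat set \<Rightarrow> 'a::comm_ring_1 grassmann set" where
  "grassmann_on I = {a. \<forall>S. gcoeff a S \<noteq> 0 \<longrightarrow> S \<subseteq> I}"

text \<open>Parities are natural numbers, considered modulo 2.\<close>

definition gparity :: "nat \<Rightarrow> 'a::comm_ring_1 grassmann \<Rightarrow> bool" where
  "gparity e a \<longleftrightarrow> (\<forall>S. gcoeff a S \<noteq> 0 \<longrightarrow> card S mod 2 = e mod 2)"

definition gpart :: "nat \<Rightarrow> 'a::comm_ring_1 grassmann \<Rightarrow> 'a grassmann" where
  "gpart e a = grass (\<lambda>S. if card S mod 2 = e mod 2 then gcoeff a S else 0)"

text \<open>
  Left and right derivatives with respect to the generator \<open>e\<^sub>j\<close>: the factor \<open>e\<^sub>j\<close> is moved to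
  the left, respectively right, end of each monomial and then removed.
\<close>

definition gderiv_left :: "nat \<Rightarrow> 'a::comm_ring_1 grassmann \<Rightarrow> 'a grassmann" where
  "gderiv_left j a = grass (\<lambda>S. if j \<in> S then 0
     else (-1) ^ card {i\<in>S. i < j} * gcoeff a (insert j S))"

definition gderiv_right :: "nat \<Rightarrow> 'a::comm_ring_1 grassmann \<Rightarrow> 'a grassmann" where
  "gderiv_right j a = grass (\<lambda>S. if j \<in> S then 0
     else (-1) ^ card {i\<in>S. j < i} * gcoeff a (insert j S))"


section \<open>Smooth functions\<close>

definition partial_deriv ::
  "'n::finite \<Rightarrow> (real ^ 'n \<Rightarrow> 'a::real_normed_vector) \<Rightarrow> real ^ 'n \<Rightarrow> 'a" where
  "partial_deriv i f x = frechet_derivative f (at x) (axis i 1)"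

primrec C_diff :: "nat \<Rightarrow> (real ^ 'n::finite \<Rightarrow> 'a::real_normed_vector) \<Rightarrow> bool" where
  "C_diff 0 f \<longleftrightarrow> continuous_on UNIV f"
| "C_diff (Suc r) f \<longleftrightarrow> (\<forall>x. f differentiable (at x)) \<and> (\<forall>i. C_diff r (partial_deriv i f))"

definition smooth :: "(real ^ 'n::finite \<Rightarrow> 'a::real_normed_vector) \<Rightarrow> bool" where
  "smooth f \<longleftrightarrow> (\<forall>r. C_diff r f)"

definition test_function :: "(real ^ 'n::finite \<Rightarrow> 'a::real_normed_vector) \<Rightarrow> bool" where
  "test_function f \<longleftrightarrow> smooth f \<and> compact (closure {x. f x \<noteq> 0})"


section \<open>Superfields\<close>

text \<open>
  The ground field is a type of class \<open>{real_normed_field, euclidean_space}\<close>, that is, the real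
  or the complex numbers.

  The space \<open>\<bbbG>\<^sup>k \<otimes> C\<^sup>\<infinity>(\<real>\<^sup>n) \<otimes> \<bbbG>\<^sup>m\<close> is realised as the space of functions on \<open>\<real>\<^sup>n\<close> with values in the
  Grassmann algebra with \<open>k + m\<close> generators and with smooth coefficients. The outer parameters
  \<open>\<theta>\<^sub>1, \<dots>, \<theta>\<^sub>k\<close> are the generators \<open>0, \<dots>, k - 1\<close> and \<open>\<xi>\<^sub>1, \<dots>, \<xi>\<^sub>m\<close> are the generators
  \<open>k, \<dots>, k + m - 1\<close>; all of them anticommute, and the parity is the total one. The outer
  algebra \<open>\<bbbG>\<^sup>k\<close> is \<open>grassmann_on {..<k}\<close>.
\<close>

type_synonym ('n, 'a) superfield = "real ^ 'n \<Rightarrow> 'a grassmann"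

definition sf_E :: "nat \<Rightarrow> nat \<Rightarrow>
  ('n::finite, 'a::{real_normed_field, euclidean_space}) superfield set" where
  "sf_E k m = {f. (\<forall>x. f x \<in> grassmann_on {..<k + m}) \<and> (\<forall>S. smooth (\<lambda>x. gcoeff (f x) S))}"

definition sf_D :: "nat \<Rightarrow> nat \<Rightarrow>
  ('n::finite, 'a::{real_normed_field, euclidean_space}) superfield set" where
  "sf_D k m = {f. (\<forall>x. f x \<in> grassmann_on {..<k + m}) \<and>
                  (\<forall>S. test_function (\<lambda>x. gcoeff (f x) S))}"

definition sf_parity :: "nat \<Rightarrow> ('n::finite, 'a::comm_ring_1) superfield \<Rightarrow> bool" where
  "sf_parity e f \<longleftrightarrow> (\<forall>x. gparity e (f x))"

text \<open>
  The coordinates \<open>z\<^sub>A\<close> are indexed by \<open>'n + nat\<close>: \<open>Inl i\<close> stands for \<open>x\<^sub>i\<close>, and \<open>Inr \<alpha>\<close> with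
  \<open>\<alpha> < m\<close> for the odd coordinate that is the generator number \<open>k + \<alpha>\<close>.
\<close>

definition coords :: "nat \<Rightarrow> ('n::finite + nat) set" where
  "coords m = UNIV <+> {..<m}"

fun coord :: "nat \<Rightarrow> 'n::finite + nat \<Rightarrow>
  ('n, 'a::{real_normed_field, euclidean_space}) superfield" where
  "coord k (Inl i) x = gscalar (of_real (x $ i))"
| "coord k (Inr \<alpha>) x = ggen (k + \<alpha>)"

fun dleft :: "nat \<Rightarrow> 'n::finite + nat \<Rightarrow>
  ('n, 'a::{real_normed_field, euclidean_space}) superfield \<Rightarrow> ('n, 'a) superfield" where
  "dleft k (Inl i) f x = grass (\<lambda>S. partial_deriv i (\<lambda>y. gcoeff (f y) S) x)"
| "dleft k (Inr \<alpha>) f x = gderiv_left (k + \<alpha>) (f x)"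

fun dright :: "nat \<Rightarrow> 'n::finite + nat \<Rightarrow>
  ('n, 'a::{real_normed_field, euclidean_space}) superfield \<Rightarrow> ('n, 'a) superfield" where
  "dright k (Inl i) f x = grass (\<lambda>S. partial_deriv i (\<lambda>y. gcoeff (f y) S) x)"
| "dright k (Inr \<alpha>) f x = gderiv_right (k + \<alpha>) (f x)"

text \<open>
  The even dimension is \<open>n\<^sub>+ = CARD('p + 'p) = 2 * CARD('p)\<close>; the canonical symplectic form pairs
  the coordinate \<open>Inl i\<close> (a position) with the coordinate \<open>Inr i\<close> (its momentum).
\<close>

fun canonical_form :: "'p + 'p \<Rightarrow> 'p + 'p \<Rightarrow> 'a::comm_ring_1" where
  "canonical_form (Inl i) (Inr j) = (if i = j then 1 else 0)"
| "canonical_form (Inr i) (Inl j) = (if i = j then -1 else 0)"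
| "canonical_form (Inl i) (Inl j) = 0"
| "canonical_form (Inr i) (Inr j) = 0"

fun omega :: "(nat \<Rightarrow> 'a) \<Rightarrow> ('p + 'p) + nat \<Rightarrow> ('p + 'p) + nat \<Rightarrow> 'a::comm_ring_1" where
  "omega lam (Inl i) (Inl j) = canonical_form i j"
| "omega lam (Inr \<alpha>) (Inr \<beta>) = (if \<alpha> = \<beta> then lam \<alpha> else 0)"
| "omega lam (Inl i) (Inr \<beta>) = 0"
| "omega lam (Inr \<alpha>) (Inl j) = 0"

definition poisson :: "nat \<Rightarrow> nat \<Rightarrow> (nat \<Rightarrow> 'a) \<Rightarrow>
  ('p::finite + 'p, 'a::{real_normed_field, euclidean_space}) superfield \<Rightarrow>
  ('p + 'p, 'a) superfield \<Rightarrow> ('p + 'p, 'a) superfield" where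
  "poisson k m lam f g x =
     (\<Sum>A\<in>coords m. \<Sum>B\<in>coords m. dright k A f x * gscalar (omega lam A B) * dleft k B g x)"

text \<open>
  \<open>bidiff_pow k m lam r f g\<close> is \<open>f (\<Sum>\<^sub>A\<^sub>B \<partial>\<^sub>A \<omega>\<^sup>A\<^sup>B \<partial>\<^sub>B)\<^sup>r g\<close>, where the right derivatives \<open>\<partial>\<^sub>A\<close> act on \<open>f\<close>
  and the left derivatives \<open>\<partial>\<^sub>B\<close> act on \<open>g\<close>. There is no ordering ambiguity: interchanging
  a right derivative with a left one of an earlier factor costs the same sign as
  interchanging the two corresponding left derivatives, since \<open>\<omega>\<^sup>A\<^sup>B\<close> is even.
\<close>

fun bidiff_pow :: "nat \<Rightarrow> nat \<Rightarrow> (nat \<Rightarrow> 'a) \<Rightarrow> nat \<Rightarrow>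
  ('p::finite + 'p, 'a::{real_normed_field, euclidean_space}) superfield \<Rightarrow>
  ('p + 'p, 'a) superfield \<Rightarrow> ('p + 'p, 'a) superfield" where
  "bidiff_pow k m lam 0 f g x = f x * g x"
| "bidiff_pow k m lam (Suc r) f g x =
     (\<Sum>A\<in>coords m. \<Sum>B\<in>coords m.
        gscalar (omega lam A B) * bidiff_pow k m lam r (dright k A f) (dleft k B g) x)"

definition euler :: "nat \<Rightarrow> nat \<Rightarrow>
  ('n::finite, 'a::{real_normed_field, euclidean_space}) superfield \<Rightarrow> ('n, 'a) superfield" where
  "euler k m f x = f x - gscalar (1 / 2) * (\<Sum>A\<in>coords m. coord k A x * dleft k A f x)"

text \<open>
  The integral with values in \<open>\<bbbG>\<^sup>k\<close>. The sign is the one in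
  \<open>\<integral> (e\<^sub>S f) = (-1)\<^bsup>m * card S\<^esup> e\<^sub>S \<integral> f\<close> for \<open>S \<subseteq> {..<k}\<close>, the integral being of parity \<open>m\<close>.
\<close>

definition sf_integral :: "nat \<Rightarrow> nat \<Rightarrow>
  ('n::finite, 'a::{real_normed_field, euclidean_space}) superfield \<Rightarrow> 'a grassmann" where
  "sf_integral k m f = grass (\<lambda>S. if S \<subseteq> {..<k}
     then (-1) ^ (m * card S) * (LINT x|lborel. gcoeff (f x) (S \<union> {k..<k + m})) else 0)"


section \<open>Bilinear maps\<close>

text \<open>
  Biadditive extension of a map \<open>M a b f g\<close>, given by a formula for arguments \<open>f\<close> of parity
  \<open>a\<close> and \<open>g\<close> of parity \<open>b\<close>, to arguments without definite parity.
\<close>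

definition parity_ext ::
  "(nat \<Rightarrow> nat \<Rightarrow> ('n, 'a) superfield \<Rightarrow> ('n, 'a) superfield \<Rightarrow> ('n, 'a) superfield) \<Rightarrow>
   ('n::finite, 'a::comm_ring_1) superfield \<Rightarrow> ('n, 'a) superfield \<Rightarrow> ('n, 'a) superfield" where
  "parity_ext M f g x =
     (\<Sum>a\<in>{0, 1}. \<Sum>b\<in>{0, 1}. M a b (\<lambda>y. gpart a (f y)) (\<lambda>y. gpart b (g y)) x)"

context
  fixes k m :: nat and lam :: "nat \<Rightarrow> 'a::{real_normed_field, euclidean_space}"
begin

definition m0 :: "('p::finite + 'p, 'a) superfield \<Rightarrow> ('p + 'p, 'a) superfield \<Rightarrow>
    ('p + 'p, 'a) superfield" where
  "m0 = poisson k m lam"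

definition m1 :: "('p::finite + 'p, 'a) superfield \<Rightarrow> ('p + 'p, 'a) superfield \<Rightarrow>
    ('p + 'p, 'a) superfield" where
  "m1 = bidiff_pow k m lam 3"

definition m3 :: "('p::finite + 'p, 'a) superfield \<Rightarrow> ('p + 'p, 'a) superfield \<Rightarrow>
    ('p + 'p, 'a) superfield" where
  "m3 = parity_ext (\<lambda>a b f g x.
     (-1) ^ (m * a) * euler k m f x * sf_integral k m g
     - (-1) ^ (a * b + m * b) * euler k m g x * sf_integral k m f)"

definition m_zeta :: "('p::finite + 'p, 'a) superfield \<Rightarrow> ('p + 'p, 'a) superfield \<Rightarrow>
    ('p + 'p, 'a) superfield \<Rightarrow> ('p + 'p, 'a) superfield" where
  "m_zeta \<zeta> = parity_ext (\<lambda>a b f g x.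
     (-1) ^ (m * a) * m0 \<zeta> f x * sf_integral k m g
     - (-1) ^ (a * b + m * b) * m0 \<zeta> g x * sf_integral k m f)"

definition j_zeta :: "('p::finite + 'p, 'a) superfield \<Rightarrow> ('p + 'p, 'a) superfield \<Rightarrow>
    ('p + 'p, 'a) superfield \<Rightarrow> ('p + 'p, 'a) superfield" where
  "j_zeta \<zeta> = parity_ext (\<lambda>a b f g x.
     (-1) ^ (m * a) * m1 \<zeta> f x * sf_integral k m g
     - (-1) ^ (a * b + m * b) * m1 \<zeta> g x * sf_integral k m f)"

definition mu :: "('p::finite + 'p, 'a) superfield \<Rightarrow> ('p + 'p, 'a) superfield \<Rightarrow>
    ('p + 'p, 'a) superfield" where
  "mu = parity_ext (\<lambda>a b f g x. (-1) ^ a * sf_integral k m f * sf_integral k m g)"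

definition deformed_bracket :: "'a grassmann \<Rightarrow> 'a grassmann \<Rightarrow>
    ('p::finite + 'p, 'a) superfield \<Rightarrow> ('p + 'p, 'a) superfield \<Rightarrow>
    ('p + 'p, 'a) superfield \<Rightarrow> ('p + 'p, 'a) superfield \<Rightarrow> ('p + 'p, 'a) superfield" where
  "deformed_bracket \<theta> h\<^sub>1 \<zeta> \<eta> f g x =
     m0 f g x + \<theta> * h\<^sub>1 * m1 f g x + \<theta> * m3 f g x
     + m_zeta \<zeta> f g x + \<theta> * h\<^sub>1 * j_zeta \<zeta> f g x + \<eta> x * mu f g x"

end

text \<open>Bilinear maps of parity \<open>e\<close> over the outer algebra, in the sense of the sign rule.\<close>

definition super_bilinear :: "nat \<Rightarrow> nat \<Rightarrow> nat \<Rightarrow>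
  (('n, 'a) superfield \<Rightarrow> ('n, 'a) superfield \<Rightarrow>
   ('n::finite, 'a::{real_normed_field, euclidean_space}) superfield) \<Rightarrow> bool" where
  "super_bilinear k m e M \<longleftrightarrow>
     (\<forall>f\<in>sf_D k m. \<forall>g\<in>sf_D k m. M f g \<in> sf_D k m) \<and>
     (\<forall>f\<in>sf_D k m. \<forall>g\<in>sf_D k m. \<forall>a b.
        sf_parity a f \<and> sf_parity b g \<longrightarrow> sf_parity (a + b + e) (M f g)) \<and>
     (\<forall>f\<in>sf_D k m. \<forall>f'\<in>sf_D k m. \<forall>g\<in>sf_D k m.
        M (\<lambda>x. f x + f' x) g = (\<lambda>x. M f g x + M f' g x) \<and>
        M g (\<lambda>x. f x + f' x) = (\<lambda>x. M g f x + M g f' x)) \<and>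
     (\<forall>f\<in>sf_D k m. \<forall>g\<in>sf_D k m. \<forall>t\<in>grassmann_on {..<k}.
        (\<forall>a. gparity a t \<longrightarrow> M (\<lambda>x. t * f x) g = (\<lambda>x. (-1) ^ (a * e) * t * M f g x)) \<and>
        M f (\<lambda>x. t * g x) = M (\<lambda>x. f x * t) g \<and>
        M f (\<lambda>x. g x * t) = (\<lambda>x. M f g x * t))"

definition lie_superbracket :: "nat \<Rightarrow> nat \<Rightarrow>
  (('n, 'a) superfield \<Rightarrow> ('n, 'a) superfield \<Rightarrow>
   ('n::finite, 'a::{real_normed_field, euclidean_space}) superfield) \<Rightarrow> bool" where
  "lie_superbracket k m C \<longleftrightarrow>
     (\<forall>f\<in>sf_D k m. \<forall>g\<in>sf_D k m. \<forall>a b.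
        sf_parity a f \<and> sf_parity b g \<longrightarrow>
        C f g = (\<lambda>x. - ((-1) ^ (a * b)) * C g f x)) \<and>
     (\<forall>f\<in>sf_D k m. \<forall>g\<in>sf_D k m. \<forall>h\<in>sf_D k m. \<forall>a b c.
        sf_parity a f \<and> sf_parity b g \<and> sf_parity c h \<longrightarrow>
        (\<forall>x. (-1) ^ (a * c) * C f (C g h) x
           + (-1) ^ (b * a) * C g (C h f) x
           + (-1) ^ (c * b) * C h (C f g) x = 0))"

text \<open>The value at \<open>\<theta>\<^sub>1 = \<dots> = \<theta>\<^sub>k = 0\<close>.\<close>

definition at_theta_0 :: "nat \<Rightarrow> 'a::comm_ring_1 grassmann \<Rightarrow> 'a grassmann" where
  "at_theta_0 k a = grass (\<lambda>S. if S \<inter> {..<k} = {} then gcoeff a S else 0)"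

end

theory Submission
  imports Defs "HOL-Library.Function_Algebras"
begin

text \<open>
  Let \<open>\<gamma>\<close> be the parity automorphism, \<open>\<gamma> f = (-1)\<^bsup>\<epsilon>(f)\<^esup> f\<close>, and put
  \<open>[f, g] = {f, g} + \<theta> h\<^sub>1 m\<^sub>1(f, g)\<close> and \<open>K f = \<theta> \<E> f + [\<zeta>, f]\<close>. Since the number \<open>m\<close> of odd coordinates
  is odd, the integral is an odd form, and the bracket of the theorem is
  \<open>C(f, g) = [f, g] + K(\<gamma> f) \<integral>g + \<integral>(\<gamma> f) K g + \<integral>(\<gamma> f) \<eta> \<integral>g\<close>, a formula without signs that makes sense
  for all \<open>f\<close> and \<open>g\<close>; bilinearity over the outer parameters can be read off from it.

  The bracket \<open>[\<cdot>, \<cdot>]\<close> is a Lie superbracket, because \<open>(\<theta> h\<^sub>1)\<^sup>2 = 0\<close>, the Poisson bracket satisfies the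
  Jacobi identity (\<open>jacobi_B1\<close>) and \<open>m\<^sub>1\<close> is a cocycle for it (\<open>cocycle_B3\<close>). The operator \<open>K\<close> is an
  odd derivation of \<open>[\<cdot>, \<cdot>]\<close>, as the Euler operator \<open>\<E>\<close> is an even derivation of the Poisson bracket
  (\<open>K_bracket\<close>), and integration by parts gives \<open>2 \<integral>K f = -(2 + n - m) \<theta> \<integral>f\<close>,
  where \<open>n\<close> is the number of even coordinates. With the odd constant
  \<open>\<omega> = (2 + n - m) \<theta> - \<integral>\<eta>\<close> the equation for \<open>\<eta>\<close> reads \<open>\<eta> = -[\<zeta>, \<zeta>] - 2 \<theta> \<E> \<zeta> + \<omega> \<zeta> + h\<^sub>2\<close>. It says that
  \<open>2 K\<^sup>2 = \<omega> K - [\<eta>, \<cdot>]\<close> (\<open>K_K\<close>), and the equation for \<open>h\<^sub>2\<close> then says that \<open>K \<eta> = \<omega> \<eta>\<close> (\<open>K_\<eta>\<close>).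

  Now sort the Jacobi identity of \<open>C\<close> by the number of integrals in a term. The terms without integrals
  cancel by the Jacobi identity of \<open>[\<cdot>, \<cdot>]\<close>, those with one integral because \<open>K\<close> is a derivation,
  those with two integrals by the formula for \<open>K\<^sup>2\<close>, and those with three by \<open>K \<eta> = \<omega> \<eta>\<close>
  (\<open>deformed_deformed\<close>, \<open>jacobi_linear_terms\<close>, \<open>jacobi_quadratic_terms\<close>).

  For the cocycle condition, \<open>B r f (B s g h)\<close> is \<open>(P\<^sub>1\<^sub>2 + P\<^sub>1\<^sub>3)\<^sup>r P\<^sub>2\<^sub>3\<^sup>s\<close> applied to the product of three
  arguments, where \<open>B r\<close> is the \<open>r\<close>-th power of the Poisson bidifferential operator and the \<open>P\<^sub>i\<^sub>j\<close>
  contract the arguments \<open>i\<close> and \<open>j\<close> and commute with each other. A rotation of the arguments permutes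
  \<open>a = P\<^sub>1\<^sub>2\<close>, \<open>b = P\<^sub>2\<^sub>3\<close>, \<open>c = -P\<^sub>1\<^sub>3\<close> cyclically, and the cyclic sums of \<open>(a - c) b\<close> and of
  \<open>(a - c) b\<^sup>3 + (a - c)\<^sup>3 b\<close> vanish as polynomials.

  These arguments are carried out in a ring with a parity automorphism, derivations and an odd
  integral. Superfields form such a ring by the Leibniz rule in Grassmann algebras, the symmetry
  of second derivatives and the vanishing of the integral of a derivative
  (\<open>superfields_integrated_superspace\<close>).

  If \<open>\<zeta>\<close> vanishes at \<open>\<theta> = 0\<close>, then there \<open>\<eta>\<close> is equal to the constant \<open>h\<^sub>2\<close>, which has to vanish since
  \<open>\<eta>\<close> has compact support; hence only the Poisson bracket survives in \<open>C\<close>.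
\<close>

section \<open>Supercommutative rings\<close>

text \<open>
  The grading modulo 2 is encoded by its parity automorphism. In this form the sign rules make
  sense for elements without definite parity, and most identities below hold for all elements.
\<close>

locale supercommutative_ring =
  fixes gam :: "'r::ring_1 \<Rightarrow> 'r"
  assumes gam_add: "gam (x + y) = gam x + gam y"
    and gam_mult: "gam (x * y) = gam x * gam y"
    and gam_gam: "gam (gam x) = x"
    and even_commute: "gam x = x \<Longrightarrow> x * y = y * x"
    and odd_commute: "gam x = - x \<Longrightarrow> x * y = gam y * x"
begin

lemma gam_0: "gam 0 = 0"
  by (metis add_cancel_right_right gam_add)

lemma gam_1: "gam 1 = 1"
  by (metis gam_gam gam_mult mult.right_neutral mult_1)

lemma gam_minus: "gam (- x) = - gam x"
  by (metis add_eq_0_iff gam_add gam_0)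

lemma gam_diff: "gam (x - y) = gam x - gam y"
  by (metis gam_add gam_minus diff_conv_add_uminus)

lemma gam_sum: "gam (sum f X) = (\<Sum>x\<in>X. gam (f x))"
  by (induction X rule: infinite_finite_induct) (auto simp: gam_0 gam_add)

definition hom :: "nat \<Rightarrow> 'r \<Rightarrow> bool" where
  "hom a f \<longleftrightarrow> gam f = (-1) ^ a * f"

lemma hom_gam: "hom a f \<Longrightarrow> gam f = (if even a then f else - f)"
  by (auto simp: hom_def)

lemma hom_mult: "hom a f \<Longrightarrow> hom b g \<Longrightarrow> hom (a + b) (f * g)"
  by (auto simp: hom_def gam_mult minus_one_power_iff)

lemma hom_commute: "hom a f \<Longrightarrow> hom b g \<Longrightarrow> g * f = (-1) ^ (a * b) * (f * g)"
  using even_commute[of f g] odd_commute[of f g]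
  by (cases "even a"; cases "even b") (auto simp: hom_def)

end

section \<open>Powers of the Poisson bidifferential operator\<close>

text \<open>
  \<open>S\<close> stands for the smooth superfields, \<open>G\<close> for the constants of the outer Grassmann algebra and
  \<open>d A\<close> for the left derivative with respect to the coordinate \<open>A\<close>. The form \<open>\<omega>\<^sup>A\<^sup>B\<close> pairs every
  coordinate \<open>A\<close> with exactly one coordinate \<open>p A\<close>, with the coefficient \<open>w A\<close>; that it is antisymmetric
  on the even and symmetric on the odd coordinates is the assumption on \<open>w (p A)\<close>.
\<close>

locale superspace = supercommutative_ring gam for gam :: "'r::ring_1 \<Rightarrow> 'r" +
  fixes S G :: "'r set"
    and I :: "'i set" and isodd :: "'i \<Rightarrow> bool"
    and d :: "'i \<Rightarrow> 'r \<Rightarrow> 'r"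
    and p :: "'i \<Rightarrow> 'i" and w :: "'i \<Rightarrow> 'r"
  assumes finite_I: "finite I"
    and G_1: "1 \<in> G"
    and G_add: "t \<in> G \<Longrightarrow> u \<in> G \<Longrightarrow> t + u \<in> G"
    and G_minus: "t \<in> G \<Longrightarrow> - t \<in> G"
    and G_mult: "t \<in> G \<Longrightarrow> u \<in> G \<Longrightarrow> t * u \<in> G"
    and G_gam: "t \<in> G \<Longrightarrow> gam t \<in> G"
    and G_S: "t \<in> G \<Longrightarrow> t \<in> S"
    and d_G: "A \<in> I \<Longrightarrow> t \<in> G \<Longrightarrow> d A t = 0"
    and S_add: "f \<in> S \<Longrightarrow> g \<in> S \<Longrightarrow> f + g \<in> S"
    and S_minus: "f \<in> S \<Longrightarrow> - f \<in> S"
    and S_mult: "f \<in> S \<Longrightarrow> g \<in> S \<Longrightarrow> f * g \<in> S"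
    and S_gam: "f \<in> S \<Longrightarrow> gam f \<in> S"
    and S_d: "A \<in> I \<Longrightarrow> f \<in> S \<Longrightarrow> d A f \<in> S"
    and d_add: "A \<in> I \<Longrightarrow> f \<in> S \<Longrightarrow> g \<in> S \<Longrightarrow> d A (f + g) = d A f + d A g"
    and d_mult: "A \<in> I \<Longrightarrow> f \<in> S \<Longrightarrow> g \<in> S \<Longrightarrow>
      d A (f * g) = d A f * g + (if isodd A then gam f else f) * d A g"
    and d_d: "A \<in> I \<Longrightarrow> B \<in> I \<Longrightarrow> f \<in> S \<Longrightarrow>
      d A (d B f) = (if isodd A \<and> isodd B then - d B (d A f) else d B (d A f))"
    and gam_d: "A \<in> I \<Longrightarrow> f \<in> S \<Longrightarrow>
      gam (d A f) = (if isodd A then - d A (gam f) else d A (gam f))"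
    and G_w: "A \<in> I \<Longrightarrow> w A \<in> G"
    and gam_w: "A \<in> I \<Longrightarrow> gam (w A) = w A"
    and I_p: "A \<in> I \<Longrightarrow> p A \<in> I"
    and p_p: "A \<in> I \<Longrightarrow> p (p A) = A"
    and isodd_p: "A \<in> I \<Longrightarrow> isodd (p A) = isodd A"
    and w_p: "A \<in> I \<Longrightarrow> w (p A) = (if isodd A then w A else - w A)"
begin

text \<open>
  The right derivative of \<open>f\<close> is \<open>tw A (d A f)\<close>: moving an odd derivative from the left to the right end
  of a monomial of degree \<open>e\<close> costs the sign \<open>(-1)\<^bsup>e - 1\<^esup>\<close>, and the derivative has degree \<open>e - 1\<close>.
\<close>

definition tw :: "'i \<Rightarrow> 'r \<Rightarrow> 'r" where
  "tw A f = (if isodd A then gam f else f)"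

lemma S_1: "1 \<in> S" using G_S[OF G_1] .

lemma S_w: "A \<in> I \<Longrightarrow> w A \<in> S" using G_S[OF G_w] .

lemma d_w: "A \<in> I \<Longrightarrow> C \<in> I \<Longrightarrow> d A (w C) = 0" using d_G[OF _ G_w] .

lemma S_0: "0 \<in> S" using S_add[OF S_1 S_minus[OF S_1]] by simp

lemma S_diff: "f \<in> S \<Longrightarrow> g \<in> S \<Longrightarrow> f - g \<in> S"
  using S_add[of f "- g"] S_minus[of g] by simp

lemma S_sum: "(\<And>x. x \<in> X \<Longrightarrow> f x \<in> S) \<Longrightarrow> sum f X \<in> S"
  by (induction X rule: infinite_finite_induct) (auto simp: S_0 S_add)

lemma S_tw: "f \<in> S \<Longrightarrow> tw A f \<in> S"
  by (simp add: tw_def S_gam)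

lemmas S_intros = S_1 S_0 S_add S_minus S_diff S_mult S_gam S_d S_tw S_w I_p S_sum

lemma d_0: "A \<in> I \<Longrightarrow> d A 0 = 0"
  using d_add[of A 0 0] by (simp add: S_0)

lemma d_minus: "A \<in> I \<Longrightarrow> f \<in> S \<Longrightarrow> d A (- f) = - d A f"
  using d_add[of A f "- f"] by (simp add: d_0 S_minus eq_neg_iff_add_eq_0 add.commute)

lemma d_sum: "A \<in> I \<Longrightarrow> (\<And>x. x \<in> X \<Longrightarrow> f x \<in> S) \<Longrightarrow> d A (sum f X) = (\<Sum>x\<in>X. d A (f x))"
  by (induction X rule: infinite_finite_induct) (auto simp: d_0 d_add S_sum)

lemma w_commute: "A \<in> I \<Longrightarrow> w A * x = x * w A"
  by (rule even_commute) (rule gam_w)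

lemma w_left_commute: "A \<in> I \<Longrightarrow> x * (w A * y) = w A * (x * y)"
  by (metis w_commute mult.assoc)

lemma d_w_mult: "A \<in> I \<Longrightarrow> B \<in> I \<Longrightarrow> f \<in> S \<Longrightarrow> d A (w B * f) = w B * d A f"
  by (simp add: d_mult S_w d_w gam_w)

lemma hom_d: "A \<in> I \<Longrightarrow> f \<in> S \<Longrightarrow> hom a f \<Longrightarrow> hom (a + of_bool (isodd A)) (d A f)"
  by (auto simp: hom_def gam_d minus_one_power_iff d_minus)

lemma hom_tw: "hom a f \<Longrightarrow> tw A f = (if isodd A \<and> odd a then - f else f)"
  by (auto simp: tw_def hom_gam)

lemma tw_minus: "tw A (- f) = - tw A f"
  by (simp add: tw_def gam_minus)

text \<open>
  Together with the sign in \<open>w_p\<close>, this relabelling of the coordinates expresses the symmetry of the form.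
\<close>

lemma sum_p: "(\<Sum>A\<in>I. F (p A)) = (\<Sum>A\<in>I. F A)"
  by (rule sum.reindex_bij_witness[of _ p p]) (auto simp: I_p p_p)

text \<open>
  \<open>B 0\<close> is the product, \<open>B 1\<close> the Poisson bracket and \<open>B 3\<close> the cochain \<open>m\<^sub>1\<close>.
\<close>

fun B :: "nat \<Rightarrow> 'r \<Rightarrow> 'r \<Rightarrow> 'r" where
  "B 0 f g = f * g"
| "B (Suc r) f g = (\<Sum>A\<in>I. w A * B r (tw A (d A f)) (d (p A) g))"

lemma S_B: "f \<in> S \<Longrightarrow> g \<in> S \<Longrightarrow> B r f g \<in> S"
  by (induction r arbitrary: f g) (simp_all add: S_intros)

lemma tw_add: "tw A (f + g) = tw A f + tw A g"
  by (simp add: tw_def gam_add)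

lemma B_add_left: "f \<in> S \<Longrightarrow> f' \<in> S \<Longrightarrow> g \<in> S \<Longrightarrow> B r (f + f') g = B r f g + B r f' g"
  by (induction r arbitrary: f f' g)
    (auto simp: algebra_simps d_add tw_add sum.distrib S_intros)

lemma B_add_right: "f \<in> S \<Longrightarrow> g \<in> S \<Longrightarrow> g' \<in> S \<Longrightarrow> B r f (g + g') = B r f g + B r f g'"
  by (induction r arbitrary: f g g')
    (auto simp: algebra_simps d_add tw_add sum.distrib S_intros)

lemma B_minus_left: "f \<in> S \<Longrightarrow> g \<in> S \<Longrightarrow> B r (- f) g = - B r f g"
  by (induction r arbitrary: f g) (auto simp: d_minus tw_minus S_intros sum_negf)

lemma B_minus_right: "f \<in> S \<Longrightarrow> g \<in> S \<Longrightarrow> B r f (- g) = - B r f g"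
  by (induction r arbitrary: f g) (auto simp: d_minus tw_minus S_intros sum_negf)

lemma B_0_left: "g \<in> S \<Longrightarrow> B r 0 g = 0"
  using B_add_left[of 0 0 g r] by (simp add: S_0)

lemma B_0_right: "f \<in> S \<Longrightarrow> B r f 0 = 0"
  using B_add_right[of f 0 0 r] by (simp add: S_0)

lemma B_sum_left: "g \<in> S \<Longrightarrow> (\<And>x. x \<in> X \<Longrightarrow> f x \<in> S) \<Longrightarrow> B r (sum f X) g = (\<Sum>x\<in>X. B r (f x) g)"
  by (induction X rule: infinite_finite_induct) (auto simp: B_0_left B_add_left S_sum)

lemma B_diff_left: "f \<in> S \<Longrightarrow> f' \<in> S \<Longrightarrow> g \<in> S \<Longrightarrow> B r (f - f') g = B r f g - B r f' g"
  using B_add_left[of f "- f'" g r] by (simp add: B_minus_left S_minus)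

lemma B_diff_right: "f \<in> S \<Longrightarrow> g \<in> S \<Longrightarrow> g' \<in> S \<Longrightarrow> B r f (g - g') = B r f g - B r f g'"
  using B_add_right[of f g "- g'" r] by (simp add: B_minus_right S_minus)

lemma gam_B: "f \<in> S \<Longrightarrow> g \<in> S \<Longrightarrow> gam (B r f g) = B r (gam f) (gam g)"
proof (induction r arbitrary: f g)
  case 0 then show ?case by (simp add: gam_mult)
next
  case (Suc r)
  show ?case
    using Suc
    by (auto simp: gam_sum gam_mult gam_w S_intros gam_d tw_def I_p isodd_p gam_minus
        B_minus_left B_minus_right intro!: sum.cong)
qed

text \<open>
  The coefficients \<open>w\<close> are constant and the derivatives supercommute, so the Leibniz rule for the
  product is inherited by all powers.
\<close>

lemma d_B: "A \<in> I \<Longrightarrow> f \<in> S \<Longrightarrow> g \<in> S \<Longrightarrow>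
  d A (B r f g) = B r (d A f) g + B r (tw A f) (d A g)"
proof (induction r arbitrary: f g)
  case 0
  then show ?case by (simp add: d_mult tw_def)
next
  case (Suc r)
  have *: "d A (w C * B r (tw C (d C f)) (d (p C) g)) =
     w C * B r (tw C (d C (d A f))) (d (p C) g) + w C * B r (tw C (d C (tw A f))) (d (p C) (d A g))"
    if "C \<in> I" for C
  proof -
    note Suc.IH[OF Suc.prems(1), simp] S_intros[simp] S_B[simp] Suc.prems[simp] that[simp] gam_d[simp]
    show ?thesis
      by (cases "isodd A"; cases "isodd C")
        (simp_all add: d_w_mult tw_def d_d[of A C] d_d[of A "p C"] isodd_p d_minus
          B_minus_left B_minus_right gam_minus gam_gam right_diff_distrib distrib_left)
  qed
  show ?case
    using Suc.prems by (simp add: d_sum S_B S_intros * sum.distrib)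
qed

text \<open>
  Besides the sign for exchanging the two factors of the product, each of the \<open>r\<close> contractions is
  reversed and contributes a factor \<open>-1\<close>.
\<close>

lemma B_swap: "f \<in> S \<Longrightarrow> g \<in> S \<Longrightarrow> hom a f \<Longrightarrow> hom b g \<Longrightarrow>
  B r g f = (-1) ^ (r + a * b) * B r f g"
proof (induction r arbitrary: f g a b)
  case 0
  then show ?case using hom_commute[of a f b g] by simp
next
  case (Suc r)
  have "B (Suc r) g f = (\<Sum>A\<in>I. w (p A) * B r (tw (p A) (d (p A) g)) (d A f))"
    unfolding B.simps sum_p[of "\<lambda>A. w A * B r (tw A (d A g)) (d (p A) f)", symmetric]
    by (rule sum.cong) (simp_all add: p_p)
  also have "\<dots> = (\<Sum>A\<in>I. (-1) ^ (Suc r + a * b) * (w A * B r (tw A (d A f)) (d (p A) g)))"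
  proof (rule sum.cong[OF refl])
    fix A assume A: "A \<in> I"
    let ?e = "of_bool (isodd A) :: nat"
    have h: "hom (a + ?e) (d A f)" "hom (b + ?e) (d (p A) g)"
      using hom_d[OF A Suc.prems(1,3)] hom_d[OF I_p[OF A] Suc.prems(2,4)] isodd_p[OF A] by simp_all
    have in_S: "d A f \<in> S" "d (p A) g \<in> S"
      using A Suc.prems(1,2) by (simp_all add: S_intros)
    have IH: "B r (d (p A) g) (d A f) = (-1) ^ (r + (a + ?e) * (b + ?e)) * B r (d A f) (d (p A) g)"
      by (rule Suc.IH[OF in_S h])
    show "w (p A) * B r (tw (p A) (d (p A) g)) (d A f)
        = (-1) ^ (Suc r + a * b) * (w A * B r (tw A (d A f)) (d (p A) g))"
      by (cases "isodd A"; cases "even a"; cases "even b"; cases "even r")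
        (simp_all add: hom_tw[OF h(1)] hom_tw[OF h(2)] w_p[OF A] isodd_p[OF A] minus_one_power_iff
          B_minus_left in_S IH)
  qed
  finally show ?case by (simp add: sum_distrib_left)
qed

section \<open>The cocycle condition\<close>

text \<open>
  Contractions of two arguments of a trilinear expression. In \<open>P13\<close> the right derivative of \<open>f\<close> has to
  pass \<open>g\<close> before it meets the derivative of \<open>h\<close>, which accounts for \<open>tw A g\<close>.
\<close>

definition P12 where
  "P12 T f g h = (\<Sum>A\<in>I. w A * T (tw A (d A f)) (d (p A) g) h)" for T :: "'r \<Rightarrow> 'r \<Rightarrow> 'r \<Rightarrow> 'r"
definition P13 where
  "P13 T f g h = (\<Sum>A\<in>I. w A * T (tw A (d A f)) (tw A g) (d (p A) h))" for T :: "'r \<Rightarrow> 'r \<Rightarrow> 'r \<Rightarrow> 'r"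
definition P23 where
  "P23 T f g h = (\<Sum>A\<in>I. w A * T f (tw A (d A g)) (d (p A) h))" for T :: "'r \<Rightarrow> 'r \<Rightarrow> 'r \<Rightarrow> 'r"

text \<open>
  Interchanging derivatives of odd coordinates produces signs inside the arguments. They cancel
  in pairs once they can be pulled out of the expression.
\<close>

definition sign_linear :: "('r \<Rightarrow> 'r \<Rightarrow> 'r \<Rightarrow> 'r) \<Rightarrow> bool" where
  "sign_linear T \<longleftrightarrow> (\<forall>f\<in>S. \<forall>g\<in>S. \<forall>h\<in>S.
     T (- f) g h = - T f g h \<and> T f (- g) h = - T f g h \<and> T f g (- h) = - T f g h)"

lemma sign_linear_P:
  assumes "sign_linear T"
  shows "sign_linear (P12 T)" "sign_linear (P13 T)" "sign_linear (P23 T)"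
  using assms
  by (auto simp: sign_linear_def P12_def P13_def P23_def d_minus tw_minus S_intros sum_negf)

text \<open>Every contraction is even, because the two derivatives in it have the same parity.\<close>

lemma
  assumes T: "sign_linear T" and S: "f \<in> S" "g \<in> S" "h \<in> S"
  shows P12_P13: "P13 (P12 T) f g h = P12 (P13 T) f g h"
    and P12_P23: "P23 (P12 T) f g h = P12 (P23 T) f g h"
    and P13_P23: "P23 (P13 T) f g h = P13 (P23 T) f g h"
proof -
  note s = T[unfolded sign_linear_def, rule_format]
  have w: "w A * (w C * X) = w C * (w A * X)" if "A \<in> I" for A C X
    using that by (rule w_left_commute[symmetric])
  note S_intros[simp] S[simp] gam_d[simp]
  show "P13 (P12 T) f g h = P12 (P13 T) f g h"
    unfolding P12_def P13_def sum_distrib_left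
  proof (subst sum.swap, rule sum.cong[OF refl], rule sum.cong[OF refl])
    fix A C assume A: "A \<in> I" and C: "C \<in> I"
    note [simp] = A C
    show "w C * (w A * T (tw A (d A (tw C (d C f)))) (d (p A) (tw C g)) (d (p C) h)) =
      w A * (w C * T (tw C (d C (tw A (d A f)))) (tw C (d (p A) g)) (d (p C) h))"
      by (subst w[OF C], cases "isodd A"; cases "isodd C")
        (simp_all add: tw_def gam_gam isodd_p d_minus gam_minus s d_d[of A C f] d_d[of A C "gam f"])
  qed
  show "P23 (P12 T) f g h = P12 (P23 T) f g h"
    unfolding P12_def P23_def sum_distrib_left
  proof (subst sum.swap, rule sum.cong[OF refl], rule sum.cong[OF refl])
    fix A C assume A: "A \<in> I" and C: "C \<in> I"
    note [simp] = A C
    show "w C * (w A * T (tw A (d A f)) (d (p A) (tw C (d C g))) (d (p C) h)) =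
      w A * (w C * T (tw A (d A f)) (tw C (d C (d (p A) g))) (d (p C) h))"
      by (subst w[OF C], cases "isodd A"; cases "isodd C")
        (simp_all add: tw_def gam_gam isodd_p d_minus gam_minus s d_d[of "p A" C g] d_d[of "p A" C "gam g"])
  qed
  show "P23 (P13 T) f g h = P13 (P23 T) f g h"
    unfolding P13_def P23_def sum_distrib_left
  proof (subst sum.swap, rule sum.cong[OF refl], rule sum.cong[OF refl])
    fix A C assume A: "A \<in> I" and C: "C \<in> I"
    note [simp] = A C
    show "w C * (w A * T (tw A (d A f)) (tw A (tw C (d C g))) (d (p A) (d (p C) h))) =
      w A * (w C * T (tw A (d A f)) (tw C (d C (tw A g))) (d (p C) (d (p A) h)))"
      by (subst w[OF C], cases "isodd A"; cases "isodd C")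
        (simp_all add: tw_def gam_gam isodd_p d_minus gam_minus s d_d[of "p A" "p C" h])
  qed
qed

text \<open>
  Because the contractions commute, only the number of contractions of each kind matters.
\<close>

definition T3 :: "nat \<Rightarrow> nat \<Rightarrow> nat \<Rightarrow> 'r \<Rightarrow> 'r \<Rightarrow> 'r \<Rightarrow> 'r" where
  "T3 i j k = (P12 ^^ i) ((P13 ^^ j) ((P23 ^^ k) (\<lambda>f g h. f * (g * h))))"

lemma sign_linear_T3: "sign_linear (T3 i j k)"
proof -
  have "sign_linear ((P23 ^^ k) (\<lambda>f g h. f * (g * h)))" for k
    by (induction k) (auto intro: sign_linear_P, simp add: sign_linear_def)
  then have "sign_linear ((P13 ^^ j) ((P23 ^^ k) (\<lambda>f g h. f * (g * h))))" for j
    by (induction j) (auto intro: sign_linear_P)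
  then show ?thesis unfolding T3_def by (induction i) (auto intro: sign_linear_P)
qed

lemma P_cong:
  assumes "\<And>f g h. f \<in> S \<Longrightarrow> g \<in> S \<Longrightarrow> h \<in> S \<Longrightarrow> T f g h = U f g h" "f \<in> S" "g \<in> S" "h \<in> S"
  shows "P12 T f g h = P12 U f g h" "P13 T f g h = P13 U f g h" "P23 T f g h = P23 U f g h"
  unfolding P12_def P13_def P23_def
  by (rule sum.cong; simp add: assms S_intros)+

lemma P12_T3: "P12 (T3 i j k) = T3 (Suc i) j k"
  by (simp add: T3_def)

lemma P13_T3: "f \<in> S \<Longrightarrow> g \<in> S \<Longrightarrow> h \<in> S \<Longrightarrow> P13 (T3 i j k) f g h = T3 i (Suc j) k f g h"
proof (induction i arbitrary: f g h)
  case 0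
  then show ?case by (simp add: T3_def)
next
  case (Suc i)
  have "P13 (T3 (Suc i) j k) f g h = P12 (P13 (T3 i j k)) f g h"
    unfolding P12_T3[symmetric] by (rule P12_P13[OF sign_linear_T3 Suc.prems])
  also have "\<dots> = P12 (T3 i (Suc j) k) f g h"
    by (rule P_cong(1)) (use Suc in auto)
  finally show ?case by (simp add: P12_T3)
qed

lemma P23_T3: "f \<in> S \<Longrightarrow> g \<in> S \<Longrightarrow> h \<in> S \<Longrightarrow> P23 (T3 i j k) f g h = T3 i j (Suc k) f g h"
proof (induction i arbitrary: f g h)
  case 0
  have "P23 (T3 0 j k) f g h = T3 0 j (Suc k) f g h" if "f \<in> S" "g \<in> S" "h \<in> S" for f g h
    using that
  proof (induction j arbitrary: f g h)
    case 0
    then show ?case by (simp add: T3_def)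
  next
    case (Suc j)
    have eq: "T3 0 (Suc j) k = P13 (T3 0 j k)" for j k
      by (simp add: T3_def)
    have "P23 (T3 0 (Suc j) k) f g h = P13 (P23 (T3 0 j k)) f g h"
      unfolding eq by (rule P13_P23[OF sign_linear_T3 Suc.prems])
    also have "\<dots> = P13 (T3 0 j (Suc k)) f g h"
      by (rule P_cong(2)) (use Suc in auto)
    finally show ?case by (simp add: eq)
  qed
  with 0 show ?case by blast
next
  case (Suc i)
  have "P23 (T3 (Suc i) j k) f g h = P12 (P23 (T3 i j k)) f g h"
    unfolding P12_T3[symmetric] by (rule P12_P23[OF sign_linear_T3 Suc.prems])
  also have "\<dots> = P12 (T3 i j (Suc k)) f g h"
    by (rule P_cong(1)) (use Suc in auto)
  finally show ?case by (simp add: P12_T3)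
qed

text \<open>
  The rotation turns the contraction of the first two arguments into one of the last two without
  change, while the other two kinds of contractions are reversed; by the symmetry of the form this
  gives \<open>(-1)\<^bsup>j + k\<^esup>\<close>. The rest of the sign comes from moving \<open>f\<close> past \<open>g h\<close>.
\<close>

lemma T3_rotate:
  assumes "f \<in> S" "g \<in> S" "h \<in> S" "hom a f" "hom b g" "hom c h"
  shows "T3 i j k g h f = (-1) ^ (j + k + a * (b + c)) * T3 j k i f g h"
  using assms
proof (induction "i + j + k" arbitrary: i j k f g h a b c rule: less_induct)
  case less
  note S = less.prems(1-3) and hom = less.prems(4-6)
  let ?e = "\<lambda>A. of_bool (isodd A) :: nat"
  have hd: "hom (a + ?e A) (d A f)" "hom (b + ?e A) (d A g)" "hom (c + ?e A) (d A h)"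
    if "A \<in> I" for A
    using hom_d[OF that S(1) hom(1)] hom_d[OF that S(2) hom(2)] hom_d[OF that S(3) hom(3)]
    by simp_all
  have Sd: "d A f \<in> S" "d A g \<in> S" "d A h \<in> S" if "A \<in> I" for A
    using that S by (simp_all add: S_intros)
  note slin = sign_linear_T3[unfolded sign_linear_def, rule_format]
  consider i' where "i = Suc i'" | j' where "j = Suc j'" | k' where "k = Suc k'" | "i = 0" "j = 0" "k = 0"
    by (metis not0_implies_Suc)
  then show ?case
  proof cases
    case 1
    have "T3 i j k g h f = P12 (T3 i' j k) g h f" by (simp add: 1 P12_T3)
    also have "\<dots> = (\<Sum>A\<in>I. (-1) ^ (j + k + a * (b + c)) * (w A * T3 j k i' f (tw A (d A g)) (d (p A) h)))"
      unfolding P12_def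
    proof (rule sum.cong[OF refl])
      fix A assume A: "A \<in> I"
      have "T3 i' j k (d A g) (d (p A) h) f =
        (-1) ^ (j + k + a * ((b + ?e A) + (c + ?e A))) * T3 j k i' f (d A g) (d (p A) h)"
        by (rule less.hyps) (use 1 A S hom hd[OF A] hd[OF I_p[OF A]] Sd I_p[OF A] isodd_p[OF A] in auto)
      then show "w A * T3 i' j k (tw A (d A g)) (d (p A) h) f =
          (-1) ^ (j + k + a * (b + c)) * (w A * T3 j k i' f (tw A (d A g)) (d (p A) h))"
        using S A by (auto simp: hom_tw[OF hd(2)[OF A]] slin Sd I_p minus_one_power_iff)
    qed
    also have "\<dots> = (-1) ^ (j + k + a * (b + c)) * P23 (T3 j k i') f g h"
      by (simp add: P23_def sum_distrib_left)
    finally show ?thesis by (simp add: P23_T3 S 1)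
  next
    case 2
    have "T3 i j k g h f = P13 (T3 i j' k) g h f" by (simp add: 2 P13_T3 S)
    also have "\<dots> = (\<Sum>A\<in>I. w (p A) * T3 i j' k (tw (p A) (d (p A) g)) (tw (p A) h) (d A f))"
      unfolding P13_def sum_p[of "\<lambda>A. w A * T3 i j' k (tw A (d A g)) (tw A h) (d (p A) f)", symmetric]
      by (rule sum.cong) (simp_all add: p_p)
    also have "\<dots> = (\<Sum>A\<in>I. (-1) ^ (j + k + a * (b + c)) * (w A * T3 j' k i (tw A (d A f)) (d (p A) g) h))"
    proof (rule sum.cong[OF refl])
      fix A assume A: "A \<in> I"
      have IH: "T3 i j' k (d (p A) g) h (d A f) =
        (-1) ^ (j' + k + (a + ?e A) * ((b + ?e A) + c)) * T3 j' k i (d A f) (d (p A) g) h"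
        by (rule less.hyps) (use 2 A S hom hd[OF A] hd[OF I_p[OF A]] Sd I_p[OF A] isodd_p[OF A] in auto)
      show "w (p A) * T3 i j' k (tw (p A) (d (p A) g)) (tw (p A) h) (d A f) =
          (-1) ^ (j + k + a * (b + c)) * (w A * T3 j' k i (tw A (d A f)) (d (p A) g) h)"
        using S A by (cases "isodd A"; cases "even a"; cases "even b"; cases "even c"; cases "even (j' + k)")
          (simp_all add: hom_tw[OF hd(1)[OF A]] hom_tw[OF hd(2)[OF I_p[OF A]]] hom_tw[OF hom(3)] slin Sd I_p
            minus_one_power_iff isodd_p w_p IH 2 S_minus)
    qed
    also have "\<dots> = (-1) ^ (j + k + a * (b + c)) * P12 (T3 j' k i) f g h"
      by (simp add: P12_def sum_distrib_left)
    finally show ?thesis by (simp add: P12_T3 S 2)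
  next
    case 3
    have "T3 i j k g h f = P23 (T3 i j k') g h f" by (simp add: 3 P23_T3 S)
    also have "\<dots> = (\<Sum>A\<in>I. w (p A) * T3 i j k' g (tw (p A) (d (p A) h)) (d A f))"
      unfolding P23_def sum_p[of "\<lambda>A. w A * T3 i j k' g (tw A (d A h)) (d (p A) f)", symmetric]
      by (rule sum.cong) (simp_all add: p_p)
    also have "\<dots> = (\<Sum>A\<in>I. (-1) ^ (j + k + a * (b + c)) * (w A * T3 j k' i (tw A (d A f)) (tw A g) (d (p A) h)))"
    proof (rule sum.cong[OF refl])
      fix A assume A: "A \<in> I"
      have IH: "T3 i j k' g (d (p A) h) (d A f) =
        (-1) ^ (j + k' + (a + ?e A) * (b + (c + ?e A))) * T3 j k' i (d A f) g (d (p A) h)"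
        by (rule less.hyps) (use 3 A S hom hd[OF A] hd[OF I_p[OF A]] Sd I_p[OF A] isodd_p[OF A] in auto)
      show "w (p A) * T3 i j k' g (tw (p A) (d (p A) h)) (d A f) =
          (-1) ^ (j + k + a * (b + c)) * (w A * T3 j k' i (tw A (d A f)) (tw A g) (d (p A) h))"
        using S A by (cases "isodd A"; cases "even a"; cases "even b"; cases "even c"; cases "even (j + k')")
          (simp_all add: hom_tw[OF hd(1)[OF A]] hom_tw[OF hd(3)[OF I_p[OF A]]] hom_tw[OF hom(2)] slin Sd I_p
            minus_one_power_iff isodd_p w_p IH 3 S_minus)
    qed
    also have "\<dots> = (-1) ^ (j + k + a * (b + c)) * P13 (T3 j k' i) f g h"
      by (simp add: P13_def sum_distrib_left)
    finally show ?thesis by (simp add: P13_T3 S 3)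
  next
    case 4
    have "hom (b + c) (g * h)" by (rule hom_mult) (use hom in auto)
    from hom_commute[OF hom(1) this] show ?thesis
      by (simp add: 4 T3_def mult.assoc)
  qed
qed

text \<open>
  By the Leibniz rule, the derivative that meets \<open>B s g h\<close> acts on \<open>g\<close> or on \<open>h\<close>. Iterating this
  expresses \<open>B r f (B s g h)\<close> by binomial coefficients and the expressions \<open>T3\<close>.
\<close>

lemma B_B_Suc:
  assumes "f \<in> S" "g \<in> S" "h \<in> S"
  shows "B (Suc r) f (B s g h) = P12 (\<lambda>f g h. B r f (B s g h)) f g h
    + P13 (\<lambda>f g h. B r f (B s g h)) f g h"
  unfolding P12_def P13_def sum.distrib[symmetric] B.simps
  by (rule sum.cong)
    (simp_all add: assms d_B S_intros S_B B_add_right distrib_left tw_def isodd_p)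

lemma B_0_B: "f \<in> S \<Longrightarrow> g \<in> S \<Longrightarrow> h \<in> S \<Longrightarrow> B 0 f (B s g h) = T3 0 0 s f g h"
proof (induction s arbitrary: f g h)
  case 0
  then show ?case by (simp add: T3_def)
next
  case (Suc s)
  have "T3 0 0 (Suc s) f g h = P23 (T3 0 0 s) f g h" by (simp add: T3_def)
  also have "\<dots> = P23 (\<lambda>f g h. B 0 f (B s g h)) f g h"
    by (rule P_cong(3)) (use Suc in auto)
  also have "\<dots> = B 0 f (B (Suc s) g h)"
    by (auto simp: P23_def sum_distrib_left w_left_commute intro!: sum.cong)
  finally show ?case by simp
qed

lemma P_add:
  "P12 (\<lambda>f g h. T f g h + U f g h) f g h = P12 T f g h + P12 U f g h"
  "P13 (\<lambda>f g h. T f g h + U f g h) f g h = P13 T f g h + P13 U f g h"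
  by (simp_all add: P12_def P13_def distrib_left sum.distrib)

lemma B_B_step:
  assumes "\<And>f g h. f \<in> S \<Longrightarrow> g \<in> S \<Longrightarrow> h \<in> S \<Longrightarrow> B r f (B s g h) = T f g h" "f \<in> S" "g \<in> S" "h \<in> S"
  shows "B (Suc r) f (B s g h) = P12 T f g h + P13 T f g h"
  using P_cong(1,2)[of "\<lambda>f g h. B r f (B s g h)" T f g h] assms by (simp add: B_B_Suc del: B.simps)

lemma B_1_B: "f \<in> S \<Longrightarrow> g \<in> S \<Longrightarrow> h \<in> S \<Longrightarrow>
  B 1 f (B s g h) = T3 1 0 s f g h + T3 0 1 s f g h"
  unfolding One_nat_def by (subst B_B_step[OF B_0_B]) (simp_all add: P12_T3 P13_T3)

lemma B_2_B: "f \<in> S \<Longrightarrow> g \<in> S \<Longrightarrow> h \<in> S \<Longrightarrow>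
  B 2 f (B s g h) = T3 2 0 s f g h + T3 1 1 s f g h + T3 1 1 s f g h + T3 0 2 s f g h"
  unfolding numeral_2_eq_2
  by (subst B_B_step[OF B_1_B[unfolded One_nat_def]]) (simp_all add: P_add P12_T3 P13_T3)

lemma B_3_B: "f \<in> S \<Longrightarrow> g \<in> S \<Longrightarrow> h \<in> S \<Longrightarrow>
  B 3 f (B s g h) = T3 3 0 s f g h + T3 2 1 s f g h + T3 2 1 s f g h + T3 2 1 s f g h
    + T3 1 2 s f g h + T3 1 2 s f g h + T3 1 2 s f g h + T3 0 3 s f g h"
  unfolding numeral_3_eq_3
  by (subst B_B_step[OF B_2_B[unfolded numeral_2_eq_2]]) (simp_all add: P_add P12_T3 P13_T3 numeral_2_eq_2)

lemma T3_rotate2: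
  assumes "f \<in> S" "g \<in> S" "h \<in> S" "hom a f" "hom b g" "hom c h"
  shows "T3 i j k h f g = (-1) ^ (i + j + c * (a + b)) * T3 k i j f g h"
  using T3_rotate[of g h f b c a i j k] T3_rotate[of f g h a b c j k i] assms
  by (auto simp: minus_one_power_iff)

definition cyclic where
  "cyclic a b c M f g h = (-1) ^ (a * c) * M f g h + (-1) ^ (b * a) * M g h f + (-1) ^ (c * b) * M h f g"
  for M :: "'r \<Rightarrow> 'r \<Rightarrow> 'r \<Rightarrow> 'r"

lemma jacobi_B1:
  assumes "f \<in> S" "g \<in> S" "h \<in> S" "hom a f" "hom b g" "hom c h"
  shows "cyclic a b c (\<lambda>f g h. B 1 f (B 1 g h)) f g h = 0"
  using assms(1-3)
  by (simp add: cyclic_def B_1_B T3_rotate[OF assms] T3_rotate2[OF assms]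
      del: One_nat_def B.simps)
    (auto simp: minus_one_power_iff)

text \<open>
  After rewriting everything in terms of \<open>T3\<close> at \<open>(f, g, h)\<close>, this is the vanishing of the cyclic sum
  of \<open>(a - c) b\<^sup>3 + (a - c)\<^sup>3 b\<close> in commuting variables \<open>a\<close>, \<open>b\<close>, \<open>c\<close>.
\<close>

lemma cocycle_B3:
  assumes "f \<in> S" "g \<in> S" "h \<in> S" "hom a f" "hom b g" "hom c h"
  shows "cyclic a b c (\<lambda>f g h. B 1 f (B 3 g h) + B 3 f (B 1 g h)) f g h = 0"
  using assms(1-3)
  by (simp add: cyclic_def B_1_B B_3_B T3_rotate[OF assms] T3_rotate2[OF assms]
      del: One_nat_def B.simps)
    (auto simp: minus_one_power_iff)

section \<open>Outer constants\<close>

lemma G_0: "0 \<in> G" using G_add[OF G_1 G_minus[OF G_1]] by simp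

lemma G_diff: "t \<in> G \<Longrightarrow> u \<in> G \<Longrightarrow> t - u \<in> G"
  using G_add[of t "- u"] G_minus[of u] by simp

lemma d_G_mult_left: "A \<in> I \<Longrightarrow> t \<in> G \<Longrightarrow> f \<in> S \<Longrightarrow> d A (t * f) = tw A t * d A f"
  by (simp add: d_mult G_S d_G tw_def)

lemma d_G_mult_right: "A \<in> I \<Longrightarrow> t \<in> G \<Longrightarrow> f \<in> S \<Longrightarrow> d A (f * t) = d A f * t"
  by (simp add: d_mult G_S d_G)

lemma tw_0: "tw A 0 = 0"
  by (simp add: tw_def gam_0)

lemma tw_mult: "tw A (f * g) = tw A f * tw A g"
  by (simp add: tw_def gam_mult)

lemma tw_tw: "tw A (tw A f) = f"
  by (simp add: tw_def gam_gam)

lemma B_G_left: "t \<in> G \<Longrightarrow> f \<in> S \<Longrightarrow> g \<in> S \<Longrightarrow> B r (t * f) g = t * B r f g"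
  by (induction r arbitrary: f g)
    (simp_all add: d_G_mult_left tw_mult tw_tw S_intros mult.assoc sum_distrib_left w_left_commute)

lemma B_G_right: "t \<in> G \<Longrightarrow> f \<in> S \<Longrightarrow> g \<in> S \<Longrightarrow> B r f (g * t) = B r f g * t"
  by (induction r arbitrary: f g)
    (simp_all add: d_G_mult_right S_intros mult.assoc sum_distrib_right)

text \<open>
  The induction needs \<open>tw\<close> on both sides: the constant picks up a sign when it passes the left derivative
  of \<open>g\<close>, and the same sign when it is absorbed by the right derivative of \<open>f\<close>.
\<close>

lemma B_G_middle: "t \<in> G \<Longrightarrow> f \<in> S \<Longrightarrow> g \<in> S \<Longrightarrow> B r f (t * g) = B r (f * t) g"
proof (induction r arbitrary: f g t)
  case (Suc r)
  have "B r (tw A (d A f)) (tw (p A) t * d (p A) g) = B r (tw A (d A f * t)) (d (p A) g)"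
    if "A \<in> I" for A
    using that Suc.prems Suc.IH[of "tw (p A) t" "tw A (d A f)" "d (p A) g"]
    by (simp add: S_intros G_gam tw_mult) (simp add: tw_def isodd_p G_gam)
  then show ?case using Suc.prems
    by (simp add: d_G_mult_right d_G_mult_left I_p)
qed (simp add: mult.assoc)

lemma B_Suc_const: "t \<in> G \<Longrightarrow> f \<in> S \<Longrightarrow> B (Suc r) f t = 0"
  by (simp add: d_G I_p B_0_right S_intros)

lemma B_Suc_const_left: "t \<in> G \<Longrightarrow> f \<in> S \<Longrightarrow> B (Suc r) t f = 0"
  by (simp add: d_G I_p B_0_left S_intros tw_0)

end

section \<open>The integral and the Euler operator\<close>

text \<open>
  \<open>D\<close> stands for the superfields with compact support, \<open>J\<close> for the integral and \<open>z A\<close> for the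
  coordinates. The integral is odd and takes values in the constants.
\<close>

locale integrated_superspace = superspace gam S G I isodd d p w
  for gam :: "'r::ring_1 \<Rightarrow> 'r" and S G and I :: "'i set" and isodd d p w +
  fixes D :: "'r set" and J :: "'r \<Rightarrow> 'r" and z :: "'i \<Rightarrow> 'r" and half :: 'r
  assumes D_S: "f \<in> D \<Longrightarrow> f \<in> S"
    and D_add: "f \<in> D \<Longrightarrow> g \<in> D \<Longrightarrow> f + g \<in> D"
    and D_mult_left: "g \<in> S \<Longrightarrow> f \<in> D \<Longrightarrow> g * f \<in> D"
    and D_gam: "f \<in> D \<Longrightarrow> gam f \<in> D"
    and D_d: "A \<in> I \<Longrightarrow> f \<in> D \<Longrightarrow> d A f \<in> D"
    and G_J: "f \<in> D \<Longrightarrow> J f \<in> G"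
    and J_add: "f \<in> D \<Longrightarrow> g \<in> D \<Longrightarrow> J (f + g) = J f + J g"
    and J_G_left: "t \<in> G \<Longrightarrow> f \<in> D \<Longrightarrow> J (t * f) = gam t * J f"
    and gam_J: "f \<in> D \<Longrightarrow> gam (J f) = - J (gam f)"
    and J_d: "A \<in> I \<Longrightarrow> f \<in> D \<Longrightarrow> J (d A f) = 0"
    and S_z: "A \<in> I \<Longrightarrow> z A \<in> S"
    and gam_z: "A \<in> I \<Longrightarrow> gam (z A) = (if isodd A then - z A else z A)"
    and d_z: "A \<in> I \<Longrightarrow> C \<in> I \<Longrightarrow> d A (z C) = (if A = C then 1 else 0)"
    and G_half: "half \<in> G" and gam_half: "gam half = half" and half_half: "half + half = 1"
    and torsion_3: "(x::'r) + x + x = 0 \<Longrightarrow> x = 0"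
begin

lemma half_double: "half * x + half * x = x"
  by (simp add: distrib_right[symmetric] half_half)

lemma half_commute: "half * x = x * half"
  by (rule even_commute) (rule gam_half)

lemma double_0: "(x::'r) + x = 0 \<Longrightarrow> x = 0"
  using half_double[of x] by (simp add: distrib_left[symmetric])

lemma minus_self: "(x::'r) = - x \<Longrightarrow> x = 0"
  by (rule double_0) (simp add: eq_neg_iff_add_eq_0[symmetric])

text \<open>
  The ring axioms describe products with even and with odd elements separately; the decomposition
  transfers their consequences to all constants.
\<close>

lemma even_odd_decomp:
  assumes "t \<in> G"
  obtains u v where "t = u + v" "u \<in> G" "v \<in> G" "gam u = u" "gam v = - v"
proof
  show "t = half * (t + gam t) + half * (t - gam t)"
    by (simp add: distrib_left[symmetric]) (simp add: distrib_left half_double)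
qed (use assms in \<open>simp_all add: G_mult G_half G_add G_diff G_gam gam_mult gam_half gam_add gam_diff
      gam_gam add.commute right_diff_distrib\<close>)

lemma D_minus: "f \<in> D \<Longrightarrow> - f \<in> D"
  using D_mult_left[of "- 1" f] by (simp add: S_minus S_1)

lemma D_diff: "f \<in> D \<Longrightarrow> g \<in> D \<Longrightarrow> f - g \<in> D"
  using D_add[of f "- g"] D_minus[of g] by simp

lemma D_mult_G: assumes "f \<in> D" "t \<in> G" shows "f * t \<in> D"
proof -
  obtain u v where t: "t = u + v" "u \<in> G" "v \<in> G" "gam u = u" "gam v = - v"
    using even_odd_decomp[OF assms(2)] .
  have "f * t = u * f + v * gam f"
    using even_commute[of u f] odd_commute[of v "gam f"] t by (simp add: distrib_left gam_gam)
  then show ?thesis using assms t by (simp add: D_add D_mult_left D_gam G_S)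
qed

lemma J_minus: "f \<in> D \<Longrightarrow> J (- f) = - J f"
  using J_G_left[of "- 1" f] by (simp add: G_minus G_1 gam_minus gam_1)

lemma D_0: assumes "f \<in> D" shows "0 \<in> D"
  using D_add[OF assms D_minus[OF assms]] by simp

lemma J_diff: "f \<in> D \<Longrightarrow> g \<in> D \<Longrightarrow> J (f - g) = J f - J g"
  using J_add[of f "- g"] by (simp add: J_minus D_minus)

lemma J_sum: "finite X \<Longrightarrow> 0 \<in> D \<Longrightarrow> (\<And>x. x \<in> X \<Longrightarrow> f x \<in> D) \<Longrightarrow>
    sum f X \<in> D \<and> J (sum f X) = (\<Sum>x\<in>X. J (f x))"
proof (induction X rule: finite_induct)
  case empty
  then show ?case using J_diff[of 0 0] by simp
qed (auto simp: D_add J_add)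

text \<open>
  Both parity parts of \<open>t\<close> are moved to the left of \<open>f\<close>, pulled out of the integral and moved back to the
  right; the sign from passing \<open>f\<close> is undone by the parity of \<open>J f\<close>.
\<close>

lemma J_G_right: assumes "f \<in> D" "t \<in> G" shows "J (f * t) = J f * t"
proof -
  obtain u v where t: "t = u + v" "u \<in> G" "v \<in> G" "gam u = u" "gam v = - v"
    using even_odd_decomp[OF assms(2)] .
  have "f * t = u * f + v * gam f"
    using even_commute[of u f] odd_commute[of v "gam f"] t by (simp add: distrib_left gam_gam)
  then have "J (f * t) = u * J f - v * J (gam f)"
    using assms t by (simp add: J_add J_G_left D_mult_left D_gam G_S)
  also have "\<dots> = u * J f + v * gam (J f)"
    using assms by (simp add: gam_J)
  also have "\<dots> = J f * t"
    using even_commute[of u "J f"] odd_commute[of v "gam (J f)"] t by (simp add: distrib_left gam_gam)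
  finally show ?thesis .
qed

lemma D_sum: "finite X \<Longrightarrow> 0 \<in> D \<Longrightarrow> (\<And>x. x \<in> X \<Longrightarrow> f x \<in> D) \<Longrightarrow> sum f X \<in> D"
  using J_sum by blast

lemma D_B: "f \<in> S \<Longrightarrow> g \<in> D \<Longrightarrow> B r f g \<in> D"
proof (induction r arbitrary: f g)
  case 0
  then show ?case by (simp add: D_mult_left)
next
  case (Suc r)
  then show ?case
    using D_0[OF Suc.prems(2)] by (auto intro!: D_sum finite_I D_mult_left S_w Suc.IH S_tw S_d D_d I_p)
qed

text \<open>
  Up to a term with second derivatives \<open>\<omega>\<^sup>A\<^sup>B \<partial>\<^sub>B \<partial>\<^sub>A f\<close>, which vanishes because the symmetry of the
  form is opposite to that of the derivatives, \<open>B (Suc r) f g\<close> is a sum of derivatives.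
\<close>

lemma J_B: assumes "f \<in> S" "g \<in> D" shows "J (B (Suc r) f g) = 0"
proof -
  have g: "g \<in> S" using assms D_S by blast
  have D0: "0 \<in> D" using D_0 assms by blast
  \<comment> \<open>The sum of these terms is its own negative under the relabelling \<open>A \<mapsto> p A\<close>.\<close>
  let ?X = "\<lambda>A. w A * d (p A) (d A f)"
  have "(\<Sum>A\<in>I. ?X A) = (\<Sum>A\<in>I. ?X (p A))" by (rule sum_p[symmetric])
  also have "\<dots> = (\<Sum>A\<in>I. - ?X A)"
  proof (rule sum.cong[OF refl])
    fix A assume "A \<in> I"
    then show "?X (p A) = - ?X A"
      using assms(1) by (simp add: p_p w_p d_d[of A "p A"] I_p isodd_p)
  qed
  finally have 0: "(\<Sum>A\<in>I. ?X A) = 0" by (auto simp: sum_negf intro: minus_self)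
  have "B (Suc r) f g = (\<Sum>A\<in>I. w A * d (p A) (B r (d A f) g) - B r (w A * d (p A) (d A f)) g)"
    unfolding B.simps
    by (rule sum.cong[OF refl])
      (use assms g in \<open>simp add: d_B S_intros B_G_left G_w tw_def isodd_p right_diff_distrib[symmetric]\<close>)
  also have "\<dots> = (\<Sum>A\<in>I. w A * d (p A) (B r (d A f) g)) - (\<Sum>A\<in>I. B r (?X A) g)"
    by (simp add: sum_subtractf)
  also have "(\<Sum>A\<in>I. B r (?X A) g) = B r (\<Sum>A\<in>I. ?X A) g"
    by (rule B_sum_left[symmetric]) (use assms g in \<open>simp_all add: S_intros\<close>)
  finally have eq: "B (Suc r) f g = (\<Sum>A\<in>I. w A * d (p A) (B r (d A f) g))"
    using 0 g by (simp add: B_0_left)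
  have "w A * d (p A) (B r (d A f) g) \<in> D \<and> J (w A * d (p A) (B r (d A f) g)) = 0" if "A \<in> I" for A
    using that assms by (simp add: J_G_left G_w J_d I_p D_B D_d S_d D_mult_left S_w)
  then show ?thesis
    unfolding eq using J_sum[OF finite_I D0, of "\<lambda>A. w A * d (p A) (B r (d A f) g)"] by simp
qed

text \<open>
  \<open>N\<close> counts the degree in the coordinates, and \<open>Eul\<close> is the operator \<open>\<E>\<close>.
\<close>

definition N where "N f = (\<Sum>A\<in>I. z A * d A f)"

definition Eul where "Eul f = f - half * N f"

text \<open>
  The superdimension \<open>n - m\<close>.
\<close>

definition dim :: 'r where "dim = (\<Sum>A\<in>I. if isodd A then - 1 else 1)"

lemma S_N: "f \<in> S \<Longrightarrow> N f \<in> S"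
  by (auto simp: N_def intro!: S_intros S_z)

lemma S_Eul: "f \<in> S \<Longrightarrow> Eul f \<in> S"
  by (simp add: Eul_def S_N S_intros G_half G_S)

lemma D_N: "f \<in> D \<Longrightarrow> N f \<in> D"
  using D_0[of f] by (auto simp: N_def intro!: D_sum finite_I D_mult_left S_z D_d)

lemma D_Eul: "f \<in> D \<Longrightarrow> Eul f \<in> D"
  by (simp add: Eul_def D_N D_diff D_mult_left G_half G_S)

lemma gam_N: "f \<in> S \<Longrightarrow> gam (N f) = N (gam f)"
  by (auto simp: N_def gam_sum gam_mult gam_z gam_d intro!: sum.cong)

lemma gam_Eul: "f \<in> S \<Longrightarrow> gam (Eul f) = Eul (gam f)"
  by (simp add: Eul_def gam_diff gam_mult gam_half gam_N)

lemma N_add: "f \<in> S \<Longrightarrow> g \<in> S \<Longrightarrow> N (f + g) = N f + N g"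
  by (simp add: N_def d_add distrib_left sum.distrib)

lemma Eul_add: "f \<in> S \<Longrightarrow> g \<in> S \<Longrightarrow> Eul (f + g) = Eul f + Eul g"
  by (simp add: Eul_def N_add distrib_left)

text \<open>
  The coordinate \<open>z A\<close> is moved past \<open>f\<close>, which undoes the sign in the Leibniz rule for \<open>d A\<close>.
\<close>

lemma N_mult: assumes "f \<in> S" "g \<in> S" shows "N (f * g) = N f * g + f * N g"
proof -
  have "z A * tw A f = f * z A" if "A \<in> I" for A
    using even_commute[of "z A" f] odd_commute[of "z A" "gam f"] gam_z[OF that]
    by (auto simp: tw_def gam_gam)
  then have "z A * (tw A f * x) = f * (z A * x)" if "A \<in> I" for A x
    using that by (metis mult.assoc)
  then show ?thesis using assms
    by (simp add: N_def d_mult tw_def[symmetric] distrib_left sum.distrib sum_distrib_left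
       sum_distrib_right mult.assoc)
qed

lemma N_G: "t \<in> G \<Longrightarrow> N t = 0"
  by (simp add: N_def d_G)

lemma N_sum: "(\<And>x. x \<in> X \<Longrightarrow> f x \<in> S) \<Longrightarrow> N (sum f X) = (\<Sum>x\<in>X. N (f x))"
proof (induction X rule: infinite_finite_induct)
qed (auto simp: N_add S_sum N_G G_0)

lemma Eul_G: "t \<in> G \<Longrightarrow> Eul t = t"
  by (simp add: Eul_def N_G)

lemma Eul_G_left: "t \<in> G \<Longrightarrow> f \<in> S \<Longrightarrow> Eul (t * f) = t * Eul f"
  by (simp add: Eul_def N_mult N_G G_S right_diff_distrib)
    (metis half_commute mult.assoc)

lemma Eul_G_right: "t \<in> G \<Longrightarrow> f \<in> S \<Longrightarrow> Eul (f * t) = Eul f * t"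
  by (simp add: Eul_def N_mult N_G G_S left_diff_distrib mult.assoc)

lemma d_N: assumes "C \<in> I" "f \<in> S" shows "d C (N f) = d C f + N (d C f)"
proof -
  have "d C (z A * d A f) = (if A = C then d C f else 0) + z A * d A (d C f)" if "A \<in> I" for A
    using assms that
    by (auto simp: d_mult S_z S_intros d_z gam_z d_d[of C A] d_minus)
  then show ?thesis
    using assms by (simp add: N_def d_sum S_intros S_z sum.distrib finite_I)
qed

text \<open>
  The bracket removes one coordinate from each factor and so lowers the degree by two.
\<close>

lemma N_B1: assumes "f \<in> S" "g \<in> S"
  shows "N (B 1 f g) + B 1 f g + B 1 f g = B 1 (N f) g + B 1 f (N g)"
proof -
  have tN: "tw A (N x) = N (tw A x)" if "x \<in> S" for A x
    using that by (simp add: tw_def gam_N)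
  have "N (w A * (tw A (d A f) * d (p A) g)) + w A * (tw A (d A f) * d (p A) g) + w A * (tw A (d A f) * d (p A) g)
     = w A * (tw A (d A (N f)) * d (p A) g) + w A * (tw A (d A f) * d (p A) (N g))" if "A \<in> I" for A
    using that assms
    by (simp add: N_mult N_G G_w S_intros d_N tw_add tN distrib_left distrib_right add_ac)
  then show ?thesis
    using assms by (simp add: N_sum S_intros sum.distrib[symmetric])
qed

text \<open>
  The normalization \<open>1 - N / 2\<close> compensates the loss of degree in \<open>N_B1\<close>.
\<close>

lemma Eul_B1: assumes "f \<in> S" "g \<in> S"
  shows "Eul (B 1 f g) = B 1 (Eul f) g + B 1 f (Eul g)"
proof -
  have h: "B 1 (half * x) g = half * B 1 x g" "B 1 f (half * x) = half * B 1 f x" if "x \<in> S" for x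
    using that assms B_G_left[OF G_half, of x g 1] B_G_left[OF G_half, of f x 1]
    by (simp_all add: B_G_middle[OF G_half] half_commute[of f, symmetric] del: B.simps One_nat_def)
  have "half * (N (B 1 f g) + B 1 f g + B 1 f g) = half * (B 1 (N f) g + B 1 f (N g))"
    using N_B1[OF assms] by simp
  then have "half * N (B 1 f g) = half * B 1 (N f) g + half * B 1 f (N g) - B 1 f g"
    using half_double[of "B 1 f g"] by (simp add: distrib_left eq_diff_eq add.assoc del: B.simps One_nat_def)
  then show ?thesis
    using assms by (simp add: Eul_def B_diff_left B_diff_right S_intros S_N G_half G_S h del: B.simps One_nat_def)
qed

lemma G_dim: "dim \<in> G"
proof -
  have "(\<Sum>A\<in>X. if isodd A then - 1 else 1) \<in> G" if "finite X" for X
    using that by (induction X) (auto simp: G_0 G_add G_1 G_minus)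
  then show ?thesis by (simp add: dim_def finite_I)
qed

lemma gam_dim: "gam dim = dim"
  by (auto simp: dim_def gam_sum gam_minus gam_1 intro!: sum.cong)

text \<open>
  Integrating \<open>d A (z A * f)\<close> by parts, each even coordinate contributes \<open>-1\<close> and each odd
  coordinate \<open>1\<close> to \<open>J (N f)\<close> as a multiple of \<open>J f\<close>.
\<close>

lemma J_Eul: assumes "f \<in> D" shows "J (Eul f) + J (Eul f) = (2 + dim) * J f"
proof -
  have f: "f \<in> S" using assms D_S by blast
  have z: "z A * d A f \<in> D \<and> J (z A * d A f) = (if isodd A then J f else - J f)" if "A \<in> I" for A
  proof -
    have D: "z A * f \<in> D" "z A * d A f \<in> D"
      using that assms by (simp_all add: D_mult_left S_z D_d)
    have "d A (z A * f) = f + (if isodd A then - (z A * d A f) else z A * d A f)"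
      using that f by (simp add: d_mult S_z d_z gam_z)
    with J_d[OF that D(1)] have "J f + J (if isodd A then - (z A * d A f) else z A * d A f) = 0"
      using D(2) assms by (simp add: J_add D_minus split: if_splits)
    then show ?thesis
      using D(2) by (cases "isodd A") (simp_all add: J_minus add_eq_0_iff)
  qed
  have "J (N f) = - (dim * J f)"
    unfolding N_def using J_sum[OF finite_I D_0[OF assms], of "\<lambda>A. z A * d A f"] z
    by (auto simp: dim_def sum_distrib_right sum_negf[symmetric] intro!: sum.cong)
  moreover have "J (Eul f) = J f - half * J (N f)"
    using assms by (simp add: Eul_def J_diff D_N D_mult_left G_half G_S J_G_left gam_half)
  ultimately have "J (Eul f) = J f + half * (dim * J f)" by simp
  then have "J (Eul f) + J (Eul f) = (J f + J f) + (half * (dim * J f) + half * (dim * J f))"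
    by (simp only: add_ac)
  then show ?thesis
    by (simp add: half_double distrib_right mult_2)
qed

text \<open>
  The expressions on the left are the values of \<open>U f \<integral>g - (-1)\<^bsup>...\<^esup> U g \<integral>f\<close> on the parity parts of \<open>f\<close> and
  \<open>g\<close>. Moving the integral of \<open>f\<close> to the left of \<open>U g\<close> absorbs the signs into the parity automorphism,
  in a way that depends on the parity of the operator \<open>U\<close>.
\<close>

lemma graded_extension_sum:
  assumes D: "f0 \<in> D" "f1 \<in> D" "g0 \<in> D" "g1 \<in> D"
    and f: "gam f0 = f0" "gam f1 = - f1"
    and g: "gam g0 = g0" "gam g1 = - g1"
    and U_add: "\<And>u v. u \<in> D \<Longrightarrow> v \<in> D \<Longrightarrow> U (u + v) = U u + U v"
    and gam_U: "\<And>v. v \<in> D \<Longrightarrow> gam (U v) = (if b then - U (gam v) else U (gam v))"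
  shows "(U f0 * J g0 - U g0 * J f0) + (U f0 * J g1 + U g1 * J f0)
      + (- (U f1 * J g0) - U g0 * J f1) + (- (U f1 * J g1) - U g1 * J f1)
    = U (f0 - f1) * J (g0 + g1) + (if b then J (f0 - f1) * U (g0 + g1) else - (J (f0 + f1) * U (g0 + g1)))"
proof -
  have U_minus: "U (- v) = - U v" if "v \<in> D" for v
    using U_add[of 0 0] U_add[of v "- v"] that D_0[OF that] D_minus[OF that]
    by (simp add: eq_neg_iff_add_eq_0 add.commute)
  have U_diff: "U (u - v) = U u - U v" if "u \<in> D" "v \<in> D" for u v
    using U_add[of u "- v"] that by (simp add: U_minus D_minus)
  have "gam (J f0) = - J f0" "gam (J f1) = J f1"
    using D f by (simp_all add: gam_J J_minus)
  then have c: "J f0 * y = gam y * J f0" "J f1 * y = y * J f1" for y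
    using odd_commute even_commute by blast+
  have "gam (U g0) = (if b then - U g0 else U g0)" "gam (U g1) = (if b then U g1 else - U g1)"
    using D g by (simp_all add: gam_U U_minus)
  then show ?thesis
    using D by (simp add: U_add U_diff J_add J_diff c algebra_simps)
qed

end

section \<open>The odd derivation\<close>

locale deformation_data = integrated_superspace gam S G I isodd d p w D J z half
  for gam :: "'r::ring_1 \<Rightarrow> 'r" and S G and I :: "'i set" and isodd d p w D J z half +
  fixes \<theta> h1 h2 \<zeta> \<eta> :: 'r
  assumes G_\<theta>: "\<theta> \<in> G" and gam_\<theta>: "gam \<theta> = - \<theta>"
    and G_h1: "h1 \<in> G" and gam_h1: "gam h1 = - h1"
    and G_h2: "h2 \<in> G" and gam_h2: "gam h2 = h2"
    and S_\<zeta>: "\<zeta> \<in> S" and gam_\<zeta>: "gam \<zeta> = - \<zeta>"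
    and D_\<eta>: "\<eta> \<in> D" and gam_\<eta>: "gam \<eta> = \<eta>"
    and \<eta>_eq: "\<eta> = - \<theta> * h1 * B 3 \<zeta> \<zeta> - \<theta> * (Eul \<zeta> + Eul \<zeta> - (2 + dim) * \<zeta>)
        - J \<eta> * \<zeta> - B 1 \<zeta> \<zeta> + h2"
    and \<theta>_J_\<eta>: "\<theta> * J \<eta> = 0"
    and h2_eq: "\<theta> * (1 + dim) * h2 - J \<eta> * h2 = 0"
begin

definition bracket where "bracket f g = B 1 f g + \<theta> * h1 * B 3 f g"

text \<open>
  Not to be confused with the form \<open>\<omega>\<^sup>A\<^sup>B\<close>. The first summand comes from integrals of \<open>K f\<close>, the second one
  from the term \<open>\<integral>f \<eta> \<integral>g\<close> of the deformation.
\<close>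

definition \<omega> where "\<omega> = \<theta> * (2 + dim) - J \<eta>"

definition K where "K f = \<theta> * Eul f + bracket \<zeta> f"

text \<open>
  The bracket of the theorem, see \<open>deformed_expand\<close>.
\<close>

definition deformed where
  "deformed f g = bracket f g + K (gam f) * J g + J (gam f) * K g + J (gam f) * \<eta> * J g"

lemma odd_square: "gam x = - x \<Longrightarrow> x * x = 0"
  using odd_commute[of x x] by (intro minus_self) simp

lemma \<theta>_\<theta>: "\<theta> * \<theta> = 0" by (rule odd_square) (rule gam_\<theta>)

lemma \<theta>_\<theta>_mult: "\<theta> * (\<theta> * x) = 0" by (simp add: \<theta>_\<theta> mult.assoc[symmetric])

lemma \<theta>_commute: "x * \<theta> = \<theta> * gam x"
  using odd_commute[of \<theta> "gam x"] gam_\<theta> by (simp add: gam_gam)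

text \<open>
  All products of two of the elements \<open>\<theta>\<close> and \<open>\<theta> h\<^sub>1\<close> contain \<open>\<theta>\<^sup>2\<close>; the coefficient \<open>\<theta> h\<^sub>1\<close> can therefore
  be treated as an infinitesimal of first order.
\<close>

lemma t_mult_0: "\<theta> * h1 * (\<theta> * x) = 0" "\<theta> * (\<theta> * h1 * x) = 0" "\<theta> * h1 * (\<theta> * h1 * x) = 0"
proof -
  have "h1 * \<theta> = - \<theta> * h1" using \<theta>_commute[of h1] by (simp add: gam_h1)
  then have "\<theta> * h1 * \<theta> = 0" by (simp add: mult.assoc \<theta>_\<theta>_mult)
  then show "\<theta> * h1 * (\<theta> * x) = 0" "\<theta> * h1 * (\<theta> * h1 * x) = 0"
    by (simp_all add: mult.assoc[symmetric])
  show "\<theta> * (\<theta> * h1 * x) = 0" by (simp add: mult.assoc \<theta>_\<theta>_mult)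
qed

lemma G_t: "\<theta> * h1 \<in> G" by (simp add: G_\<theta> G_h1 G_mult)

lemma gam_t: "gam (\<theta> * h1) = \<theta> * h1" by (simp add: gam_mult gam_\<theta> gam_h1)

lemma t_left_commute: "x * (\<theta> * h1 * y) = \<theta> * h1 * (x * y)"
  using even_commute[OF gam_t, of x] by (simp add: mult.assoc[symmetric])

lemma t_commute: "x * (\<theta> * h1) = \<theta> * h1 * x"
  using even_commute[OF gam_t, of x] by simp

context
  notes One_nat_def [simp del] B.simps [simp del]
begin

lemma S_bracket: "f \<in> S \<Longrightarrow> g \<in> S \<Longrightarrow> bracket f g \<in> S"
  by (simp add: bracket_def S_add S_mult S_B G_S[OF G_t])

lemma D_bracket: "f \<in> S \<Longrightarrow> g \<in> D \<Longrightarrow> bracket f g \<in> D"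
  by (simp add: bracket_def D_add D_mult_left D_B G_S[OF G_t])

lemma bracket_add_left: "f \<in> S \<Longrightarrow> f' \<in> S \<Longrightarrow> g \<in> S \<Longrightarrow> bracket (f + f') g = bracket f g + bracket f' g"
  by (simp add: bracket_def B_add_left distrib_left)

lemma bracket_add_right: "f \<in> S \<Longrightarrow> g \<in> S \<Longrightarrow> g' \<in> S \<Longrightarrow> bracket f (g + g') = bracket f g + bracket f g'"
  by (simp add: bracket_def B_add_right distrib_left)

lemma bracket_minus_left: "f \<in> S \<Longrightarrow> g \<in> S \<Longrightarrow> bracket (- f) g = - bracket f g"
  by (simp add: bracket_def B_minus_left)

lemma bracket_minus_right: "f \<in> S \<Longrightarrow> g \<in> S \<Longrightarrow> bracket f (- g) = - bracket f g"
  by (simp add: bracket_def B_minus_right)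

lemma bracket_diff_left: "f \<in> S \<Longrightarrow> f' \<in> S \<Longrightarrow> g \<in> S \<Longrightarrow> bracket (f - f') g = bracket f g - bracket f' g"
  by (simp add: bracket_def B_diff_left right_diff_distrib)

lemma bracket_diff_right: "f \<in> S \<Longrightarrow> g \<in> S \<Longrightarrow> g' \<in> S \<Longrightarrow> bracket f (g - g') = bracket f g - bracket f g'"
  by (simp add: bracket_def B_diff_right right_diff_distrib)

lemma bracket_G_left: "c \<in> G \<Longrightarrow> f \<in> S \<Longrightarrow> g \<in> S \<Longrightarrow> bracket (c * f) g = c * bracket f g"
  by (simp add: bracket_def B_G_left distrib_left t_left_commute)

lemma bracket_G_right: "c \<in> G \<Longrightarrow> f \<in> S \<Longrightarrow> g \<in> S \<Longrightarrow> bracket f (g * c) = bracket f g * c"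
  by (simp add: bracket_def B_G_right distrib_right mult.assoc)

lemma bracket_G_middle: "c \<in> G \<Longrightarrow> f \<in> S \<Longrightarrow> g \<in> S \<Longrightarrow> bracket f (c * g) = bracket (f * c) g"
  by (simp add: bracket_def B_G_middle)

lemma bracket_const: "c \<in> G \<Longrightarrow> f \<in> S \<Longrightarrow> bracket f c = 0" "c \<in> G \<Longrightarrow> f \<in> S \<Longrightarrow> bracket c f = 0"
  using B_Suc_const[of c f 0] B_Suc_const[of c f 2] B_Suc_const_left[of c f 0] B_Suc_const_left[of c f 2]
  by (simp_all add: bracket_def One_nat_def numeral_eq_Suc)

lemma gam_bracket: "f \<in> S \<Longrightarrow> g \<in> S \<Longrightarrow> gam (bracket f g) = bracket (gam f) (gam g)"
  by (simp add: bracket_def gam_B gam_add gam_mult[of "\<theta> * h1"] gam_t)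

lemma hom_bracket: "f \<in> S \<Longrightarrow> g \<in> S \<Longrightarrow> hom a f \<Longrightarrow> hom b g \<Longrightarrow> hom (a + b) (bracket f g)"
  by (auto simp: hom_def gam_bracket minus_one_power_iff bracket_minus_left bracket_minus_right S_minus)

lemma bracket_swap: "f \<in> S \<Longrightarrow> g \<in> S \<Longrightarrow> hom a f \<Longrightarrow> hom b g \<Longrightarrow>
    bracket g f = - ((-1) ^ (a * b)) * bracket f g"
  by (simp add: bracket_def B_swap[of f g a b] minus_one_power_iff)

lemma bracket_jacobi:
  assumes "f \<in> S" "g \<in> S" "h \<in> S" "hom a f" "hom b g" "hom c h"
  shows "cyclic a b c (\<lambda>f g h. bracket f (bracket g h)) f g h = 0"
proof -
  have LL: "bracket f (bracket g h) = B 1 f (B 1 g h) + \<theta> * h1 * (B 1 f (B 3 g h) + B 3 f (B 1 g h))"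
    if "f \<in> S" "g \<in> S" "h \<in> S" for f g h
  proof -
    have "B r f (\<theta> * h1 * B 3 g h) = \<theta> * h1 * B r f (B 3 g h)" for r
      using that by (simp add: B_G_middle G_t S_B t_commute B_G_left)
    then show ?thesis
      using that by (simp add: bracket_def B_add_right S_B S_mult G_S[OF G_t] distrib_left t_mult_0 add_ac)
  qed
  have "cyclic a b c (\<lambda>f g h. bracket f (bracket g h)) f g h
    = cyclic a b c (\<lambda>f g h. B 1 f (B 1 g h)) f g h
      + \<theta> * h1 * cyclic a b c (\<lambda>f g h. B 1 f (B 3 g h) + B 3 f (B 1 g h)) f g h"
    using assms(1-3) by (simp add: cyclic_def LL minus_one_power_iff algebra_simps)
  then show ?thesis
    by (simp add: jacobi_B1[OF assms] cocycle_B3[OF assms])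
qed

text \<open>
  The form of the Jacobi identity that says that \<open>[f, \<cdot>]\<close> is a derivation.
\<close>

lemma bracket_leibniz:
  assumes "f \<in> S" "g \<in> S" "h \<in> S" "hom a f" "hom b g" "hom c h"
  shows "bracket f (bracket g h) = bracket (bracket f g) h + (-1) ^ (a * b) * bracket g (bracket f h)"
proof -
  have *: "bracket h (bracket f g) = - ((-1) ^ ((a + b) * c)) * bracket (bracket f g) h"
    by (rule bracket_swap) (use assms in \<open>auto intro: hom_bracket S_bracket\<close>)
  show ?thesis
    using bracket_jacobi[OF assms] bracket_swap[OF assms(1,3,4,6)] assms(1-3)
    by (cases "even a"; cases "even b"; cases "even c")
      (simp_all add: cyclic_def * bracket_minus_right S_bracket eq_neg_iff_add_eq_0 eq_diff_eq neg_eq_iff_add_eq_0 algebra_simps)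
qed

lemma S_K: "f \<in> S \<Longrightarrow> K f \<in> S"
  by (simp add: K_def S_add S_mult S_Eul S_bracket S_\<zeta> G_S[OF G_\<theta>])

lemma D_K: "f \<in> D \<Longrightarrow> K f \<in> D"
  by (simp add: K_def D_add D_mult_left D_Eul D_bracket S_\<zeta> G_S[OF G_\<theta>])

lemma gam_K: "f \<in> S \<Longrightarrow> gam (K f) = - K (gam f)"
  by (simp add: K_def gam_add gam_mult gam_\<theta> gam_Eul gam_bracket S_\<zeta> gam_\<zeta> bracket_minus_left S_gam)

lemma K_add: "f \<in> S \<Longrightarrow> g \<in> S \<Longrightarrow> K (f + g) = K f + K g"
  by (simp add: K_def Eul_add distrib_left bracket_add_right S_\<zeta> add_ac)

lemma \<zeta>_G: "c \<in> G \<Longrightarrow> f \<in> S \<Longrightarrow> bracket \<zeta> (c * f) = gam c * bracket \<zeta> f"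
  using odd_commute[OF gam_\<zeta>, of c]
  by (simp add: bracket_G_middle S_\<zeta> bracket_G_left G_gam)

lemma K_G_left: "c \<in> G \<Longrightarrow> f \<in> S \<Longrightarrow> K (c * f) = gam c * K f"
  using \<theta>_commute[of "gam c"]
  by (simp add: K_def Eul_G_left \<zeta>_G distrib_left gam_gam flip: mult.assoc)

lemma K_G_right: "c \<in> G \<Longrightarrow> f \<in> S \<Longrightarrow> K (f * c) = K f * c"
  by (simp add: K_def Eul_G_right bracket_G_right S_\<zeta> distrib_right mult.assoc)

lemma K_minus: "f \<in> S \<Longrightarrow> K (- f) = - K f"
  using K_G_right[of "- 1" f] by (simp add: G_minus G_1)

lemma hom_K: "f \<in> S \<Longrightarrow> hom a f \<Longrightarrow> hom (Suc a) (K f)"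
  by (auto simp: hom_def gam_K minus_one_power_iff K_minus)

lemma hom_\<zeta>: "hom 1 \<zeta>" by (simp add: hom_def gam_\<zeta>)

lemma hom_\<eta>: "hom 0 \<eta>" by (simp add: hom_def gam_\<eta>)

lemma \<theta>_bracket: "\<theta> * bracket f g = \<theta> * B 1 f g"
  by (simp add: bracket_def distrib_left t_mult_0)

text \<open>
  The Euler operator is a derivation of the Poisson bracket only, but the factor \<open>\<theta>\<close> removes the term
  with \<open>B 3\<close>.
\<close>

lemma \<theta>_Eul_bracket: "f \<in> S \<Longrightarrow> g \<in> S \<Longrightarrow>
    \<theta> * Eul (bracket f g) = \<theta> * bracket (Eul f) g + \<theta> * bracket f (Eul g)"
  by (simp add: \<theta>_bracket Eul_B1 distrib_left[symmetric])
    (simp add: bracket_def Eul_add S_B S_mult G_S[OF G_t] Eul_G_left G_t distrib_left t_mult_0 Eul_B1)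

lemma bracket_\<theta>: "f \<in> S \<Longrightarrow> g \<in> S \<Longrightarrow> hom a f \<Longrightarrow> bracket f (\<theta> * g) = (-1) ^ a * (\<theta> * bracket f g)"
  using \<theta>_commute[of f]
  by (auto simp: bracket_G_middle G_\<theta> bracket_G_left S_minus hom_gam bracket_minus_right bracket_minus_left)

text \<open>
  Both summands of \<open>K\<close> are odd derivations: \<open>\<theta>\<close> is odd and \<open>\<E>\<close> an even derivation, and \<open>[\<zeta>, \<cdot>]\<close> is an odd
  derivation by the Jacobi identity.
\<close>

lemma K_bracket:
  assumes "f \<in> S" "g \<in> S" "hom a f" "hom b g"
  shows "K (bracket f g) = bracket (K f) g + (-1) ^ a * bracket f (K g)"
proof -
  have 1: "bracket (K f) g = \<theta> * bracket (Eul f) g + bracket (bracket \<zeta> f) g"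
    using assms by (simp add: K_def bracket_add_left bracket_G_left S_mult S_Eul S_bracket S_\<zeta> G_\<theta> G_S)
  have 2: "bracket f (K g) = (-1) ^ a * (\<theta> * bracket f (Eul g)) + bracket f (bracket \<zeta> g)"
    using assms by (simp add: K_def bracket_add_right bracket_\<theta> S_mult S_Eul S_bracket S_\<zeta> G_\<theta> G_S)
  show ?thesis
    unfolding 1 2 using bracket_leibniz[OF S_\<zeta> assms(1,2) hom_\<zeta> assms(3,4)] assms(1,2)
    by (simp add: K_def \<theta>_Eul_bracket minus_one_power_iff algebra_simps)
qed

lemma G_J_\<eta>: "J \<eta> \<in> G" by (simp add: G_J D_\<eta>)

lemma gam_J_\<eta>: "gam (J \<eta>) = - J \<eta>" by (simp add: gam_J D_\<eta> gam_\<eta>)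

lemma two_dim_commute: "x * (2 + dim) = (2 + dim) * x" "gam (2 + dim) = 2 + dim" "2 + dim \<in> G"
proof -
  show *: "gam (2 + dim) = 2 + dim"
    by (metis gam_add gam_dim gam_1 one_add_one)
  show "x * (2 + dim) = (2 + dim) * x"
    using even_commute[OF *, of x] by simp
  show "2 + dim \<in> G"
    using G_add[OF G_add[OF G_1 G_1] G_dim] by simp
qed

lemma G_\<omega>: "\<omega> \<in> G"
  by (simp add: \<omega>_def G_diff G_mult G_\<theta> two_dim_commute G_J_\<eta>)

lemma gam_\<omega>: "gam \<omega> = - \<omega>"
  by (simp add: \<omega>_def gam_diff gam_mult gam_\<theta> two_dim_commute gam_J_\<eta>)

lemma \<theta>_\<omega>: "\<theta> * \<omega> = 0" "\<omega> * \<theta> = 0"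
proof -
  show "\<theta> * \<omega> = 0" by (simp add: \<omega>_def right_diff_distrib \<theta>_J_\<eta> \<theta>_\<theta>_mult)
  then show "\<omega> * \<theta> = 0" by (simp add: \<theta>_commute gam_\<omega>)
qed

lemma \<theta>_\<omega>_mult: "\<theta> * (\<omega> * x) = 0" "\<omega> * (\<theta> * x) = 0"
  by (simp_all add: \<theta>_\<omega> mult.assoc[symmetric])

lemma \<eta>_alt: "\<eta> = - bracket \<zeta> \<zeta> - \<theta> * (Eul \<zeta> + Eul \<zeta>) + \<omega> * \<zeta> + h2"
  by (subst \<eta>_eq) (simp add: \<omega>_def bracket_def right_diff_distrib left_diff_distrib mult.assoc)

lemma in_S: "\<eta> \<in> S" "h2 \<in> S" "\<theta> \<in> S" "\<omega> \<in> S" "Eul \<zeta> \<in> S"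
  by (auto intro: D_S G_S D_\<eta> G_h2 G_\<theta> G_\<omega> S_Eul S_\<zeta>)

text \<open>
  On the one hand \<open>2 K\<^sup>2 f = [2 \<theta> \<E> \<zeta> + [\<zeta>, \<zeta>], f]\<close>, because \<open>\<theta>\<^sup>2 = 0\<close> and \<open>\<zeta>\<close> is odd. On the other hand the
  equation for \<open>\<eta>\<close> identifies the first entry with \<open>\<omega> \<zeta> + h\<^sub>2 - \<eta>\<close>, constants have vanishing brackets,
  and \<open>\<omega> [\<zeta>, f] = \<omega> K f\<close> since \<open>\<omega> \<theta> = 0\<close>.
\<close>

lemma K_K:
  assumes "f \<in> S" "hom a f"
  shows "K (K f) + K (K f) = \<omega> * K f - bracket \<eta> f"
proof -
  note S = assms(1) S_\<zeta> in_S
  have "K (K f) = \<theta> * Eul (bracket \<zeta> f) - \<theta> * bracket \<zeta> (Eul f) + bracket \<zeta> (bracket \<zeta> f)"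
    using S by (simp add: K_def Eul_add S_mult S_Eul S_bracket Eul_G_left G_\<theta> distrib_left \<theta>_\<theta>_mult
        bracket_add_right \<zeta>_G gam_\<theta>)
  then have KK: "K (K f) = \<theta> * bracket (Eul \<zeta>) f + bracket \<zeta> (bracket \<zeta> f)"
    using S by (simp add: \<theta>_Eul_bracket)
  have \<zeta>\<zeta>: "bracket (bracket \<zeta> \<zeta>) f = bracket \<zeta> (bracket \<zeta> f) + bracket \<zeta> (bracket \<zeta> f)"
    using bracket_leibniz[OF S_\<zeta> S_\<zeta> assms(1) hom_\<zeta> hom_\<zeta> assms(2)] by (simp add: algebra_simps)
  have "bracket \<eta> f = - bracket (bracket \<zeta> \<zeta>) f - \<theta> * (bracket (Eul \<zeta>) f + bracket (Eul \<zeta>) f)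
      + \<omega> * bracket \<zeta> f"
    using S by (subst \<eta>_alt) (simp add: bracket_add_left bracket_diff_left bracket_minus_left S_bracket S_add S_mult S_minus S_diff
        bracket_G_left G_\<theta> G_\<omega> bracket_const G_h2)
  moreover have "\<omega> * K f = \<omega> * bracket \<zeta> f"
    by (simp add: K_def distrib_left \<theta>_\<omega>_mult)
  ultimately show ?thesis
    by (simp add: KK \<zeta>\<zeta> algebra_simps)
qed

text \<open>
  The three terms of the Jacobi identity coincide, and the ring has no 3-torsion.
\<close>

lemma \<zeta>_\<zeta>_\<zeta>: "bracket \<zeta> (bracket \<zeta> \<zeta>) = 0"
  using bracket_jacobi[OF S_\<zeta> S_\<zeta> S_\<zeta> hom_\<zeta> hom_\<zeta> hom_\<zeta>] torsion_3[of "- bracket \<zeta> (bracket \<zeta> \<zeta>)"]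
  by (simp add: cyclic_def)

text \<open>
  Inserting the equation for \<open>\<eta>\<close>, both sides become \<open>\<theta> h\<^sub>2 - \<omega> [\<zeta>, \<zeta>]\<close>. For the right-hand side this uses
  \<open>\<omega>\<^sup>2 = 0\<close> and \<open>\<omega> h\<^sub>2 = \<theta> h\<^sub>2\<close>; the latter is the equation for \<open>h\<^sub>2\<close>.
\<close>

lemma K_\<eta>: "K \<eta> = \<omega> * \<eta>"
proof -
  note S = S_\<zeta> in_S
  have Em: "Eul (- x) = - Eul x" if "x \<in> S" for x
    using that Eul_G_right[of "- 1" x] by (simp add: G_1 G_minus)
  have Ed: "Eul (x - y) = Eul x - Eul y" if "x \<in> S" "y \<in> S" for x y
    using that Eul_add[of x "- y"] by (simp add: Em S_minus)
  have hE: "hom 1 (Eul \<zeta>)" by (simp add: hom_def gam_Eul S_\<zeta> gam_\<zeta> Em)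
  have sw: "bracket (Eul \<zeta>) \<zeta> = bracket \<zeta> (Eul \<zeta>)"
    using bracket_swap[OF S_\<zeta> in_S(5) hom_\<zeta> hE] by simp
  have "\<theta> * Eul \<eta> = - (\<theta> * Eul (bracket \<zeta> \<zeta>)) + \<theta> * h2"
    using S by (subst \<eta>_alt) (simp add: Eul_add Ed Em S_bracket S_add S_mult S_minus S_diff S_Eul
        Eul_G_left G_\<theta> G_\<omega> G_h2 Eul_G distrib_left right_diff_distrib \<theta>_\<omega>_mult \<theta>_\<theta>_mult)
  then have 1: "\<theta> * Eul \<eta> = - (\<theta> * bracket \<zeta> (Eul \<zeta>)) - \<theta> * bracket \<zeta> (Eul \<zeta>) + \<theta> * h2"
    using S by (simp add: \<theta>_Eul_bracket sw)
  have 2: "bracket \<zeta> \<eta> = \<theta> * bracket \<zeta> (Eul \<zeta>) + \<theta> * bracket \<zeta> (Eul \<zeta>) - \<omega> * bracket \<zeta> \<zeta>"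
    using S by (subst \<eta>_alt) (simp add: bracket_add_right bracket_diff_right bracket_minus_right S_bracket S_add S_mult S_minus S_diff
        \<zeta>_G G_\<theta> G_\<omega> bracket_const G_h2 \<zeta>_\<zeta>_\<zeta> gam_\<theta> gam_\<omega> distrib_left)
  have "\<theta> * (2 + dim) * h2 - J \<eta> * h2 = \<theta> * h2 + (\<theta> * (1 + dim) * h2 - J \<eta> * h2)"
    by (simp add: algebra_simps mult_2)
  then have "\<omega> * h2 = \<theta> * h2"
    unfolding h2_eq by (simp add: \<omega>_def left_diff_distrib)
  moreover have "\<omega> * (\<omega> * \<zeta>) = 0"
    by (simp add: odd_square gam_\<omega> mult.assoc[symmetric])
  ultimately have 3: "\<omega> * \<eta> = - (\<omega> * bracket \<zeta> \<zeta>) + \<theta> * h2"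
    by (subst \<eta>_alt) (simp add: distrib_left right_diff_distrib \<theta>_\<omega>_mult)
  show ?thesis
    unfolding K_def[of \<eta>] 1 2 3 by simp
qed

section \<open>The deformed bracket\<close>

lemma D_deformed: "f \<in> D \<Longrightarrow> g \<in> D \<Longrightarrow> deformed f g \<in> D"
  by (simp add: deformed_def D_add D_bracket D_S D_mult_G D_K D_gam G_J D_mult_left G_S D_\<eta>)

text \<open>
  Only the Euler operator contributes, because integrals of brackets vanish.
\<close>

lemma J_K: assumes "f \<in> D" shows "J (K f) = - (\<theta> * J (Eul f))"
proof -
  have "J (bracket \<zeta> f) = 0"
    using J_B[OF S_\<zeta> assms, of 0] J_B[OF S_\<zeta> assms, of 2] assms
    by (simp add: bracket_def J_add D_B S_\<zeta> D_mult_left G_S[OF G_t] J_G_left G_t One_nat_def numeral_eq_Suc)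
  then show ?thesis
    using assms by (simp add: K_def J_add D_mult_left G_S[OF G_\<theta>] D_Eul D_bracket S_\<zeta> J_G_left G_\<theta> gam_\<theta>)
qed

lemma J_bracket: "f \<in> D \<Longrightarrow> g \<in> D \<Longrightarrow> J (bracket f g) = 0"
  using J_B[of f g 0] J_B[of f g 2]
  by (simp add: bracket_def J_add D_B D_S D_mult_left G_S[OF G_t] J_G_left G_t One_nat_def numeral_eq_Suc)

lemma hom_J: "f \<in> D \<Longrightarrow> hom a f \<Longrightarrow> hom (Suc a) (J f)"
  by (auto simp: hom_def gam_J minus_one_power_iff J_minus)

lemma deformed_hom:
  assumes "f \<in> D" "g \<in> D" "hom a f"
  shows "deformed f g = bracket f g + (-1) ^ a * (K f * J g) + (-1) ^ a * (J f * K g) + (-1) ^ a * (J f * \<eta> * J g)"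
  using assms by (auto simp: deformed_def hom_gam K_minus J_minus D_S)

lemma \<eta>_commute: "x * \<eta> = \<eta> * x"
  using even_commute[OF gam_\<eta>, of x] by simp

text \<open>
  The two terms with \<open>K\<close> contribute the same multiple of \<open>\<theta> \<integral>f \<integral>g\<close>; together they give \<open>-(2 + n - m) \<theta>\<close>,
  and the term with \<open>\<eta>\<close> completes this to \<open>-\<omega>\<close>.
\<close>

lemma J_deformed:
  assumes "f \<in> D" "g \<in> D" "hom a f" "hom b g"
  shows "J (deformed f g) = - ((-1) ^ a * (\<omega> * J f * J g))"
proof -
  \<comment> \<open>the factor with \<open>\<integral>\<E> x = e \<integral>x\<close>\<close>
  define e where "e = half * (2 + dim)"
  have e: "x * e = e * x" for x
    using even_commute[of e x] by (simp add: e_def gam_mult gam_half two_dim_commute)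
  have E: "J (Eul x) = e * J x" if "x \<in> D" for x
    using half_double[of "J (Eul x)"] J_Eul[OF that] by (simp add: distrib_left[symmetric] e_def mult.assoc)
  have ee: "e + e = 2 + dim" by (simp add: e_def half_double)
  note D = assms(1,2) D_K[OF assms(1)] D_K[OF assms(2)] G_J[OF assms(1)] G_J[OF assms(2)]
    D_mult_left[OF G_S] D_mult_G D_bracket[OF D_S] D_\<eta> G_J_\<eta>
  have sgn: "(-1) ^ n * x \<in> D \<and> J ((-1) ^ n * x) = (-1) ^ n * J x" if "x \<in> D" for n x
    using that by (cases "even n") (simp_all add: D_minus J_minus)
  have "J (deformed f g) = (-1) ^ a * (J (K f) * J g) + (-1) ^ a * (gam (J f) * J (K g))
      + (-1) ^ a * (gam (J f) * J \<eta> * J g)"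
    unfolding deformed_hom[OF assms(1-3)] using D sgn
    by (simp add: J_add D_add J_bracket J_G_left J_G_right mult.assoc)
  also have "gam (J f) * J \<eta> = J \<eta> * J f"
    using odd_commute[OF gam_J_\<eta>] by simp
  also have "J (K f) * J g = - (\<theta> * e * J f * J g)"
    using assms by (simp add: J_K E mult.assoc)
  also have "gam (J f) * J (K g) = - (\<theta> * e * J f * J g)"
  proof -
    have "gam (J f) * J (K g) = - (gam (J f) * \<theta> * (e * J g))"
      using assms by (simp add: J_K E mult.assoc)
    also have "gam (J f) * \<theta> = \<theta> * J f" by (simp add: \<theta>_commute gam_gam)
    finally show ?thesis using e[of "J f"] by (simp add: mult.assoc) (simp add: mult.assoc[symmetric])
  qed
  finally have "J (deformed f g) = - ((-1) ^ a * ((\<theta> * (e + e) - J \<eta>) * J f * J g))"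
    by (simp add: algebra_simps)
  then show ?thesis by (simp add: ee \<omega>_def)
qed

lemma deformed_antisym:
  assumes "f \<in> D" "g \<in> D" "hom a f" "hom b g"
  shows "deformed f g = - ((-1) ^ (a * b)) * deformed g f"
proof -
  note h = hom_J[OF assms(1,3)] hom_J[OF assms(2,4)] hom_K[OF D_S[OF assms(1)] assms(3)]
    hom_K[OF D_S[OF assms(2)] assms(4)]
  have 1: "J g * K f = (-1) ^ (Suc a * Suc b) * (K f * J g)"
    "J g * (\<eta> * J f) = (-1) ^ (Suc a * Suc b) * (J f * (\<eta> * J g))"
    "K g * J f = (-1) ^ (Suc a * Suc b) * (J f * K g)"
    using hom_commute[OF h(3) h(2)] hom_commute[OF h(1) h(4)] hom_commute[OF h(1) h(2)]
      \<eta>_commute[of "J g"] \<eta>_commute[of "J f"]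
    by (simp_all add: mult.assoc[symmetric]) (simp add: mult.assoc minus_one_power_iff)
  show ?thesis
    unfolding deformed_hom[OF assms(1-3)] deformed_hom[OF assms(2,1,4)]
      bracket_swap[OF D_S[OF assms(1)] D_S[OF assms(2)] assms(3,4)]
    by (simp add: mult.assoc 1 minus_one_power_iff)
qed

lemma deformed_add_left: "f \<in> D \<Longrightarrow> f' \<in> D \<Longrightarrow> g \<in> D \<Longrightarrow> deformed (f + f') g = deformed f g + deformed f' g"
  by (simp add: deformed_def bracket_add_left D_S gam_add K_add S_gam J_add D_gam distrib_right add_ac)

lemma deformed_add_right: "f \<in> D \<Longrightarrow> g \<in> D \<Longrightarrow> g' \<in> D \<Longrightarrow> deformed f (g + g') = deformed f g + deformed f g'"
  by (simp add: deformed_def bracket_add_right D_S K_add S_gam J_add D_gam distrib_left add_ac)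

lemma deformed_G_left: "c \<in> G \<Longrightarrow> f \<in> D \<Longrightarrow> g \<in> D \<Longrightarrow> deformed (c * f) g = c * deformed f g"
  by (simp add: deformed_def bracket_G_left D_S gam_mult K_G_left S_gam J_G_left D_gam G_gam gam_gam distrib_left mult.assoc)

lemma deformed_G_right: "c \<in> G \<Longrightarrow> f \<in> D \<Longrightarrow> g \<in> D \<Longrightarrow> deformed f (g * c) = deformed f g * c"
  by (simp add: deformed_def bracket_G_right D_S K_G_right S_gam J_G_right D_gam distrib_right mult.assoc)

lemma deformed_G_middle: "c \<in> G \<Longrightarrow> f \<in> D \<Longrightarrow> g \<in> D \<Longrightarrow> deformed f (c * g) = deformed (f * c) g"
  using \<eta>_commute
  by (simp add: deformed_def bracket_G_middle D_S gam_mult K_G_right K_G_left S_gam J_G_right J_G_left D_gam G_gam mult.assoc)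

lemma gam_deformed: "f \<in> D \<Longrightarrow> g \<in> D \<Longrightarrow> gam (deformed f g) = deformed (gam f) (gam g)"
  by (simp add: deformed_def gam_add gam_mult gam_bracket gam_K gam_J gam_gam D_S D_gam S_gam gam_\<eta>)

lemma hom_deformed:
  assumes "f \<in> D" "g \<in> D" "hom a f" "hom b g"
  shows "hom (a + b) (deformed f g)"
  using assms deformed_G_left[of "- 1" f g] deformed_G_right[of "- 1" f g] deformed_G_left[of "- 1" f "- g"]
  by (cases "even a"; cases "even b")
    (simp_all add: hom_def gam_deformed G_minus G_1 D_minus)

text \<open>
  Here \<open>\<integral>g\<close> and \<open>\<integral>f\<close> are moved to the left. The terms with three integrals come from \<open>K (\<integral>g \<eta> \<integral>h)\<close> and
  from \<open>\<integral>(C g h)\<close>; they cancel by \<open>K \<eta> = \<omega> \<eta>\<close>. Likewise \<open>[f, \<eta>]\<close> and the contribution of \<open>\<integral>(C g h)\<close> to the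
  coefficient of \<open>\<integral>g \<integral>h\<close> combine to \<open>2 K\<^sup>2 f\<close>.
\<close>

lemma deformed_deformed:
  assumes "f \<in> D" "g \<in> D" "h \<in> D" "hom a f" "hom b g" "hom c h"
  shows "deformed f (deformed g h) = bracket f (bracket g h)
     + (-1) ^ b * (bracket f (K g) * J h)
     + (-1) ^ (b + a * b + a) * (J g * bracket f (K h))
     + (-1) ^ a * (J f * K (bracket g h))
     + (-1) ^ (b + a * b + a) * (J g * (K (K f) + K (K f)) * J h)
     + (-1) ^ (a + b) * (J f * K (K g) * J h)
     - (-1) ^ a * (J f * J g * K (K h))"
proof -
  note S = D_S[OF assms(1)] D_S[OF assms(2)] D_S[OF assms(3)]
  note G = G_J[OF assms(1)] G_J[OF assms(2)] G_J[OF assms(3)]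
  note closed = S assms(1-3) S_K[OF S(1)] S_K[OF S(2)] S_K[OF S(3)] G G_S[OF G(1)] G_S[OF G(2)] G_S[OF G(3)]
     D_S[OF D_\<eta>] S_bracket D_bracket D_\<eta> D_K
  have Lf: "bracket f (J g * x) = (-1) ^ (a * Suc b) * (J g * bracket f x)" if "x \<in> S" for x
    using hom_commute[OF hom_J[OF assms(2,5)] assms(4)] that closed
    by (auto simp: bracket_G_middle bracket_G_left minus_one_power_iff bracket_minus_left S_mult)
  have Kg: "K (J g * x) = (-1) ^ Suc b * (J g * K x)" if "x \<in> S" for x
    using hom_J[OF assms(2,5)] that closed by (simp add: K_G_left hom_def mult.assoc)
  have sgn_in: "(-1) ^ n * x \<in> S" if "x \<in> S" for n x
    using that by (auto simp: minus_one_power_iff S_minus)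
  have bracket_sgn: "bracket f ((-1) ^ n * x) = (-1) ^ n * bracket f x" if "x \<in> S" for n x
    using that closed by (auto simp: minus_one_power_iff bracket_minus_right)
  have K_sgn: "K ((-1) ^ n * x) = (-1) ^ n * K x" if "x \<in> S" for n x
    using that closed by (auto simp: minus_one_power_iff K_minus)
  have bracket_X: "bracket f (deformed g h) = bracket f (bracket g h) + (-1) ^ b * (bracket f (K g) * J h)
     + (-1) ^ b * ((-1) ^ (a * Suc b) * (J g * bracket f (K h)))
     + (-1) ^ b * ((-1) ^ (a * Suc b) * (J g * bracket f \<eta> * J h))"
    using closed by (simp add: deformed_hom[OF assms(2,3,5)] bracket_add_right S_mult S_add sgn_in bracket_sgn
       bracket_G_right Lf mult.assoc)
  have K_X: "K (deformed g h) = K (bracket g h) + (-1) ^ b * (K (K g) * J h)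
     - J g * K (K h) - J g * (\<omega> * \<eta>) * J h"
    using closed by (simp add: deformed_hom[OF assms(2,3,5)] K_add S_mult S_add sgn_in K_sgn
       K_G_right Kg K_\<eta> mult.assoc) (simp add: minus_one_power_iff)
  have J_X: "J (deformed g h) = - ((-1) ^ b * (\<omega> * J g * J h))"
    by (rule J_deformed[OF assms(2,3,5,6)])
  have h\<omega>: "hom 1 \<omega>" by (simp add: hom_def gam_\<omega>)
  have K\<omega>: "K f * \<omega> = (-1) ^ Suc a * (\<omega> * K f)"
    using hom_commute[OF h\<omega> hom_K[OF S(1) assms(4)]] by (cases "even a") simp_all
  have "hom (1 + Suc a) (\<omega> * K f)"
    by (rule hom_mult[OF h\<omega> hom_K[OF S(1) assms(4)]])
  then have \<omega>K: "\<omega> * K f * J g = (-1) ^ (a * Suc b) * (J g * (\<omega> * K f))"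
    using hom_commute[OF hom_J[OF assms(2,5)], of "1 + Suc a" "\<omega> * K f"]
    by (cases "even a"; cases "even b") simp_all
  have "K f * (\<omega> * J g * J h) = (-1) ^ Suc a * (\<omega> * K f * J g) * J h"
    by (simp add: mult.assoc[symmetric] K\<omega>)
  also have "\<dots> = (-1) ^ Suc a * ((-1) ^ (a * Suc b) * (J g * (\<omega> * K f))) * J h"
    by (simp only: \<omega>K)
  finally have K_J: "K f * J (deformed g h) = (-1) ^ (a + b + a * Suc b) * (J g * (\<omega> * K f) * J h)"
    by (cases "even a"; cases "even b") (simp_all add: J_X mult.assoc)
  have "\<eta> * (\<omega> * J g) = (-1) ^ Suc b * (J g * (\<omega> * \<eta>))"
    using hom_commute[OF hom_J[OF assms(2,5)] h\<omega>] \<eta>_commute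
    by (simp add: mult.assoc[symmetric])
  moreover have "J f * \<eta> * J (deformed g h) = - ((-1) ^ b * (J f * (\<eta> * (\<omega> * J g)) * J h))"
    by (cases "even b") (simp_all add: J_X mult.assoc)
  ultimately have \<eta>_J: "J f * \<eta> * J (deformed g h) = J f * J g * (\<omega> * \<eta>) * J h"
    by (cases "even b") (simp_all add: mult.assoc)
  have L\<eta>: "bracket f \<eta> = - bracket \<eta> f"
    using bracket_swap[OF D_S[OF D_\<eta>] S(1) hom_\<eta> assms(4)] by simp
  show ?thesis
    unfolding deformed_hom[OF assms(1) D_deformed[OF assms(2,3)] assms(4)] bracket_X K_X K_J \<eta>_J K_K[OF S(1) assms(4)] L\<eta>
    by (cases "even a"; cases "even b")
      (simp_all add: minus_one_power_iff algebra_simps)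
qed

text \<open>
  The terms of the cyclic sum that contain only the integral of \<open>h\<close>. They cancel because \<open>K\<close> is a
  derivation of the bracket.
\<close>

lemma jacobi_linear_terms:
  assumes "f \<in> D" "g \<in> D" "h \<in> D" "hom a f" "hom b g" "hom c h"
  shows "(-1) ^ (a * c) * ((-1) ^ b * (bracket f (K g) * J h))
    + (-1) ^ (b * a) * ((-1) ^ (c + b * c + b) * (J h * bracket g (K f)))
    + (-1) ^ (c * b) * ((-1) ^ c * (J h * K (bracket f g))) = 0"
proof -
  note S = D_S[OF assms(1)] D_S[OF assms(2)]
  have "hom (a + Suc b) (bracket f (K g))"
    by (rule hom_bracket) (use assms S in \<open>auto intro: S_K hom_K\<close>)
  from hom_commute[OF hom_J[OF assms(3,6)] this]
  have 1: "bracket f (K g) * J h = (-1) ^ (Suc c * (a + Suc b)) * (J h * bracket f (K g))" .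
  have 2: "bracket (K f) g = - ((-1) ^ (b * Suc a)) * bracket g (K f)"
    by (rule bracket_swap) (use assms S in \<open>auto intro: S_K hom_K\<close>)
  show ?thesis
    unfolding K_bracket[OF S assms(4,5)] 1 2
    by (cases "even a"; cases "even b"; cases "even c") (simp_all add: algebra_simps)
qed

text \<open>
  The terms of the cyclic sum in which \<open>f\<close> is not integrated but \<open>g\<close> and \<open>h\<close> are. They are the multiples
  \<open>2\<close>, \<open>-1\<close> and \<open>-1\<close> of the same expression.
\<close>

lemma jacobi_quadratic_terms:
  assumes "f \<in> D" "g \<in> D" "h \<in> D" "hom a f" "hom b g" "hom c h"
  shows "(-1) ^ (a * c) * ((-1) ^ (b + a * b + a) * (J g * (K (K f) + K (K f)) * J h))
    - (-1) ^ (b * a) * ((-1) ^ b * (J g * J h * K (K f)))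
    + (-1) ^ (c * b) * ((-1) ^ (c + a) * (J h * K (K f) * J g)) = 0"
proof -
  note S = D_S[OF assms(1)]
  have h: "hom (Suc (Suc a)) (K (K f))"
    using assms S by (auto intro: S_K hom_K)
  have 1: "J g * J h * K (K f) = (-1) ^ (a * Suc c) * (J g * (K (K f) * J h))"
    using hom_commute[OF h hom_J[OF assms(3,6)]]
    by (cases "even a"; cases "even c") (simp_all add: mult.assoc)
  have 3: "K (K f) * J g = (-1) ^ (Suc b * Suc (Suc a)) * (J g * K (K f))"
    by (rule hom_commute[OF hom_J[OF assms(2,5)] h])
  have "J h * K (K f) * J g = (-1) ^ ((Suc (Suc a) + Suc b) * Suc c) * (K (K f) * J g * J h)"
    unfolding mult.assoc[of "J h"]
    by (rule hom_commute[OF hom_mult[OF h hom_J[OF assms(2,5)]] hom_J[OF assms(3,6)]])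
  then have 2: "J h * K (K f) * J g =
     (-1) ^ ((Suc (Suc a) + Suc b) * Suc c + Suc b * Suc (Suc a)) * (J g * (K (K f) * J h))"
    unfolding 3
    by (cases "even a"; cases "even b"; cases "even c") (simp_all add: mult.assoc)
  show ?thesis
    unfolding 1 2
    by (cases "even a"; cases "even b"; cases "even c") (simp_all add: algebra_simps)
qed

lemma deformed_jacobi:
  assumes "f \<in> D" "g \<in> D" "h \<in> D" "hom a f" "hom b g" "hom c h"
  shows "cyclic a b c (\<lambda>f g h. deformed f (deformed g h)) f g h = 0"
proof -
  note S = assms(1-3)[THEN D_S]
  have "cyclic a b c (\<lambda>f g h. deformed f (deformed g h)) f g h =
    cyclic a b c (\<lambda>f g h. bracket f (bracket g h)) f g h
    + ((-1) ^ (a * c) * ((-1) ^ b * (bracket f (K g) * J h))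
      + (-1) ^ (b * a) * ((-1) ^ (c + b * c + b) * (J h * bracket g (K f)))
      + (-1) ^ (c * b) * ((-1) ^ c * (J h * K (bracket f g))))
    + ((-1) ^ (b * a) * ((-1) ^ c * (bracket g (K h) * J f))
      + (-1) ^ (c * b) * ((-1) ^ (a + c * a + c) * (J f * bracket h (K g)))
      + (-1) ^ (a * c) * ((-1) ^ a * (J f * K (bracket g h))))
    + ((-1) ^ (c * b) * ((-1) ^ a * (bracket h (K f) * J g))
      + (-1) ^ (a * c) * ((-1) ^ (b + a * b + a) * (J g * bracket f (K h)))
      + (-1) ^ (b * a) * ((-1) ^ b * (J g * K (bracket h f))))
    + ((-1) ^ (a * c) * ((-1) ^ (b + a * b + a) * (J g * (K (K f) + K (K f)) * J h))
      - (-1) ^ (b * a) * ((-1) ^ b * (J g * J h * K (K f)))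
      + (-1) ^ (c * b) * ((-1) ^ (c + a) * (J h * K (K f) * J g)))
    + ((-1) ^ (b * a) * ((-1) ^ (c + b * c + b) * (J h * (K (K g) + K (K g)) * J f))
      - (-1) ^ (c * b) * ((-1) ^ c * (J h * J f * K (K g)))
      + (-1) ^ (a * c) * ((-1) ^ (a + b) * (J f * K (K g) * J h)))
    + ((-1) ^ (c * b) * ((-1) ^ (a + c * a + c) * (J f * (K (K h) + K (K h)) * J g))
      - (-1) ^ (a * c) * ((-1) ^ a * (J f * J g * K (K h)))
      + (-1) ^ (b * a) * ((-1) ^ (b + c) * (J g * K (K h) * J f)))"
    unfolding cyclic_def deformed_deformed[OF assms] deformed_deformed[OF assms(2,3,1,5,6,4)] deformed_deformed[OF assms(3,1,2,6,4,5)]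
    by (simp only: distrib_left right_diff_distrib) (simp only: diff_conv_add_uminus add_ac)
  then show ?thesis
    unfolding bracket_jacobi[OF S assms(4-6)] jacobi_linear_terms[OF assms] jacobi_linear_terms[OF assms(2,3,1,5,6,4)]
      jacobi_linear_terms[OF assms(3,1,2,6,4,5)] jacobi_quadratic_terms[OF assms] jacobi_quadratic_terms[OF assms(2,3,1,5,6,4)]
      jacobi_quadratic_terms[OF assms(3,1,2,6,4,5)]
    by simp
qed

text \<open>
  The six terms of the definition of the deformation. The minus sign in the third one arises because
  \<open>\<theta>\<close> has to pass the integral of \<open>\<gamma> f\<close>.
\<close>

lemma deformed_expand:
  assumes "f \<in> D" "g \<in> D"
  shows "deformed f g = B 1 f g + \<theta> * h1 * B 3 f g + \<theta> * (Eul (gam f) * J g - J f * Eul g)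
      + (B 1 \<zeta> (gam f) * J g + J (gam f) * B 1 \<zeta> g)
      + \<theta> * h1 * (B 3 \<zeta> (gam f) * J g + J (gam f) * B 3 \<zeta> g) + \<eta> * (J (gam f) * J g)"
proof -
  have "J (gam f) * \<theta> = - (\<theta> * J f)"
    using \<theta>_commute[of "J (gam f)"] assms by (simp add: gam_J D_gam gam_gam)
  then have 1: "J (gam f) * (\<theta> * Eul g) = - (\<theta> * (J f * Eul g))"
    by (simp add: mult.assoc[symmetric])
  have 2: "J (gam f) * (\<theta> * (h1 * x)) = \<theta> * (h1 * (J (gam f) * x))" for x
    using t_left_commute[of "J (gam f)" x] by (simp add: mult.assoc)
  have 3: "J (gam f) * \<eta> = \<eta> * J (gam f)" by (rule \<eta>_commute)
  show ?thesis
    unfolding deformed_def K_def bracket_def 3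
    by (simp add: distrib_left distrib_right right_diff_distrib 1 2 add_ac mult.assoc)
qed

end
end

section \<open>Parity and derivatives in Grassmann algebras\<close>

text \<open>
  The parity automorphism of a Grassmann algebra, denoted by \<open>\<gamma>\<close> above.
\<close>

definition mirror :: "'a::comm_ring_1 grassmann \<Rightarrow> 'a grassmann" where
  "mirror a = grass (\<lambda>S. (-1) ^ card S * gcoeff a S)"

lemma gcoeff_mirror [simp]: "gcoeff (mirror a) S = (-1) ^ card S * gcoeff a S"
  by (cases "finite S") (auto simp: mirror_def)

lemma gcoeff_sign [simp]: "gcoeff ((-1) ^ n * a) S = (-1) ^ n * gcoeff a S"
  for a :: "'a::comm_ring_1 grassmann"
  by (cases "even n") auto

lemma mirror_add: "mirror (a + b) = mirror a + mirror b"
  by (rule grassmann_eqI) (simp add: distrib_left)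

lemma mirror_mirror: "mirror (mirror a) = a"
  by (rule grassmann_eqI) (simp add: mult.assoc[symmetric] power_mult_distrib[symmetric])

lemma mirror_mult: "mirror (a * b) = mirror a * mirror b"
proof (rule grassmann_eqI)
  fix S :: "nat set" assume S: "finite S"
  have "(-1) ^ card S * ((-1) ^ inversions T (S - T) * gcoeff a T * gcoeff b (S - T))
    = (-1) ^ inversions T (S - T) * gcoeff (mirror a) T * gcoeff (mirror b) (S - T)"
    if "T \<subseteq> S" for T
  proof -
    have "card S = card T + card (S - T)"
      using that S by (metis add.commute card_Diff_subset card_mono finite_subset le_add_diff_inverse2)
    then show ?thesis by (simp add: power_add mult_ac)
  qed
  then show "gcoeff (mirror (a * b)) S = gcoeff (mirror a * mirror b) S"
    unfolding gcoeff_mirror[of "a * b"] gcoeff_mult[OF S] sum_distrib_left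
    by (intro sum.cong refl) (simp del: gcoeff_mirror)
qed

lemma gparity_iff_mirror: "gparity e a \<longleftrightarrow> mirror a = (-1) ^ e * a"
  for a :: "'a::{idom, ring_char_0} grassmann"
proof
  assume "gparity e a"
  then have "gcoeff a S = 0 \<or> even (card S) = even e" for S
    unfolding gparity_def by (metis even_iff_mod_2_eq_zero)
  then show "mirror a = (-1) ^ e * a"
    by (intro grassmann_eqI) (metis gcoeff_mirror gcoeff_sign minus_one_power_iff mult_zero_right)
next
  assume *: "mirror a = (-1) ^ e * a"
  have "gcoeff a S = 0" if "card S mod 2 \<noteq> e mod 2" for S
  proof -
    have "(-1) ^ card S * gcoeff a S = (-1) ^ e * gcoeff a S"
      using arg_cong[OF *, of "\<lambda>x. gcoeff x S"] by simp
    moreover have "even (card S) \<noteq> even e" using that by presburger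
    ultimately show ?thesis
      by (simp add: minus_one_power_iff split: if_splits)
  qed
  then show "gparity e a" by (auto simp: gparity_def)
qed

text \<open>
  Every pair of elements is an inversion in exactly one of the two orders.
\<close>

lemma inversions_swap:
  assumes "finite S" "finite T" "S \<inter> T = {}"
  shows "inversions S T + inversions T S = card S * card T"
proof -
  have "inversions T S = card {(i, j). i \<in> S \<and> j \<in> T \<and> i < j}"
    unfolding inversions_def by (rule bij_betw_same_card[of prod.swap]) (auto simp: bij_betw_def inj_on_def image_iff)
  moreover have "card {(i, j). i \<in> S \<and> j \<in> T \<and> j < i} + card {(i, j). i \<in> S \<and> j \<in> T \<and> i < j}
    = card ({(i, j). i \<in> S \<and> j \<in> T \<and> j < i} \<union> {(i, j). i \<in> S \<and> j \<in> T \<and> i < j})"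
    by (rule card_Un_disjoint[symmetric]) (use assms in \<open>auto intro: finite_subset[of _ "S \<times> T"]\<close>)
  moreover have "{(i, j). i \<in> S \<and> j \<in> T \<and> j < i} \<union> {(i, j). i \<in> S \<and> j \<in> T \<and> i < j} = S \<times> T"
    using assms(3) by (auto simp: neq_iff)
  ultimately show ?thesis
    by (simp add: inversions_def card_cartesian_product)
qed

text \<open>
  A common expansion of \<open>a * b\<close> and \<open>b * a\<close>, so that supercommutativity can be checked coefficientwise.
\<close>

lemma gcoeff_mult_swap:
  assumes "finite S"
  shows "gcoeff (b * a) S = (\<Sum>T\<in>Pow S. (-1) ^ (inversions T (S - T) + card T * card (S - T))
    * gcoeff a T * gcoeff b (S - T))"
proof -
  have "gcoeff (b * a) S = (\<Sum>T\<in>Pow S. (-1) ^ inversions (S - T) T * gcoeff b (S - T) * gcoeff a T)"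
    unfolding gcoeff_mult[OF assms]
    by (rule sum.reindex_bij_witness[of _ "\<lambda>T. S - T" "\<lambda>T. S - T"]) (auto simp: double_diff)
  also have "\<dots> = (\<Sum>T\<in>Pow S. (-1) ^ (inversions T (S - T) + card T * card (S - T))
    * gcoeff a T * gcoeff b (S - T))"
  proof (rule sum.cong[OF refl])
    fix T assume "T \<in> Pow S"
    then have f: "finite T" "finite (S - T)" using assms finite_subset by auto
    have "even (inversions (S - T) T) = even (inversions T (S - T) + card T * card (S - T))"
      using inversions_swap[OF f] by (metis Diff_disjoint even_add add.commute)
    then show "(-1) ^ inversions (S - T) T * gcoeff b (S - T) * gcoeff a T
      = (-1) ^ (inversions T (S - T) + card T * card (S - T)) * gcoeff a T * gcoeff b (S - T)"
      by (simp only: minus_one_power_iff) (simp add: mult_ac)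
  qed
  finally show ?thesis .
qed

lemma gparity_0_commute:
  assumes "gparity 0 a" shows "a * b = b * a"
proof (rule grassmann_eqI)
  fix S :: "nat set" assume S: "finite S"
  have "gcoeff a T = 0 \<or> even (card T)" for T
    using assms by (auto simp: gparity_def)
  then have *: "(-1) ^ (inversions T (S - T) + card T * card (S - T)) * gcoeff a T
    = (-1) ^ inversions T (S - T) * gcoeff a T" for T
    by (metis even_mult_iff minus_one_power_iff mult_zero_right power_add mult.right_neutral)
  show "gcoeff (a * b) S = gcoeff (b * a) S"
    unfolding gcoeff_mult_swap[OF S, of b a] gcoeff_mult[OF S, of a b] * ..
qed

lemma gparity_1_commute:
  assumes "gparity 1 a" shows "a * b = mirror b * a"
proof (rule grassmann_eqI)
  fix S :: "nat set" assume S: "finite S"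
  have "(-1) ^ (inversions T (S - T) + card T * card (S - T)) * gcoeff a T * gcoeff (mirror b) (S - T)
    = (-1) ^ inversions T (S - T) * gcoeff a T * gcoeff b (S - T)" for T
  proof (cases "gcoeff a T = 0")
    case False
    then have "odd (card T)" using assms by (auto simp: gparity_def odd_iff_mod_2_eq_one)
    then show ?thesis by (auto simp: minus_one_power_iff)
  qed simp
  then show "gcoeff (a * b) S = gcoeff (mirror b * a) S"
    unfolding gcoeff_mult_swap[OF S, of "mirror b" a] gcoeff_mult[OF S, of a b] by simp
qed

lemma grassmann_onD: "a \<in> grassmann_on I \<Longrightarrow> \<not> S \<subseteq> I \<Longrightarrow> gcoeff a S = 0"
  by (auto simp: grassmann_on_def)

lemma grassmann_onI: "(\<And>S. finite S \<Longrightarrow> \<not> S \<subseteq> I \<Longrightarrow> gcoeff a S = 0) \<Longrightarrow> a \<in> grassmann_on I"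
proof -
  assume *: "\<And>S. finite S \<Longrightarrow> \<not> S \<subseteq> I \<Longrightarrow> gcoeff a S = 0"
  have "gcoeff a S = 0" if "\<not> S \<subseteq> I" for S
    by (cases "finite S") (simp_all add: * that)
  then show ?thesis by (auto simp: grassmann_on_def)
qed

lemma grassmann_on_mono: "a \<in> grassmann_on I \<Longrightarrow> I \<subseteq> K \<Longrightarrow> a \<in> grassmann_on K"
  by (auto simp: grassmann_on_def)

lemma grassmann_on_add: "a \<in> grassmann_on I \<Longrightarrow> b \<in> grassmann_on I \<Longrightarrow> a + b \<in> grassmann_on I"
  by (rule grassmann_onI) (simp add: grassmann_onD)

lemma grassmann_on_minus: "a \<in> grassmann_on I \<Longrightarrow> - a \<in> grassmann_on I"
  by (rule grassmann_onI) (simp add: grassmann_onD)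

lemma grassmann_on_mirror: "a \<in> grassmann_on I \<Longrightarrow> mirror a \<in> grassmann_on I"
  by (rule grassmann_onI) (simp add: grassmann_onD)

lemma grassmann_on_1: "1 \<in> grassmann_on I"
  by (rule grassmann_onI) (auto simp: gcoeff_1)

lemma grassmann_on_mult: "a \<in> grassmann_on I \<Longrightarrow> b \<in> grassmann_on I \<Longrightarrow> a * b \<in> grassmann_on I"
proof (rule grassmann_onI)
  fix S assume *: "a \<in> grassmann_on I" "b \<in> grassmann_on I" "finite S" "\<not> S \<subseteq> I"
  have "\<not> T \<subseteq> I \<or> \<not> S - T \<subseteq> I" for T using *(4) by auto
  then have "gcoeff a T = 0 \<or> gcoeff b (S - T) = 0" for T
    using * grassmann_onD by metis
  then show "gcoeff (a * b) S = 0"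
    unfolding gcoeff_mult[OF *(3)] by (intro sum.neutral ballI) (metis mult_zero_left mult_zero_right)
qed

lemma grassmann_on_gscalar: "gscalar c \<in> grassmann_on I"
  by (rule grassmann_onI) (auto simp: gscalar_def)

lemma grassmann_on_ggen: "i \<in> I \<Longrightarrow> ggen i \<in> grassmann_on I"
  by (rule grassmann_onI) (auto simp: ggen_def)

lemma mirror_gscalar: "mirror (gscalar c) = gscalar c"
  by (rule grassmann_eqI) (auto simp: gscalar_def)

lemma mirror_ggen: "mirror (ggen i) = - ggen i"
  by (rule grassmann_eqI) (auto simp: ggen_def)

lemma gparity_0_mirror: "mirror a = a \<Longrightarrow> gparity 0 a"
  and gparity_1_mirror: "mirror a = - a \<Longrightarrow> gparity 1 a"
  for a :: "'a::{idom, ring_char_0} grassmann"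
  by (simp_all add: gparity_iff_mirror)

lemma gscalar_commute: "gscalar c * a = a * gscalar c"
  by (rule gparity_0_commute) (auto simp: gparity_def gscalar_def)

lemma gscalar_add: "gscalar (a + b) = gscalar a + gscalar b"
  by (rule grassmann_eqI) (auto simp: gscalar_def)

lemma gscalar_1: "gscalar 1 = 1"
  by (rule grassmann_eqI) (auto simp: gscalar_def gcoeff_1)

lemma gscalar_0: "gscalar 0 = 0"
  by (rule grassmann_eqI) (auto simp: gscalar_def)

lemma gscalar_minus: "gscalar (- a) = - gscalar a"
  by (rule grassmann_eqI) (auto simp: gscalar_def)

lemma gcoeff_gderiv_left: "finite S \<Longrightarrow> gcoeff (gderiv_left j a) S = (if j \<in> S then 0
     else (-1) ^ card {i\<in>S. i < j} * gcoeff a (insert j S))"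
  by (simp add: gderiv_left_def)

lemma gderiv_right_eq: "gderiv_right j a = mirror (gderiv_left j a)"
proof (rule grassmann_eqI)
  fix S :: "nat set" assume S: "finite S"
  show "gcoeff (gderiv_right j a) S = gcoeff (mirror (gderiv_left j a)) S"
  proof (cases "j \<in> S")
    case False
    have "{i \<in> S. j < i} \<union> {i \<in> S. i < j} = S"
      using False by (auto intro: le_neq_implies_less simp: not_less)
    moreover have "card ({i \<in> S. j < i} \<union> {i \<in> S. i < j}) = card {i \<in> S. j < i} + card {i \<in> S. i < j}"
      by (rule card_Un_disjoint) (use S in auto)
    ultimately have "card S = card {i \<in> S. j < i} + card {i \<in> S. i < j}" by simp
    then show ?thesis using S False
      by (simp add: gderiv_right_def gcoeff_gderiv_left power_add mult.assoc
          mult.left_commute[of "(-1) ^ card {i \<in> S. i < j}"])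
  qed (use S in \<open>simp add: gderiv_right_def gcoeff_gderiv_left\<close>)
qed

lemma gderiv_left_add: "gderiv_left j (a + b) = gderiv_left j a + gderiv_left j b"
  by (rule grassmann_eqI) (simp add: gcoeff_gderiv_left distrib_left)

lemma mirror_gderiv_left: "mirror (gderiv_left j a) = - gderiv_left j (mirror a)"
  by (rule grassmann_eqI) (simp add: gcoeff_gderiv_left mult.left_commute)

lemma inversions_singleton: "inversions {j} S = card {i\<in>S. i < j}"
  unfolding inversions_def by (rule bij_betw_same_card[of snd]) (auto simp: bij_betw_def inj_on_def image_iff)

lemma gcoeff_ggen_mult:
  assumes "finite S"
  shows "gcoeff (ggen j * a :: 'a::comm_ring_1 grassmann) S = (if j \<in> S then (-1) ^ card {i\<in>S. i < j} * gcoeff a (S - {j}) else 0)"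
proof (cases "j \<in> S")
  case True
  have "gcoeff (ggen j * a) S
    = (\<Sum>T\<in>{{j}}. (-1) ^ inversions T (S - T) * gcoeff (ggen j) T * gcoeff a (S - T))"
    unfolding gcoeff_mult[OF assms]
    by (rule sum.mono_neutral_right) (use assms True in \<open>auto simp: ggen_def\<close>)
  also have "{i \<in> S - {j}. i < j} = {i \<in> S. i < j}" by auto
  then have "(\<Sum>T\<in>{{j}}. (-1) ^ inversions T (S - T) * gcoeff (ggen j) T * gcoeff a (S - T))
    = (-1) ^ card {i\<in>S. i < j} * gcoeff a (S - {j})"
    by (simp add: ggen_def inversions_singleton)
  finally show ?thesis using True by simp
next
  case False
  then have "gcoeff (ggen j :: 'a grassmann) T = 0" if "T \<subseteq> S" for T
    using that by (auto simp: ggen_def)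
  then show ?thesis
    using False unfolding gcoeff_mult[OF assms] by (simp add: sum.neutral)
qed

lemma gderiv_left_avoids: "gderiv_left j a \<in> grassmann_on (- {j})"
  by (rule grassmann_onI) (auto simp: gcoeff_gderiv_left)

lemma gderiv_left_decomp:
  assumes "x \<in> grassmann_on (- {j})" "y \<in> grassmann_on (- {j})"
  shows "gderiv_left j (x + ggen j * y) = y"
proof (rule grassmann_eqI)
  fix S :: "nat set" assume S: "finite S"
  have "{i. (i = j \<or> i \<in> S) \<and> i < j} = {i \<in> S. i < j}" by auto
  then show "gcoeff (gderiv_left j (x + ggen j * y)) S = gcoeff y S"
    using S grassmann_onD[OF assms(1), of "insert j S"] grassmann_onD[OF assms(2), of S]
    by (auto simp: gcoeff_gderiv_left gcoeff_ggen_mult insert_Diff_if mult.assoc[symmetric]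
        power_mult_distrib[symmetric] power_add[symmetric])
qed

text \<open>
  Splitting off the part of \<open>a\<close> that contains the generator \<open>j\<close>; the derivative is the cofactor. With this
  description the Leibniz rule becomes a computation in the ring without counting inversions.
\<close>

lemma obtain_gderiv_left_decomp:
  obtains x where "x \<in> grassmann_on (- {j})" "a = x + ggen j * gderiv_left j a"
proof
  let ?x = "grass (\<lambda>S. if j \<in> S then 0 else gcoeff a S)"
  show "?x \<in> grassmann_on (- {j})" by (rule grassmann_onI) auto
  show "a = ?x + ggen j * gderiv_left j a"
  proof (rule grassmann_eqI)
    fix S :: "nat set" assume S: "finite S"
    have "{i. i \<in> S \<and> i \<noteq> j \<and> i < j} = {i \<in> S. i < j}" by auto
    then show "gcoeff a S = gcoeff (?x + ggen j * gderiv_left j a) S"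
      using S by (auto simp: gcoeff_gderiv_left gcoeff_ggen_mult insert_absorb mult.assoc[symmetric]
          power_add[symmetric])
  qed
qed

lemma ggen_commute: "ggen j * a = mirror a * ggen j"
  by (rule gparity_1_commute) (auto simp: gparity_def ggen_def)

lemma ggen_square: "ggen j * ggen j = 0"
  by (rule grassmann_eqI, simp add: gcoeff_ggen_mult) (auto simp: ggen_def)

lemma gderiv_left_mult: "gderiv_left j (a * b) = gderiv_left j a * b + mirror a * gderiv_left j b"
proof -
  let ?e = "ggen j" and ?da = "gderiv_left j a" and ?db = "gderiv_left j b"
  obtain x where x: "x \<in> grassmann_on (- {j})" "a = x + ?e * ?da" by (rule obtain_gderiv_left_decomp)
  obtain y where y: "y \<in> grassmann_on (- {j})" "b = y + ?e * ?db" by (rule obtain_gderiv_left_decomp)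
  have c: "u * (?e * v) = ?e * (mirror u * v)" for u v :: "'a grassmann"
    using ggen_commute[of j "mirror u"] by (simp add: mirror_mirror mult.assoc[symmetric])
  have e: "?e * (?e * u) = 0" for u :: "'a grassmann"
    by (simp add: mult.assoc[symmetric] ggen_square)
  have "a * b = (x + ?e * ?da) * (y + ?e * ?db)" by (simp only: x(2)[symmetric] y(2)[symmetric])
  also have "\<dots> = x * y + ?e * (?da * y + mirror x * ?db)"
    by (simp add: distrib_left distrib_right mult.assoc c[of x] c[of ?da] e add_ac)
  finally have "gderiv_left j (a * b) = ?da * y + mirror x * ?db"
    using x y by (simp add: gderiv_left_decomp grassmann_on_mult grassmann_on_add grassmann_on_mirror
        gderiv_left_avoids)
  moreover have "?da * b + mirror a * ?db = ?da * (y + ?e * ?db) + mirror (x + ?e * ?da) * ?db"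
    by (simp only: x(2)[symmetric] y(2)[symmetric])
  moreover have "\<dots> = ?da * y + mirror x * ?db"
    by (simp add: distrib_left distrib_right mult.assoc c[of ?da] mirror_add mirror_mult mirror_ggen
        left_diff_distrib)
  ultimately show ?thesis by simp
qed

lemma gderiv_left_gderiv_left: "gderiv_left i (gderiv_left j a) = - gderiv_left j (gderiv_left i a)"
proof (rule grassmann_eqI)
  fix S :: "nat set" assume S: "finite S"
  consider "i = j" | "i < j" | "j < i" by linarith
  then show "gcoeff (gderiv_left i (gderiv_left j a)) S = gcoeff (- gderiv_left j (gderiv_left i a)) S"
  proof cases
    case 2
    have "{x. (x = i \<or> x \<in> S) \<and> x < j} = insert i {x\<in>S. x < j}" "{x. (x = j \<or> x \<in> S) \<and> x < i} = {x\<in>S. x < i}"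
      using 2 by auto
    then show ?thesis using S 2 by (auto simp: gcoeff_gderiv_left insert_commute)
  next
    case 3
    have "{x. (x = j \<or> x \<in> S) \<and> x < i} = insert j {x\<in>S. x < i}" "{x. (x = i \<or> x \<in> S) \<and> x < j} = {x\<in>S. x < j}"
      using 3 by auto
    then show ?thesis using S 3 by (auto simp: gcoeff_gderiv_left insert_commute)
  qed (use S in \<open>simp add: gcoeff_gderiv_left\<close>)
qed

lemma gderiv_left_on: "j \<notin> I \<Longrightarrow> a \<in> grassmann_on I \<Longrightarrow> gderiv_left j a = 0"
  by (rule grassmann_eqI) (auto simp: gcoeff_gderiv_left grassmann_onD)

lemma grassmann_on_gderiv_left: "a \<in> grassmann_on I \<Longrightarrow> gderiv_left j a \<in> grassmann_on I"
  by (rule grassmann_onI) (auto simp: gcoeff_gderiv_left grassmann_onD)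

lemma gderiv_left_ggen: "gderiv_left i (ggen j) = (if i = j then 1 else 0)"
  by (rule grassmann_eqI) (auto simp: gcoeff_gderiv_left ggen_def gcoeff_1)

lemma gpart_decomp: "gpart 0 a + gpart 1 a = a" "gpart 0 a - gpart 1 a = mirror a"
  by (rule grassmann_eqI; auto simp: gpart_def minus_one_power_iff)+

lemma gparity_gpart: "gparity e (gpart e a)"
  by (auto simp: gparity_def gpart_def)

section \<open>Smooth functions\<close>

lemma C_diff_Suc_imp: "C_diff (Suc r) f \<Longrightarrow> C_diff r f"
proof (induction r arbitrary: f)
  case 0
  then have "f differentiable (at x)" for x by simp
  then show ?case
    by (simp add: continuous_at_imp_continuous_on differentiable_imp_continuous_within)
next
  case (Suc r)
  then show ?case by (metis C_diff.simps(2))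
qed

lemma smooth_iff: "smooth f \<longleftrightarrow> (\<forall>x. f differentiable (at x)) \<and> (\<forall>i. smooth (partial_deriv i f))"
proof
  assume "smooth f"
  then have "C_diff (Suc r) f" for r by (simp add: smooth_def)
  then show "(\<forall>x. f differentiable (at x)) \<and> (\<forall>i. smooth (partial_deriv i f))"
    by (simp add: smooth_def)
next
  assume *: "(\<forall>x. f differentiable (at x)) \<and> (\<forall>i. smooth (partial_deriv i f))"
  then have "C_diff (Suc r) f" for r by (simp add: smooth_def)
  then show "smooth f" unfolding smooth_def by (blast intro: C_diff_Suc_imp)
qed

lemma smooth_partial_deriv: "smooth f \<Longrightarrow> smooth (partial_deriv i f)"
  using smooth_iff by blast

lemma smooth_differentiable: "smooth f \<Longrightarrow> f differentiable (at x)"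
  using smooth_iff by blast

lemma smooth_has_derivative: "smooth f \<Longrightarrow> (f has_derivative frechet_derivative f (at x)) (at x)"
  using smooth_differentiable frechet_derivative_works by blast

lemma smooth_continuous_on: "smooth f \<Longrightarrow> continuous_on X f"
  by (simp add: continuous_at_imp_continuous_on differentiable_imp_continuous_within smooth_differentiable)

lemma partial_deriv_eqI: "(f has_derivative f') (at x) \<Longrightarrow> partial_deriv i f x = f' (axis i 1)"
  by (simp add: partial_deriv_def frechet_derivative_at[symmetric])

lemma partial_deriv_add:
  assumes "f differentiable (at x)" "g differentiable (at x)"
  shows "partial_deriv i (\<lambda>x. f x + g x) x = partial_deriv i f x + partial_deriv i g x"
  unfolding partial_deriv_def[of i f] partial_deriv_def[of i g]
  by (rule partial_deriv_eqI has_derivative_add)+ (use assms frechet_derivative_works in blast)+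

lemma partial_deriv_mult:
  fixes f g :: "real ^ 'n::finite \<Rightarrow> 'a::real_normed_algebra"
  assumes "f differentiable (at x)" "g differentiable (at x)"
  shows "partial_deriv i (\<lambda>x. f x * g x) x = partial_deriv i f x * g x + f x * partial_deriv i g x"
  unfolding partial_deriv_def[of i f] partial_deriv_def[of i g]
  using partial_deriv_eqI[OF has_derivative_mult[OF assms[unfolded frechet_derivative_works]], of i]
  by (simp add: add.commute)

lemma partial_deriv_const: "partial_deriv i (\<lambda>x. c) = (\<lambda>x. 0)"
  by (rule ext) (simp add: partial_deriv_def)

lemma smooth_const: "smooth (\<lambda>x :: real ^ 'n::finite. c :: 'b::real_normed_vector)"
proof -
  have "C_diff r (\<lambda>x :: real ^ 'n. c)" for r and c :: 'b
    by (induction r arbitrary: c) (auto simp: partial_deriv_const)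
  then show ?thesis by (simp add: smooth_def)
qed

lemma C_diff_add:
  "C_diff r f \<Longrightarrow> C_diff r g \<Longrightarrow> C_diff r (\<lambda>x. f x + g x)"
proof (induction r arbitrary: f g)
  case 0 then show ?case by (simp add: continuous_on_add)
next
  case (Suc r)
  then have "partial_deriv i (\<lambda>x. f x + g x) = (\<lambda>x. partial_deriv i f x + partial_deriv i g x)" for i
    by (auto simp: partial_deriv_add)
  then show ?case using Suc by simp
qed

lemma C_diff_mult:
  fixes f g :: "real ^ 'n::finite \<Rightarrow> 'a::real_normed_algebra"
  shows "C_diff r f \<Longrightarrow> C_diff r g \<Longrightarrow> C_diff r (\<lambda>x. f x * g x)"
proof (induction r arbitrary: f g)
  case 0 then show ?case by (simp add: continuous_on_mult)
next
  case (Suc r)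
  then have "partial_deriv i (\<lambda>x. f x * g x) = (\<lambda>x. partial_deriv i f x * g x + f x * partial_deriv i g x)" for i
    by (auto simp: partial_deriv_mult)
  moreover have "C_diff r f" "C_diff r g" using Suc.prems C_diff_Suc_imp by blast+
  ultimately show ?case using Suc by (simp add: C_diff_add)
qed

lemma smooth_add: "smooth f \<Longrightarrow> smooth g \<Longrightarrow> smooth (\<lambda>x. f x + g x)"
  by (simp add: smooth_def C_diff_add)

lemma smooth_mult:
  fixes f g :: "real ^ 'n::finite \<Rightarrow> 'a::real_normed_algebra"
  shows "smooth f \<Longrightarrow> smooth g \<Longrightarrow> smooth (\<lambda>x. f x * g x)"
  by (simp add: smooth_def C_diff_mult)

lemma smooth_sum: "(\<And>a. a \<in> X \<Longrightarrow> smooth (f a)) \<Longrightarrow> smooth (\<lambda>x. \<Sum>a\<in>X. f a x)"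
  by (induction X rule: infinite_finite_induct) (simp_all add: smooth_const smooth_add)

lemma partial_deriv_sum:
  "(\<And>a. a \<in> X \<Longrightarrow> smooth (f a)) \<Longrightarrow>
    partial_deriv i (\<lambda>x. \<Sum>a\<in>X. f a x) x = (\<Sum>a\<in>X. partial_deriv i (f a) x)"
  by (induction X rule: infinite_finite_induct)
    (simp_all add: partial_deriv_const partial_deriv_add smooth_differentiable smooth_sum)

lemma partial_deriv_cmult:
  fixes f :: "real ^ 'n::finite \<Rightarrow> 'a::real_normed_algebra"
  shows "smooth f \<Longrightarrow> partial_deriv i (\<lambda>x. c * f x) x = c * partial_deriv i f x"
  by (simp add: partial_deriv_mult smooth_differentiable partial_deriv_const)

lemma has_derivative_component:
  "((\<lambda>x. of_real (x $ i) :: 'a::real_normed_algebra_1) has_derivative (\<lambda>h. of_real (h $ i))) (at x)"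
  by (intro bounded_linear_imp_has_derivative bounded_linear_compose[OF bounded_linear_of_real]
      bounded_linear_vec_nth)

lemma partial_deriv_component:
  "partial_deriv j (\<lambda>x. of_real (x $ i) :: 'a::real_normed_algebra_1) x = (if i = j then 1 else 0)"
  by (subst partial_deriv_eqI[OF has_derivative_component]) (auto simp: axis_def)

lemma smooth_component: "smooth (\<lambda>x. of_real (x $ i) :: 'a::real_normed_algebra_1)"
proof -
  have "partial_deriv j (\<lambda>x. of_real (x $ i) :: 'a) = (\<lambda>x. if i = j then 1 else 0)" for j
    by (rule ext) (rule partial_deriv_component)
  then show ?thesis
    using has_derivative_component[of i] by (subst smooth_iff) (auto simp: smooth_const differentiable_def)
qed

lemma has_derivative_along_axis:
  assumes "smooth f"
  shows "((\<lambda>t. f (x + t *\<^sub>R axis i 1)) has_vector_derivative partial_deriv i f (x + t *\<^sub>R axis i 1)) (at t)"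
proof -
  let ?y = "x + t *\<^sub>R axis i 1"
  have "((\<lambda>t. x + t *\<^sub>R axis i 1) has_derivative (\<lambda>h. h *\<^sub>R axis i 1)) (at t)"
    by (auto intro!: derivative_eq_intros)
  from has_derivative_compose[OF this smooth_has_derivative[OF assms]]
  have "((\<lambda>t. f (x + t *\<^sub>R axis i 1)) has_derivative
    (\<lambda>h. frechet_derivative f (at ?y) (h *\<^sub>R axis i 1))) (at t)" .
  moreover have "frechet_derivative f (at ?y) (h *\<^sub>R axis i 1) = h *\<^sub>R partial_deriv i f ?y" for h
    using linear_frechet_derivative[OF smooth_differentiable[OF assms]]
    by (simp add: partial_deriv_def linear_cmul)
  ultimately show ?thesis by (simp add: has_vector_derivative_def)
qed

text \<open>
  The mean value theorem, applied first to \<open>s \<mapsto> f (x + t e\<^sub>j + s e\<^sub>i) - f (x + s e\<^sub>i)\<close> and then in the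
  direction \<open>j\<close>. As the left-hand side is symmetric in \<open>i\<close> and \<open>j\<close>, it compares the two mixed derivatives
  at points close to \<open>x\<close>.
\<close>

lemma second_difference:
  fixes f :: "real ^ 'n::finite \<Rightarrow> real"
  assumes f: "smooth f" and t: "0 < t"
  shows "\<exists>y. norm (y - x) \<le> 2 * t \<and>
    f (x + t *\<^sub>R axis i 1 + t *\<^sub>R axis j 1) - f (x + t *\<^sub>R axis i 1) - f (x + t *\<^sub>R axis j 1) + f x
    = t * t * partial_deriv j (partial_deriv i f) y"
proof -
  let ?a = "axis i 1 :: real ^ 'n" and ?b = "axis j 1 :: real ^ 'n"
  let ?\<phi> = "\<lambda>s. f (x + t *\<^sub>R ?b + s *\<^sub>R ?a) - f (x + s *\<^sub>R ?a)"
  have D: "(?\<phi> has_real_derivative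
      partial_deriv i f (x + t *\<^sub>R ?b + s *\<^sub>R ?a) - partial_deriv i f (x + s *\<^sub>R ?a)) (at s)" for s
    unfolding has_real_derivative_iff_has_vector_derivative
    by (intro has_vector_derivative_diff has_derivative_along_axis f)
  then obtain s where s: "0 < s" "s < t"
    "?\<phi> t - ?\<phi> 0 = (t - 0) * (partial_deriv i f (x + t *\<^sub>R ?b + s *\<^sub>R ?a) - partial_deriv i f (x + s *\<^sub>R ?a))"
    using MVT2[OF t D] by blast
  let ?\<psi> = "\<lambda>r. partial_deriv i f (x + s *\<^sub>R ?a + r *\<^sub>R ?b)"
  have D': "(?\<psi> has_real_derivative
      partial_deriv j (partial_deriv i f) (x + s *\<^sub>R ?a + r *\<^sub>R ?b)) (at r)" for r
    unfolding has_real_derivative_iff_has_vector_derivative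
    by (intro has_derivative_along_axis smooth_partial_deriv f)
  then obtain r where r: "0 < r" "r < t"
    "?\<psi> t - ?\<psi> 0 = (t - 0) * partial_deriv j (partial_deriv i f) (x + s *\<^sub>R ?a + r *\<^sub>R ?b)"
    using MVT2[OF t D'] by blast
  have "norm (s *\<^sub>R ?a + r *\<^sub>R ?b) \<le> norm (s *\<^sub>R ?a) + norm (r *\<^sub>R ?b)" by (rule norm_triangle_ineq)
  then have "norm (x + s *\<^sub>R ?a + r *\<^sub>R ?b - x) \<le> 2 * t"
    using s r by (simp add: add_diff_eq add.assoc)
  moreover have "f (x + t *\<^sub>R ?a + t *\<^sub>R ?b) - f (x + t *\<^sub>R ?a) - f (x + t *\<^sub>R ?b) + f x
    = t * t * partial_deriv j (partial_deriv i f) (x + s *\<^sub>R ?a + r *\<^sub>R ?b)"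
    using s(3) r(3) by (simp add: add.commute add.left_commute algebra_simps)
  ultimately show ?thesis by blast
qed

lemma partial_deriv_commute_real:
  fixes f :: "real ^ 'n::finite \<Rightarrow> real"
  assumes f: "smooth f"
  shows "partial_deriv i (partial_deriv j f) x = partial_deriv j (partial_deriv i f) x"
proof -
  let ?t = "\<lambda>n. inverse (real (Suc n))"
  have t: "0 < ?t n" for n by simp
  have lim: "(\<lambda>n. partial_deriv a (partial_deriv b f) (y n)) \<longlonglongrightarrow> partial_deriv a (partial_deriv b f) x"
    if "\<And>n. norm (y n - x) \<le> 2 * ?t n" for y a b
  proof -
    have "(\<lambda>n. 2 * ?t n) \<longlonglongrightarrow> 2 * 0"
      by (rule tendsto_mult[OF tendsto_const LIMSEQ_inverse_real_of_nat])
    then have t0: "(\<lambda>n. 2 * ?t n) \<longlonglongrightarrow> 0" by (simp only: mult_zero_right)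
    have "(\<lambda>n. y n - x) \<longlonglongrightarrow> 0"
      by (rule Lim_null_comparison[OF always_eventually t0]) (use that in blast)
    then have "y \<longlonglongrightarrow> x" by (simp add: LIM_zero_iff)
    moreover have "isCont (partial_deriv a (partial_deriv b f)) x"
      by (simp add: differentiable_imp_continuous_within smooth_differentiable smooth_partial_deriv f)
    ultimately show ?thesis by (rule isCont_tendsto_compose[rotated])
  qed
  have "\<exists>y y'. norm (y - x) \<le> 2 * ?t n \<and> norm (y' - x) \<le> 2 * ?t n \<and>
      partial_deriv j (partial_deriv i f) y = partial_deriv i (partial_deriv j f) y'" for n
  proof -
    obtain y y' where y: "norm (y - x) \<le> 2 * ?t n" "norm (y' - x) \<le> 2 * ?t n"
      and eq: "?t n * ?t n * partial_deriv j (partial_deriv i f) y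
        = ?t n * ?t n * partial_deriv i (partial_deriv j f) y'"
      using second_difference[OF f t[of n], of x i j] second_difference[OF f t[of n], of x j i]
      by (auto simp only: add_ac diff_diff_eq)
    have "?t n * ?t n \<noteq> 0" by simp
    with eq have "partial_deriv j (partial_deriv i f) y = partial_deriv i (partial_deriv j f) y'"
      using mult_left_cancel[of "?t n * ?t n"] by blast
    with y show ?thesis by blast
  qed
  then obtain y y' where y: "\<And>n. norm (y n - x) \<le> 2 * ?t n" "\<And>n. norm (y' n - x) \<le> 2 * ?t n"
    and eq: "\<And>n. partial_deriv j (partial_deriv i f) (y n) = partial_deriv i (partial_deriv j f) (y' n)"
    by metis
  show ?thesis
    by (rule LIMSEQ_unique[OF lim[OF y(2)] lim[OF y(1), of j i, unfolded eq]])
qed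

lemma smooth_inner:
  fixes f :: "real ^ 'n::finite \<Rightarrow> 'a::euclidean_space"
  assumes "smooth f"
  shows "smooth (\<lambda>x. f x \<bullet> b)" "partial_deriv i (\<lambda>x. f x \<bullet> b) x = partial_deriv i f x \<bullet> b"
proof -
  have d: "((\<lambda>x. f x \<bullet> b) has_derivative (\<lambda>h. frechet_derivative f (at x) h \<bullet> b)) (at x)"
    if "f differentiable (at x)" for f :: "real ^ 'n \<Rightarrow> 'a" and x
    using that by (intro has_derivative_inner_left) (simp add: frechet_derivative_works)
  have p: "partial_deriv i (\<lambda>x. f x \<bullet> b) x = partial_deriv i f x \<bullet> b"
    if "f differentiable (at x)" for f :: "real ^ 'n \<Rightarrow> 'a" and x i
    by (subst partial_deriv_eqI[OF d[OF that]]) (simp add: partial_deriv_def)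
  have "C_diff r (\<lambda>x. f x \<bullet> b)" if "C_diff r f" for r and f :: "real ^ 'n \<Rightarrow> 'a"
    using that
  proof (induction r arbitrary: f)
    case 0 then show ?case by (auto intro: continuous_intros)
  next
    case (Suc r)
    then have "partial_deriv i (\<lambda>x. f x \<bullet> b) = (\<lambda>x. partial_deriv i f x \<bullet> b)" for i
      by (auto simp: p)
    moreover have "(\<lambda>x. f x \<bullet> b) differentiable (at x)" for x
      using d[of f x] Suc.prems by (auto intro: differentiableI)
    ultimately show ?case using Suc by simp
  qed
  then show "smooth (\<lambda>x. f x \<bullet> b)" using assms by (simp add: smooth_def)
  show "partial_deriv i (\<lambda>x. f x \<bullet> b) x = partial_deriv i f x \<bullet> b"
    by (rule p) (rule smooth_differentiable[OF assms])
qed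

lemma partial_deriv_commute:
  fixes f :: "real ^ 'n::finite \<Rightarrow> 'a::euclidean_space"
  assumes f: "smooth f"
  shows "partial_deriv i (partial_deriv j f) x = partial_deriv j (partial_deriv i f) x"
proof (rule euclidean_eqI)
  fix b :: 'a
  have "(\<lambda>x. partial_deriv a f x \<bullet> b) = partial_deriv a (\<lambda>x. f x \<bullet> b)" for a
    by (auto simp: smooth_inner f)
  then show "partial_deriv i (partial_deriv j f) x \<bullet> b = partial_deriv j (partial_deriv i f) x \<bullet> b"
    using partial_deriv_commute_real[OF smooth_inner(1)[OF f], of i j b x]
    by (simp add: smooth_inner(2)[OF smooth_partial_deriv[OF f], symmetric])
qed

section \<open>Test functions\<close>

lemma test_function_iff: "test_function f \<longleftrightarrow> smooth f \<and> bounded {x. f x \<noteq> 0}"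
  by (simp add: test_function_def)

lemma test_function_smooth: "test_function f \<Longrightarrow> smooth f"
  by (simp add: test_function_def)

lemma test_function_0: "test_function (\<lambda>x. 0)"
  by (simp add: test_function_iff smooth_const)

lemma test_function_add:
  assumes "test_function f" "test_function g" shows "test_function (\<lambda>x. f x + g x)"
proof -
  have "bounded ({x. f x \<noteq> 0} \<union> {x. g x \<noteq> 0})"
    using assms by (simp add: test_function_iff)
  moreover have "{x. f x + g x \<noteq> 0} \<subseteq> {x. f x \<noteq> 0} \<union> {x. g x \<noteq> 0}" by auto
  ultimately show ?thesis
    using assms bounded_subset by (simp only: test_function_iff smooth_add) blast
qed

lemma test_function_mult:
  fixes f g :: "real ^ 'n::finite \<Rightarrow> 'a::real_normed_algebra"
  assumes "smooth g" "test_function f" shows "test_function (\<lambda>x. g x * f x)"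
proof -
  have "{x. g x * f x \<noteq> 0} \<subseteq> {x. f x \<noteq> 0}" by auto
  then show ?thesis
    using assms bounded_subset by (simp only: test_function_iff smooth_mult) blast
qed

lemma test_function_sum: "(\<And>a. a \<in> X \<Longrightarrow> test_function (f a)) \<Longrightarrow> test_function (\<lambda>x. \<Sum>a\<in>X. f a x)"
  by (induction X rule: infinite_finite_induct) (simp_all add: test_function_0 test_function_add)

lemma partial_deriv_support: "{x. partial_deriv i f x \<noteq> 0} \<subseteq> closure {x. f x \<noteq> 0}"
proof
  fix x assume x: "x \<in> {x. partial_deriv i f x \<noteq> 0}"
  show "x \<in> closure {x. f x \<noteq> 0}"
  proof (rule ccontr)
    assume "x \<notin> closure {x. f x \<noteq> 0}"
    then have "x \<in> - closure {x. f x \<noteq> 0}" by simp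
    moreover have "open (- closure {x. f x \<noteq> 0})" by (simp add: open_Compl)
    moreover have "0 = f y" if "y \<in> - closure {x. f x \<noteq> 0}" for y
      using that closure_subset[of "{x. f x \<noteq> 0}"] by auto
    ultimately have "(f has_derivative (\<lambda>x. 0)) (at x)"
      using has_derivative_transform_within_open[OF has_derivative_const[of 0 "at x"]] by metis
    then show False using x by (simp add: partial_deriv_eqI)
  qed
qed

lemma test_function_partial_deriv: "test_function f \<Longrightarrow> test_function (partial_deriv i f)"
  unfolding test_function_iff
  using bounded_subset[OF bounded_closure partial_deriv_support] smooth_partial_deriv by blast

lemma test_function_integrable:
  fixes f :: "real ^ 'n::finite \<Rightarrow> 'a::euclidean_space"
  assumes "test_function f" shows "integrable lborel f"
proof -
  let ?K = "closure {x. f x \<noteq> 0}"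
  have "integrable lborel (\<lambda>x. indicator ?K x *\<^sub>R f x)"
    using assms by (intro borel_integrable_compact smooth_continuous_on) (simp_all add: test_function_def)
  moreover have "(\<lambda>x. indicator ?K x *\<^sub>R f x) = f"
  proof
    fix x show "indicator ?K x *\<^sub>R f x = f x"
      using closure_subset[of "{x. f x \<noteq> 0}"] by (cases "x \<in> ?K") auto
  qed
  ultimately show ?thesis by simp
qed

text \<open>
  The difference quotients of \<open>f\<close> in direction \<open>i\<close> have integral \<open>0\<close> by translation invariance. They
  converge to the derivative, are bounded by its maximum, and vanish outside a fixed ball, so the
  dominated convergence theorem applies.
\<close>

lemma integral_partial_deriv:
  fixes f :: "real ^ 'n::finite \<Rightarrow> 'a::euclidean_space"
  assumes f: "test_function f"
  shows "(LINT x|lborel. partial_deriv i f x) = 0"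
proof -
  let ?e = "axis i 1 :: real ^ 'n"
  let ?h = "\<lambda>n. inverse (real (Suc n))"
  let ?s = "\<lambda>n x. real (Suc n) *\<^sub>R (f (x + ?h n *\<^sub>R ?e) - f x)"
  obtain R where R: "\<And>x. f x \<noteq> 0 \<Longrightarrow> norm x \<le> R"
    using f by (auto simp: test_function_iff bounded_iff)
  have sm: "smooth f" using f by (rule test_function_smooth)
  have cont: "continuous_on X f" for X by (rule smooth_continuous_on[OF sm])
  have "bounded (partial_deriv i f ` closure {x. f x \<noteq> 0})"
    using f by (intro compact_imp_bounded compact_continuous_image smooth_continuous_on smooth_partial_deriv sm)
      (simp add: test_function_def)
  then obtain C where C: "\<And>x. x \<in> closure {x. f x \<noteq> 0} \<Longrightarrow> norm (partial_deriv i f x) \<le> C"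
    unfolding bounded_iff by blast
  have C': "norm (partial_deriv i f x) \<le> max C 0" for x
    using C[of x] partial_deriv_support[of i f] by (cases "partial_deriv i f x = 0") auto
  have bound: "norm (?s n x) \<le> max C 0" for n x
  proof -
    have "norm (f (x + ?h n *\<^sub>R ?e) - f (x + 0 *\<^sub>R ?e)) \<le> max C 0 * norm (?h n - 0)"
    proof (rule differentiable_bound[of "UNIV :: real set"
          "\<lambda>t. f (x + t *\<^sub>R ?e)" "\<lambda>t h. h *\<^sub>R partial_deriv i f (x + t *\<^sub>R ?e)"])
      show "((\<lambda>t. f (x + t *\<^sub>R ?e)) has_derivative (\<lambda>h. h *\<^sub>R partial_deriv i f (x + t *\<^sub>R ?e))) (at t)" for t
        using has_derivative_along_axis[OF sm] by (simp add: has_vector_derivative_def)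
      show "onorm (\<lambda>h. h *\<^sub>R partial_deriv i f (x + t *\<^sub>R ?e)) \<le> max C 0" for t
        using C' by (intro onorm_le) (metis mult.commute mult_left_mono norm_ge_zero norm_scaleR real_norm_def)
    qed auto
    then have "real (Suc n) * norm (f (x + ?h n *\<^sub>R ?e) - f x) \<le> real (Suc n) * (max C 0 * ?h n)"
      by (intro mult_left_mono) auto
    also have "\<dots> = max C 0" by (simp add: field_simps del: of_nat_Suc)
    finally show ?thesis by (simp del: of_nat_Suc)
  qed
  have supp: "?s n x = 0" if "norm x > R + 1" for n x
  proof -
    have "norm x \<le> norm (x + ?h n *\<^sub>R ?e) + norm (?h n *\<^sub>R ?e)"
      by (metis add_diff_cancel norm_triangle_ineq4)
    moreover have "norm (?h n *\<^sub>R ?e) \<le> 1" by (simp add: inverse_le_1_iff)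
    ultimately have "f (x + ?h n *\<^sub>R ?e) = 0" "f x = 0"
      using that R by (force, force)
    then show ?thesis by simp
  qed
  let ?w = "\<lambda>x. indicator (cball 0 (R + 1)) x *\<^sub>R max C 0"
  have "(\<lambda>n. LINT x|lborel. ?s n x) \<longlonglongrightarrow> (LINT x|lborel. partial_deriv i f x)"
  proof (rule integral_dominated_convergence[where w = ?w])
    show "partial_deriv i f \<in> borel_measurable lborel"
      using smooth_continuous_on[OF smooth_partial_deriv[OF sm]]
      by (simp add: borel_measurable_continuous_onI)
    have "continuous_on UNIV (\<lambda>x. ?s n x)" for n
      by (intro continuous_intros continuous_on_compose2[OF cont[of UNIV]]) auto
    then show "?s n \<in> borel_measurable lborel" for n
      by (simp add: borel_measurable_continuous_onI)
    show "integrable lborel ?w"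
      by (rule borel_integrable_compact) auto
    show "AE x in lborel. (\<lambda>n. ?s n x) \<longlonglongrightarrow> partial_deriv i f x"
    proof (rule AE_I2)
      fix x
      have "((\<lambda>t. f (x + t *\<^sub>R ?e)) has_vector_derivative partial_deriv i f x) (at 0)"
        using has_derivative_along_axis[OF sm, of x i 0] by simp
      then have l0: "(\<lambda>t. norm (f (x + t *\<^sub>R ?e) - f x - t *\<^sub>R partial_deriv i f x) / norm t) \<midarrow>0\<rightarrow> 0"
        by (simp add: has_vector_derivative_def has_derivative_at)
      have eq: "norm (f (x + t *\<^sub>R ?e) - f x - t *\<^sub>R partial_deriv i f x) / norm t
          = norm ((1 / t) *\<^sub>R (f (x + t *\<^sub>R ?e) - f x) - partial_deriv i f x)" if "t \<noteq> 0" for t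
      proof -
        have "(1 / t) *\<^sub>R (f (x + t *\<^sub>R ?e) - f x) - partial_deriv i f x
          = (1 / t) *\<^sub>R (f (x + t *\<^sub>R ?e) - f x - t *\<^sub>R partial_deriv i f x)"
          using that by (simp add: scaleR_diff_right)
        then show ?thesis by simp
      qed
      have "(\<lambda>t. norm ((1 / t) *\<^sub>R (f (x + t *\<^sub>R ?e) - f x) - partial_deriv i f x)) \<midarrow>0\<rightarrow> 0"
        by (rule iffD1[OF LIM_equal l0], intro allI impI, rule eq)
      then have "((\<lambda>t. (1 / t) *\<^sub>R (f (x + t *\<^sub>R ?e) - f x)) \<longlongrightarrow> partial_deriv i f x) (at 0)"
        by (rule LIM_zero_cancel[OF tendsto_norm_zero_cancel])
      moreover have "filterlim ?h (at 0) sequentially"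
        using LIMSEQ_inverse_real_of_nat by (simp add: filterlim_at)
      ultimately have "(\<lambda>n. (1 / ?h n) *\<^sub>R (f (x + ?h n *\<^sub>R ?e) - f x)) \<longlonglongrightarrow> partial_deriv i f x"
        by (rule filterlim_compose)
      moreover have "1 / ?h n = real (Suc n)" for n by (simp add: divide_inverse del: of_nat_Suc)
      ultimately show "(\<lambda>n. ?s n x) \<longlonglongrightarrow> partial_deriv i f x" by (simp only:)
    qed
    show "AE x in lborel. norm (?s n x) \<le> ?w x" for n
      using bound[of n] supp[of _ n] by (intro AE_I2) (auto simp: indicator_def not_le simp del: of_nat_Suc)
  qed
  moreover have "(LINT x|lborel. ?s n x) = 0" for n
  proof -
    let ?c = "?h n *\<^sub>R ?e"
    have int: "integrable lborel f" by (rule test_function_integrable[OF f])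
    have m: "f \<in> borel_measurable borel" using cont by (simp add: borel_measurable_continuous_onI)
    have "integrable (distr lborel borel ((+) ?c)) f" "(LINT x|distr lborel borel ((+) ?c). f x) = (LINT x|lborel. f x)"
      using int by (simp_all add: lborel_distr_plus)
    then have "integrable lborel (\<lambda>x. f (?c + x))" "(LINT x|lborel. f (?c + x)) = (LINT x|lborel. f x)"
      using m by (simp_all add: integrable_distr_eq integral_distr)
    then show ?thesis
      using int by (simp add: add.commute[of _ ?c] Bochner_Integration.integral_diff del: of_nat_Suc)
  qed
  ultimately show ?thesis by (simp add: LIMSEQ_const_iff)
qed

section \<open>Superfields and their derivatives\<close>

definition constants :: "nat \<Rightarrow> ('n::finite, 'a::{real_normed_field, euclidean_space}) superfield set" where
  "constants k = {\<lambda>x. t |t. t \<in> grassmann_on {..<k}}"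

text \<open>
  The unique coordinate with which \<open>\<omega>\<^sup>A\<^sup>B\<close> pairs \<open>A\<close>.
\<close>

fun partner :: "('p + 'p) + nat \<Rightarrow> ('p + 'p) + nat" where
  "partner (Inl (Inl i)) = Inl (Inr i)"
| "partner (Inl (Inr i)) = Inl (Inl i)"
| "partner (Inr \<alpha>) = Inr \<alpha>"

definition weight :: "(nat \<Rightarrow> 'a::comm_ring_1) \<Rightarrow> ('p + 'p) + nat \<Rightarrow> ('n, 'a) superfield" where
  "weight lam A = (\<lambda>x. gscalar (omega lam A (partner A)))"

lemma omega_not_partner: "C \<noteq> partner A \<Longrightarrow> omega lam A C = 0"
  by (cases A rule: partner.cases; cases C rule: partner.cases) auto

lemma partner_partner: "partner (partner A) = A"
  by (cases A rule: partner.cases) auto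

lemma isl_partner: "isl (partner A) = isl A"
  by (cases A rule: partner.cases) auto

lemma partner_coords: "A \<in> coords m \<Longrightarrow> partner A \<in> coords m"
  by (cases A rule: partner.cases) (auto simp: coords_def)

lemma omega_partner: "omega lam (partner A) A = (if isl A then - omega lam A (partner A) else omega lam A (partner A))"
  by (cases A rule: partner.cases) auto

lemma sum_fun_apply: "(\<Sum>a\<in>X. f a) x = (\<Sum>a\<in>X. f a x)"
  by (induction X rule: infinite_finite_induct) auto

lemma minus_one_power_fun_apply: "((-1) ^ n :: 'b \<Rightarrow> 'a::ring_1) x = (-1) ^ n"
  by (cases "even n") auto

lemma sf_EI:
  assumes "\<And>x. f x \<in> grassmann_on {..<k + m}" "\<And>S. finite S \<Longrightarrow> smooth (\<lambda>x. gcoeff (f x) S)"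
  shows "f \<in> sf_E k m"
proof -
  have "smooth (\<lambda>x. gcoeff (f x) S)" for S
    by (cases "finite S") (simp_all add: assms smooth_const)
  then show ?thesis using assms(1) by (simp add: sf_E_def)
qed

lemma sf_DI:
  assumes "\<And>x. f x \<in> grassmann_on {..<k + m}" "\<And>S. finite S \<Longrightarrow> test_function (\<lambda>x. gcoeff (f x) S)"
  shows "f \<in> sf_D k m"
proof -
  have "test_function (\<lambda>x. gcoeff (f x) S)" for S
    by (cases "finite S") (simp_all add: assms test_function_0)
  then show ?thesis using assms(1) by (simp add: sf_D_def)
qed

lemma sf_E_smooth: "f \<in> sf_E k m \<Longrightarrow> smooth (\<lambda>x. gcoeff (f x) S)"
  and sf_E_on: "f \<in> sf_E k m \<Longrightarrow> f x \<in> grassmann_on {..<k + m}"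
  by (auto simp: sf_E_def)

lemma sf_D_test: "f \<in> sf_D k m \<Longrightarrow> test_function (\<lambda>x. gcoeff (f x) S)"
  and sf_D_on: "f \<in> sf_D k m \<Longrightarrow> f x \<in> grassmann_on {..<k + m}"
  by (auto simp: sf_D_def)

lemma sf_D_E: "f \<in> sf_D k m \<Longrightarrow> f \<in> sf_E k m"
  by (auto simp: sf_D_def sf_E_def test_function_smooth)

lemma gcoeff_dleft_even: "gcoeff (dleft k (Inl i) f x) S = partial_deriv i (\<lambda>y. gcoeff (f y) S) x"
  by (cases "finite S") (simp_all add: partial_deriv_const)

lemma smooth_cmult: "smooth f \<Longrightarrow> smooth (\<lambda>x. c * f x)" for f :: "real ^ 'n::finite \<Rightarrow> 'a::real_normed_algebra"
  by (intro smooth_mult smooth_const)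

lemma test_function_cmult: "test_function f \<Longrightarrow> test_function (\<lambda>x. c * f x)"
  for f :: "real ^ 'n::finite \<Rightarrow> 'a::real_normed_algebra"
  by (intro test_function_mult smooth_const)

lemma sf_E_add: "f \<in> sf_E k m \<Longrightarrow> g \<in> sf_E k m \<Longrightarrow> f + g \<in> sf_E k m"
  by (rule sf_EI) (simp_all add: grassmann_on_add sf_E_on smooth_add sf_E_smooth)

lemma sf_D_add: "f \<in> sf_D k m \<Longrightarrow> g \<in> sf_D k m \<Longrightarrow> f + g \<in> sf_D k m"
  by (rule sf_DI) (simp_all add: grassmann_on_add sf_D_on test_function_add sf_D_test)

lemma sf_E_minus: "f \<in> sf_E k m \<Longrightarrow> - f \<in> sf_E k m"
  using smooth_cmult[of "\<lambda>x. gcoeff (f x) _" "- 1"]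
  by (intro sf_EI) (simp_all add: grassmann_on_minus sf_E_on sf_E_smooth)

lemma sf_E_mult: "f \<in> sf_E k m \<Longrightarrow> g \<in> sf_E k m \<Longrightarrow> f * g \<in> sf_E k m"
  by (rule sf_EI)
    (simp_all add: grassmann_on_mult sf_E_on gcoeff_mult smooth_sum smooth_mult smooth_const sf_E_smooth)

lemma sf_D_mult: "g \<in> sf_E k m \<Longrightarrow> f \<in> sf_D k m \<Longrightarrow> g * f \<in> sf_D k m"
  by (rule sf_DI)
    (simp_all add: grassmann_on_mult sf_E_on sf_D_on gcoeff_mult test_function_sum test_function_mult
      smooth_mult smooth_const sf_E_smooth sf_D_test)

lemma sf_E_mirror: "f \<in> sf_E k m \<Longrightarrow> (\<lambda>x. mirror (f x)) \<in> sf_E k m"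
  by (rule sf_EI) (simp_all add: grassmann_on_mirror sf_E_on smooth_cmult sf_E_smooth)

lemma sf_D_mirror: "f \<in> sf_D k m \<Longrightarrow> (\<lambda>x. mirror (f x)) \<in> sf_D k m"
  by (rule sf_DI) (simp_all add: grassmann_on_mirror sf_D_on test_function_cmult sf_D_test)

lemma dleft_on:
  assumes "\<And>x. f x \<in> grassmann_on I" shows "dleft k A f x \<in> grassmann_on I"
proof (cases A)
  case (Inl i)
  have "gcoeff (dleft k (Inl i) f x) S = 0" if "\<not> S \<subseteq> I" for S
    using grassmann_onD[OF assms that] by (simp only: gcoeff_dleft_even partial_deriv_const)
  then show ?thesis unfolding Inl by (intro grassmann_onI)
qed (simp add: grassmann_on_gderiv_left assms)

lemma sf_E_dleft: assumes "f \<in> sf_E k m" shows "dleft k A f \<in> sf_E k m"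
proof (rule sf_EI)
  show "dleft k A f x \<in> grassmann_on {..<k + m}" for x
    by (rule dleft_on) (rule sf_E_on[OF assms])
  show "smooth (\<lambda>x. gcoeff (dleft k A f x) S)" if "finite S" for S
  proof (cases A)
    case (Inl i)
    then show ?thesis
      by (simp only: gcoeff_dleft_even smooth_partial_deriv sf_E_smooth[OF assms])
  next
    case (Inr \<alpha>)
    then show ?thesis
      using that by (cases "k + \<alpha> \<in> S")
        (simp_all add: gcoeff_gderiv_left smooth_const smooth_cmult sf_E_smooth[OF assms])
  qed
qed

lemma sf_D_dleft: assumes "f \<in> sf_D k m" shows "dleft k A f \<in> sf_D k m"
proof (rule sf_DI)
  show "dleft k A f x \<in> grassmann_on {..<k + m}" for x
    by (rule dleft_on) (rule sf_D_on[OF assms])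
  show "test_function (\<lambda>x. gcoeff (dleft k A f x) S)" if "finite S" for S
  proof (cases A)
    case (Inl i)
    then show ?thesis
      by (simp only: gcoeff_dleft_even test_function_partial_deriv sf_D_test[OF assms])
  next
    case (Inr \<alpha>)
    then show ?thesis
      using that by (cases "k + \<alpha> \<in> S")
        (simp_all add: gcoeff_gderiv_left test_function_0 test_function_cmult sf_D_test[OF assms])
  qed
qed

lemma sf_E_const: "t \<in> grassmann_on {..<k + m} \<Longrightarrow> (\<lambda>x. t) \<in> sf_E k m"
  by (rule sf_EI) (simp_all add: smooth_const)

lemma gcoeff_coord_even: "gcoeff (coord k (Inl j) x) S = (if S = {} then of_real (x $ j) else 0)"
  by (simp add: gscalar_def)

lemma coord_sf_E: "A \<in> coords m \<Longrightarrow> coord k A \<in> sf_E k m"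
proof (rule sf_EI)
  assume "A \<in> coords m"
  then show "coord k A x \<in> grassmann_on {..<k + m}" for x
    by (cases A) (auto simp: coords_def grassmann_on_gscalar grassmann_on_ggen)
  show "smooth (\<lambda>x. gcoeff (coord k A x) S)" for S
  proof (cases A)
    case (Inl i)
    then show ?thesis
      by (cases "S = {}") (simp_all add: gcoeff_coord_even smooth_component smooth_const del: coord.simps(1))
  qed (simp add: smooth_const)
qed

lemma dleft_add: "f \<in> sf_E k m \<Longrightarrow> g \<in> sf_E k m \<Longrightarrow> dleft k A (f + g) = dleft k A f + dleft k A g"
  by (rule ext, cases A)
    (auto intro!: grassmann_eqI simp: gcoeff_dleft_even partial_deriv_add smooth_differentiable sf_E_smooth
      gderiv_left_add simp del: dleft.simps(1))

lemma dleft_mult: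
  assumes "f \<in> sf_E k m" "g \<in> sf_E k m"
  shows "dleft k A (f * g) = dleft k A f * g + (if \<not> isl A then (\<lambda>x. mirror (f x)) else f) * dleft k A g"
proof (cases A)
  case (Inl i)
  show ?thesis
  proof (rule ext, rule grassmann_eqI)
    fix x and S :: "nat set" assume S: "finite S"
    note sm = sf_E_smooth[OF assms(1)] sf_E_smooth[OF assms(2)]
    have product: "partial_deriv i (\<lambda>y. (-1) ^ n * gcoeff (f y) T * gcoeff (g y) U) x
      = (-1) ^ n * partial_deriv i (\<lambda>y. gcoeff (f y) T) x * gcoeff (g x) U
        + (-1) ^ n * gcoeff (f x) T * partial_deriv i (\<lambda>y. gcoeff (g y) U) x" for n T U
      by (subst partial_deriv_mult)
        (simp_all add: smooth_differentiable sm smooth_cmult partial_deriv_cmult)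
    have "gcoeff (dleft k A (f * g) x) S
      = partial_deriv i (\<lambda>y. \<Sum>T\<in>Pow S. (-1) ^ inversions T (S - T) * gcoeff (f y) T * gcoeff (g y) (S - T)) x"
      unfolding Inl gcoeff_dleft_even times_fun_def gcoeff_mult[OF S] ..
    also have "\<dots> = (\<Sum>T\<in>Pow S. partial_deriv i
        (\<lambda>y. (-1) ^ inversions T (S - T) * gcoeff (f y) T * gcoeff (g y) (S - T)) x)"
      by (rule partial_deriv_sum) (rule smooth_mult smooth_const sm)+
    finally show "gcoeff (dleft k A (f * g) x) S
      = gcoeff ((dleft k A f * g + (if \<not> isl A then (\<lambda>x. mirror (f x)) else f) * dleft k A g) x) S"
      unfolding product
      using S by (simp add: Inl gcoeff_dleft_even gcoeff_mult sum.distrib del: dleft.simps(1))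
  qed
qed (simp add: fun_eq_iff gderiv_left_mult)

lemma dleft_dleft:
  assumes "f \<in> sf_E k m"
  shows "dleft k A (dleft k C f) = (if \<not> isl A \<and> \<not> isl C then - dleft k C (dleft k A f) else dleft k C (dleft k A f))"
proof -
  note sm = sf_E_smooth[OF assms]
  have mixed: "dleft k (Inl i) (dleft k (Inr \<alpha>) f) = dleft k (Inr \<alpha>) (dleft k (Inl i) f)" for i \<alpha>
  proof (rule ext, rule grassmann_eqI)
    fix x and S :: "nat set" assume S: "finite S"
    show "gcoeff (dleft k (Inl i) (dleft k (Inr \<alpha>) f) x) S = gcoeff (dleft k (Inr \<alpha>) (dleft k (Inl i) f) x) S"
      using S by (cases "k + \<alpha> \<in> S")
        (simp_all add: gcoeff_dleft_even gcoeff_gderiv_left partial_deriv_cmult sm partial_deriv_const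
          del: dleft.simps(1))
  qed
  have even: "dleft k (Inl i) (dleft k (Inl j) f) = dleft k (Inl j) (dleft k (Inl i) f)" for i j
  proof (rule ext, rule grassmann_eqI)
    fix x and S :: "nat set" assume S: "finite S"
    show "gcoeff (dleft k (Inl i) (dleft k (Inl j) f) x) S = gcoeff (dleft k (Inl j) (dleft k (Inl i) f) x) S"
      unfolding gcoeff_dleft_even by (rule partial_deriv_commute[OF sm])
  qed
  have odd: "dleft k (Inr \<alpha>) (dleft k (Inr \<beta>) f) = - dleft k (Inr \<beta>) (dleft k (Inr \<alpha>) f)" for \<alpha> \<beta>
    by (rule ext) (simp, rule gderiv_left_gderiv_left)
  show ?thesis
    by (cases A; cases C; simp only: sum.disc simp_thms if_True if_False;
        rule even mixed mixed[symmetric] odd)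
qed

lemma mirror_dleft:
  assumes "f \<in> sf_E k m"
  shows "(\<lambda>x. mirror (dleft k A f x)) = (if \<not> isl A then - dleft k A (\<lambda>x. mirror (f x)) else dleft k A (\<lambda>x. mirror (f x)))"
  by (rule ext, cases A)
    (auto intro!: grassmann_eqI simp: gcoeff_dleft_even partial_deriv_cmult sf_E_smooth[OF assms]
        mirror_gderiv_left simp del: dleft.simps(1))

lemma dleft_const:
  assumes "t \<in> grassmann_on {..<k}" shows "dleft k A (\<lambda>x. t) = 0"
proof (cases A)
  case (Inl i)
  then show ?thesis
    by (auto intro!: grassmann_eqI simp: fun_eq_iff gcoeff_dleft_even partial_deriv_const simp del: dleft.simps(1))
next
  case (Inr \<alpha>)
  have "gderiv_left (k + \<alpha>) t = 0" by (rule gderiv_left_on[OF _ assms]) simp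
  then show ?thesis by (simp add: Inr fun_eq_iff)
qed

lemma dleft_coord: "dleft k A (coord k C) = (if A = C then 1 else 0)"
proof (rule ext, rule grassmann_eqI)
  fix x and S :: "nat set" assume S: "finite S"
  show "gcoeff (dleft k A (coord k C) x) S = gcoeff ((if A = C then 1 else 0) x) S"
  proof (cases A)
    case (Inl i)
    show ?thesis
      by (cases C; cases "S = {}")
        (auto simp: Inl gcoeff_dleft_even gcoeff_coord_even partial_deriv_const partial_deriv_component gcoeff_1
          simp del: dleft.simps(1) coord.simps(1))
  next
    case (Inr \<alpha>)
    then show ?thesis
      using S by (cases C) (auto simp: gderiv_left_ggen gcoeff_gderiv_left gscalar_def)
  qed
qed

section \<open>The integral of superfields\<close>

lemma sf_integral_on: "sf_integral k m f \<in> grassmann_on {..<k}"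
  by (rule grassmann_onI) (simp add: sf_integral_def)

lemma gcoeff_sf_integral: "finite S \<Longrightarrow> S \<subseteq> {..<k} \<Longrightarrow>
    gcoeff (sf_integral k m f) S = (-1) ^ (m * card S) * (LINT x|lborel. gcoeff (f x) (S \<union> {k..<k + m}))"
  by (simp add: sf_integral_def)

lemma grassmann_on_eqI:
  assumes "a \<in> grassmann_on I" "b \<in> grassmann_on I" "\<And>S. finite S \<Longrightarrow> S \<subseteq> I \<Longrightarrow> gcoeff a S = gcoeff b S"
  shows "a = b"
  by (rule grassmann_eqI) (metis assms grassmann_onD)

lemma sf_integral_add:
  assumes "f \<in> sf_D k m" "g \<in> sf_D k m"
  shows "sf_integral k m (f + g) = sf_integral k m f + sf_integral k m g"
  by (rule grassmann_on_eqI[of _ "{..<k}"])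
    (simp_all add: sf_integral_on grassmann_on_add gcoeff_sf_integral distrib_left
      test_function_integrable[OF sf_D_test[OF assms(1)]] test_function_integrable[OF sf_D_test[OF assms(2)]])

lemma inversions_below:
  assumes "\<And>i j. i \<in> S \<Longrightarrow> j \<in> T \<Longrightarrow> i < j" shows "inversions S T = 0"
proof -
  have "{(i, j). i \<in> S \<and> j \<in> T \<and> j < i} = {}" using assms less_asym by blast
  then show ?thesis unfolding inversions_def by (simp only: card.empty)
qed

text \<open>
  For \<open>T \<subseteq> S \<subseteq> {..<k}\<close> the generators in \<open>T\<close> precede those of the odd coordinates, so the product of the
  coefficients creates no further inversions. The signs \<open>(-1)\<^bsup>m * card S\<^esup>\<close> in the definition of the
  integral differ by \<open>(-1)\<^bsup>card T\<^esup>\<close>, as \<open>m\<close> is odd, and this is the sign in \<open>mirror t\<close>.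
\<close>

lemma sf_integral_const_mult:
  assumes f: "f \<in> sf_D k m" and t: "t \<in> grassmann_on {..<k}" and m: "odd m"
  shows "sf_integral k m (\<lambda>x. t * f x) = mirror t * sf_integral k m f"
proof (rule grassmann_on_eqI[of _ "{..<k}"])
  show "sf_integral k m (\<lambda>x. t * f x) \<in> grassmann_on {..<k}" by (rule sf_integral_on)
  show "mirror t * sf_integral k m f \<in> grassmann_on {..<k}"
    by (intro grassmann_on_mult grassmann_on_mirror t sf_integral_on)
  fix S :: "nat set" assume S: "finite S" "S \<subseteq> {..<k}"
  let ?U = "{k..<k + m}"
  have coeff: "gcoeff (t * f x) (S \<union> ?U)
    = (\<Sum>T\<in>Pow S. (-1) ^ inversions T (S - T) * gcoeff t T * gcoeff (f x) ((S - T) \<union> ?U))" for x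
  proof -
    have "gcoeff (t * f x) (S \<union> ?U)
      = (\<Sum>T\<in>Pow (S \<union> ?U). (-1) ^ inversions T (S \<union> ?U - T) * gcoeff t T * gcoeff (f x) (S \<union> ?U - T))"
      using S by (simp add: gcoeff_mult)
    also have "\<dots> = (\<Sum>T\<in>Pow S. (-1) ^ inversions T (S \<union> ?U - T) * gcoeff t T * gcoeff (f x) (S \<union> ?U - T))"
    proof (rule sum.mono_neutral_right)
      have "gcoeff t T = 0" if "T \<subseteq> S \<union> ?U" "\<not> T \<subseteq> S" for T
      proof -
        from that obtain i where "i \<in> T" "i \<in> ?U" by blast
        then have "\<not> T \<subseteq> {..<k}" by auto
        then show ?thesis by (rule grassmann_onD[OF t])
      qed
      then show "\<forall>T\<in>Pow (S \<union> ?U) - Pow S. (-1) ^ inversions T (S \<union> ?U - T) * gcoeff t T * gcoeff (f x) (S \<union> ?U - T) = 0"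
        by simp
    qed (use S in auto)
    also have "\<dots> = (\<Sum>T\<in>Pow S. (-1) ^ inversions T (S - T) * gcoeff t T * gcoeff (f x) ((S - T) \<union> ?U))"
    proof (rule sum.cong[OF refl])
      fix T assume "T \<in> Pow S"
      then have T: "finite T" "T \<subseteq> {..<k}" using S finite_subset by auto
      have e: "S \<union> ?U - T = (S - T) \<union> ?U" using T(2) by auto
      have "inversions T ((S - T) \<union> ?U) = inversions T (S - T) + inversions T ?U"
        by (rule inversions_Un_right) (use S T in auto)
      also have "inversions T ?U = 0"
        by (rule inversions_below) (use T(2) in fastforce)
      finally show "(-1) ^ inversions T (S \<union> ?U - T) * gcoeff t T * gcoeff (f x) (S \<union> ?U - T)
        = (-1) ^ inversions T (S - T) * gcoeff t T * gcoeff (f x) ((S - T) \<union> ?U)"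
        by (simp only: e add_0_right)
    qed
    finally show ?thesis .
  qed
  have int: "integrable lborel (\<lambda>x. gcoeff (f x) T)" for T
    by (rule test_function_integrable[OF sf_D_test[OF f]])
  have "gcoeff (sf_integral k m (\<lambda>x. t * f x)) S = (-1) ^ (m * card S) *
    (\<Sum>T\<in>Pow S. (-1) ^ inversions T (S - T) * gcoeff t T * (LINT x|lborel. gcoeff (f x) ((S - T) \<union> ?U)))"
    unfolding gcoeff_sf_integral[OF S] coeff
    by (subst Bochner_Integration.integral_sum) (simp_all add: int)
  also have "\<dots> = (\<Sum>T\<in>Pow S. (-1) ^ inversions T (S - T) * gcoeff (mirror t) T * gcoeff (sf_integral k m f) (S - T))"
    unfolding sum_distrib_left
  proof (rule sum.cong[OF refl])
    fix T assume "T \<in> Pow S"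
    then have T: "finite T" "T \<subseteq> S" using S finite_subset by auto
    have "card S = card T + card (S - T)"
      using T S(1) by (metis add.commute card_Diff_subset card_mono le_add_diff_inverse2)
    then have "((-1) ^ (m * card S) :: 'b) = (-1) ^ card T * (-1) ^ (m * card (S - T))"
      using m by (simp add: minus_one_power_iff)
    moreover have "gcoeff (sf_integral k m f) (S - T)
        = (-1) ^ (m * card (S - T)) * (LINT x|lborel. gcoeff (f x) ((S - T) \<union> ?U))"
      by (rule gcoeff_sf_integral) (use S in auto)
    ultimately show "(-1) ^ (m * card S) * ((-1) ^ inversions T (S - T) * gcoeff t T *
        (LINT x|lborel. gcoeff (f x) ((S - T) \<union> ?U)))
      = (-1) ^ inversions T (S - T) * gcoeff (mirror t) T * gcoeff (sf_integral k m f) (S - T)"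
      by (simp add: mult_ac)
  qed
  also have "\<dots> = gcoeff (mirror t * sf_integral k m f) S"
    using S by (simp add: gcoeff_mult)
  finally show "gcoeff (sf_integral k m (\<lambda>x. t * f x)) S = gcoeff (mirror t * sf_integral k m f) S" .
qed

lemma mirror_sf_integral:
  assumes m: "odd m"
  shows "mirror (sf_integral k m f) = - sf_integral k m (\<lambda>x. mirror (f x))"
proof (rule grassmann_on_eqI[of _ "{..<k}"])
  fix S :: "nat set" assume S: "finite S" "S \<subseteq> {..<k}"
  have "card (S \<union> {k..<k + m}) = card S + m"
    using S by (subst card_Un_disjoint) auto
  then show "gcoeff (mirror (sf_integral k m f)) S = gcoeff (- sf_integral k m (\<lambda>x. mirror (f x))) S"
    using S m by (simp add: gcoeff_sf_integral minus_one_power_iff)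
qed (intro grassmann_on_mirror grassmann_on_minus sf_integral_on)+

lemma sf_integral_dleft:
  assumes "f \<in> sf_D k m" "A \<in> coords m"
  shows "sf_integral k m (dleft k A f) = 0"
proof (rule grassmann_on_eqI[of _ "{..<k}"])
  fix S :: "nat set" assume S: "finite S" "S \<subseteq> {..<k}"
  show "gcoeff (sf_integral k m (dleft k A f)) S = gcoeff 0 S"
  proof (cases A)
    case (Inl i)
    then show ?thesis
      unfolding gcoeff_sf_integral[OF S] Inl gcoeff_dleft_even
      by (simp add: integral_partial_deriv[OF sf_D_test[OF assms(1)]])
  next
    case (Inr \<alpha>)
    then have "k + \<alpha> \<in> S \<union> {k..<k + m}" using assms(2) by (auto simp: coords_def)
    then show ?thesis
      using S by (simp add: gcoeff_sf_integral Inr gcoeff_gderiv_left)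
  qed
qed (auto simp: sf_integral_on intro: grassmann_onI)

lemma superfields_integrated_superspace:
  fixes lam :: "nat \<Rightarrow> 'a::{real_normed_field, euclidean_space}"
  assumes m: "odd m"
  shows "integrated_superspace (\<lambda>f x. mirror (f x)) (sf_E k m) (constants k)
    (coords m :: (('p::finite + 'p) + nat) set) (\<lambda>A. \<not> isl A)
    (dleft k) partner (weight lam) (sf_D k m) (\<lambda>f x. sf_integral k m f) (coord k) (\<lambda>x. gscalar (1 / 2))"
  (is "integrated_superspace ?g _ _ _ _ _ _ _ _ _ _ ?h")
proof
  show "?g (f + g) = ?g f + ?g g" "?g (f * g) = ?g f * ?g g" "?g (?g f) = f"
    for f g :: "('p + 'p, 'a) superfield"
    by (simp_all add: fun_eq_iff mirror_add mirror_mult mirror_mirror)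
  show "f * g = g * f" if "?g f = f" for f g :: "('p + 'p, 'a) superfield"
    using that by (auto simp: fun_eq_iff intro: gparity_0_commute gparity_0_mirror)
  show "f * g = ?g g * f" if "?g f = - f" for f g :: "('p + 'p, 'a) superfield"
    using that by (auto simp: fun_eq_iff intro: gparity_1_commute gparity_1_mirror)
  show "finite (coords m :: (('p + 'p) + nat) set)" by (simp add: coords_def)
  show "1 \<in> constants k" by (auto simp: constants_def grassmann_on_1 one_fun_def)
  show "f + g \<in> constants k" "f * g \<in> constants k"
    if "f \<in> constants k" "g \<in> constants k" for f g :: "('p + 'p, 'a) superfield"
    using that by (auto simp: constants_def plus_fun_def times_fun_def grassmann_on_add grassmann_on_mult)
  show "- f \<in> constants k" "?g f \<in> constants k" "f \<in> sf_E k m"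
    if "f \<in> constants k" for f :: "('p + 'p, 'a) superfield"
    using that by (auto simp: constants_def fun_Compl_def grassmann_on_minus grassmann_on_mirror
        intro!: sf_E_const intro: grassmann_on_mono)
  show "dleft k A f = 0" if "f \<in> constants k" for A and f :: "('p + 'p, 'a) superfield"
    using that by (auto simp: constants_def dleft_const)
  show "f + g \<in> sf_E k m" "f * g \<in> sf_E k m"
    if "f \<in> sf_E k m" "g \<in> sf_E k m" for f g :: "('p + 'p, 'a) superfield"
    using that by (simp_all add: sf_E_add sf_E_mult)
  show "- f \<in> sf_E k m" "?g f \<in> sf_E k m" "dleft k A f \<in> sf_E k m"
    if "f \<in> sf_E k m" for A and f :: "('p + 'p, 'a) superfield"
    using that by (simp_all add: sf_E_minus sf_E_mirror sf_E_dleft)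
  show "dleft k A (f + g) = dleft k A f + dleft k A g"
    "dleft k A (f * g) = dleft k A f * g + (if \<not> isl A then ?g f else f) * dleft k A g"
    if "f \<in> sf_E k m" "g \<in> sf_E k m" for A and f g :: "('p + 'p, 'a) superfield"
    using that by (simp_all only: dleft_add dleft_mult)
  show "dleft k A (dleft k C f) = (if \<not> isl A \<and> \<not> isl C then - dleft k C (dleft k A f) else dleft k C (dleft k A f))"
    "?g (dleft k A f) = (if \<not> isl A then - dleft k A (?g f) else dleft k A (?g f))"
    if "f \<in> sf_E k m" for A C and f :: "('p + 'p, 'a) superfield"
    using that by (rule dleft_dleft mirror_dleft)+
  show "weight lam A \<in> constants k" "?g (weight lam A) = weight lam A" for A :: "('p + 'p) + nat"
    by (auto simp: weight_def constants_def grassmann_on_gscalar mirror_gscalar)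
  show "partner (partner A) = A" "(\<not> isl (partner A)) = (\<not> isl A)" for A :: "('p + 'p) + nat"
    by (simp_all add: partner_partner isl_partner)
  show "partner A \<in> coords m" if "A \<in> coords m" for A :: "('p + 'p) + nat"
    using that by (rule partner_coords)
  show "weight lam (partner A) = (if \<not> isl A then weight lam A else - weight lam A)" for A :: "('p + 'p) + nat"
    using omega_partner[of lam A] by (simp add: weight_def partner_partner fun_eq_iff gscalar_minus)
  show "f \<in> sf_E k m" "?g f \<in> sf_D k m" "dleft k A f \<in> sf_D k m" "(\<lambda>x. sf_integral k m f) \<in> constants k"
    "?g (\<lambda>x. sf_integral k m f) = - (\<lambda>x. sf_integral k m (?g f))"
    if "f \<in> sf_D k m" for A and f :: "('p + 'p, 'a) superfield"
    using that by (auto simp: sf_D_E sf_D_mirror sf_D_dleft constants_def sf_integral_on fun_eq_iff mirror_sf_integral[OF m])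
  show "f + g \<in> sf_D k m" "(\<lambda>x. sf_integral k m (f + g)) = (\<lambda>x. sf_integral k m f) + (\<lambda>x. sf_integral k m g)"
    if "f \<in> sf_D k m" "g \<in> sf_D k m" for f g :: "('p + 'p, 'a) superfield"
    using that by (simp_all add: sf_D_add sf_integral_add fun_eq_iff)
  show "g * f \<in> sf_D k m" if "g \<in> sf_E k m" "f \<in> sf_D k m" for f g :: "('p + 'p, 'a) superfield"
    using that by (rule sf_D_mult)
  show "(\<lambda>x. sf_integral k m (t * f)) = ?g t * (\<lambda>x. sf_integral k m f)"
    if "t \<in> constants k" "f \<in> sf_D k m" for t f :: "('p + 'p, 'a) superfield"
    using that by (auto simp: constants_def times_fun_def sf_integral_const_mult[OF _ _ m])
  show "(\<lambda>x. sf_integral k m (dleft k A f)) = 0"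
    if "A \<in> coords m" "f \<in> sf_D k m" for A and f :: "('p + 'p, 'a) superfield"
    using that by (simp add: fun_eq_iff sf_integral_dleft)
  show "coord k A \<in> sf_E k m" if "A \<in> coords m" for A :: "('p + 'p) + nat"
    using that by (rule coord_sf_E)
  show "?g (coord k A) = (if \<not> isl A then - coord k A else coord k A)" for A :: "('p + 'p) + nat"
    by (cases A) (simp_all add: fun_eq_iff mirror_gscalar mirror_ggen)
  show "dleft k A (coord k C) = (if A = C then 1 else 0)" for A C :: "('p + 'p) + nat"
    by (rule dleft_coord)
  show "?h \<in> constants k" "?g ?h = ?h" "?h + ?h = 1"
    by (auto simp: constants_def grassmann_on_gscalar mirror_gscalar fun_eq_iff gscalar_add[symmetric] gscalar_1)
  show "f = 0" if "f + f + f = 0" for f :: "('p + 'p, 'a) superfield"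
  proof (rule ext, rule grassmann_eqI)
    fix x S
    have "gcoeff ((f + f + f) x) S = 0" unfolding that by simp
    then have "3 * gcoeff (f x) S = 0" by simp
    then show "gcoeff (f x) S = gcoeff (0 x) S" by simp
  qed
qed

section \<open>The bilinear maps on superfields\<close>

text \<open>The parameter \<open>position\<close> only carries the type \<open>'p\<close> that indexes the pairs of even coordinates.\<close>

locale superfields =
  fixes k m :: nat and lam :: "nat \<Rightarrow> 'a::{real_normed_field, euclidean_space}"
    and position :: "'p::finite itself"
  assumes odd_m: "odd m"
begin

sublocale integrated_superspace "\<lambda>f x. mirror (f x)" "sf_E k m" "constants k"
    "coords m :: (('p::finite + 'p) + nat) set" "\<lambda>A. \<not> isl A"
    "dleft k" partner "weight lam" "sf_D k m" "\<lambda>f x. sf_integral k m f" "coord k" "\<lambda>x. gscalar (1 / 2)"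
  by (rule superfields_integrated_superspace[OF odd_m])

abbreviation gam where "gam f \<equiv> (\<lambda>x. mirror (f x))" for f :: "('p + 'p, 'a) superfield"

abbreviation J where "J f \<equiv> (\<lambda>x. sf_integral k m f)" for f :: "('p + 'p, 'a) superfield"

lemma dright_eq: "dright k A f = tw A (dleft k A f)"
  by (rule ext, cases A) (simp_all add: tw_def gderiv_right_eq)

text \<open>
  Each row of the form has a single nonzero entry.
\<close>

lemma sum_omega:
  fixes A :: "('p + 'p) + nat"
  assumes "A \<in> coords m"
  shows "(\<Sum>C\<in>coords m. gscalar (omega lam A C) * h C) = weight lam A x * h (partner A)"
proof -
  have "(\<Sum>C\<in>coords m. gscalar (omega lam A C) * h C) = (\<Sum>C\<in>{partner A}. gscalar (omega lam A C) * h C)"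
    by (rule sum.mono_neutral_right)
      (use assms finite_I in \<open>auto simp: partner_coords omega_not_partner gscalar_0\<close>)
  then show ?thesis by (simp add: weight_def)
qed

lemma bidiff_pow_eq: "bidiff_pow k m lam r f g = B r f g"
proof (induction r arbitrary: f g)
  case 0
  show ?case by (rule ext) simp
next
  case (Suc r)
  show ?case
  proof (rule ext)
    fix x
    have "bidiff_pow k m lam (Suc r) f g x
      = (\<Sum>A\<in>coords m. weight lam A x * B r (dright k A f) (dleft k (partner A) g) x)"
      unfolding bidiff_pow.simps Suc by (rule sum.cong[OF refl]) (rule sum_omega)
    then show "bidiff_pow k m lam (Suc r) f g x = B (Suc r) f g x"
      by (simp add: sum_fun_apply dright_eq)
  qed
qed

lemma m1_eq: "m1 k m lam f g = B 3 f g"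
  by (simp add: m1_def bidiff_pow_eq)

lemma m0_eq: "m0 k m lam f g = B 1 f g"
proof -
  have "poisson k m lam f g x = bidiff_pow k m lam 1 f g x" for x
    by (simp add: poisson_def gscalar_commute[symmetric] mult.assoc[symmetric])
  then show ?thesis by (simp add: m0_def fun_eq_iff bidiff_pow_eq)
qed

lemma euler_eq: "euler k m f = Eul f"
  by (rule ext) (simp add: euler_def Eul_def N_def sum_fun_apply)

lemma dim_eq: "dim = (\<lambda>x. of_int (int (CARD('p + 'p)) - int m))"
proof (rule ext)
  fix x :: "real ^ ('p + 'p)"
  have "dim x = (\<Sum>A\<in>(coords m :: (('p + 'p) + nat) set). if isl A then 1 else - 1)"
    by (auto simp: dim_def sum_fun_apply intro!: sum.cong)
  also have "\<dots> = of_nat (CARD('p + 'p)) - of_nat m"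
    unfolding coords_def by (subst sum.Plus) (simp_all add: sum_negf)
  finally show "dim x = of_int (int (CARD('p + 'p)) - int m)"
    by (simp only: of_int_diff of_int_of_nat_eq)
qed

lemma sf_parity_iff_hom: "sf_parity e f \<longleftrightarrow> hom e f"
  by (simp add: sf_parity_def hom_def gparity_iff_mirror fun_eq_iff minus_one_power_fun_apply)

lemma gpart_parts:
  fixes f :: "('p + 'p, 'a) superfield"
  assumes "f \<in> sf_D k m"
  defines "f0 \<equiv> \<lambda>y. gpart 0 (f y)" and "f1 \<equiv> \<lambda>y. gpart 1 (f y)"
  shows "f0 \<in> sf_D k m" "f1 \<in> sf_D k m" "gam f0 = f0" "gam f1 = - f1" "f0 + f1 = f" "f0 - f1 = gam f"
proof -
  have "(\<lambda>y. gpart e (f y)) \<in> sf_D k m" for e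
  proof (rule sf_DI)
    show "gpart e (f x) \<in> grassmann_on {..<k + m}" for x
      by (rule grassmann_onI) (simp add: gpart_def grassmann_onD[OF sf_D_on[OF assms(1)]])
    show "test_function (\<lambda>x. gcoeff (gpart e (f x)) S)" if "finite S" for S
      using that by (cases "card S mod 2 = e mod 2") (simp_all add: gpart_def sf_D_test[OF assms(1)] test_function_0)
  qed
  then show "f0 \<in> sf_D k m" "f1 \<in> sf_D k m" by (simp_all add: f0_def f1_def)
  have "mirror (gpart e a) = (-1) ^ e * gpart e a" for e and a :: "'a grassmann"
    using gparity_gpart gparity_iff_mirror by blast
  from this[of 0] this[of 1] show "gam f0 = f0" "gam f1 = - f1"
    by (simp_all add: f0_def f1_def fun_eq_iff)
  show "f0 + f1 = f" "f0 - f1 = gam f"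
    by (simp_all add: f0_def f1_def fun_eq_iff gpart_decomp del: One_nat_def)
qed

text \<open>
  The common shape of \<open>m\<^sub>3\<close>, \<open>m\<^sub>\<zeta>\<close> and \<open>j\<^sub>\<zeta>\<close>, with an operator \<open>U\<close> that is odd if \<open>b\<close> holds and even otherwise.
\<close>

lemma parity_ext_eq:
  fixes U :: "('p + 'p, 'a) superfield \<Rightarrow> ('p + 'p, 'a) superfield"
  assumes fg: "f \<in> sf_D k m" "g \<in> sf_D k m"
    and U_add: "\<And>u v. u \<in> sf_D k m \<Longrightarrow> v \<in> sf_D k m \<Longrightarrow> U (u + v) = U u + U v"
    and gam_U: "\<And>v. v \<in> sf_D k m \<Longrightarrow> gam (U v) = (if b then - U (gam v) else U (gam v))"
  shows "parity_ext (\<lambda>a b f g x.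
     (-1) ^ (m * a) * U f x * sf_integral k m g
     - (-1) ^ (a * b + m * b) * U g x * sf_integral k m f) f g
   = U (gam f) * J g + (if b then J (gam f) * U g else - (J f * U g))"
proof -
  note f = gpart_parts[OF fg(1)] and g = gpart_parts[OF fg(2)]
  let ?f0 = "\<lambda>y. gpart 0 (f y)" and ?f1 = "\<lambda>y. gpart 1 (f y)"
  let ?g0 = "\<lambda>y. gpart 0 (g y)" and ?g1 = "\<lambda>y. gpart 1 (g y)"
  have signs: "(-1 :: 'a grassmann) ^ (m * 0) = 1" "(-1 :: 'a grassmann) ^ (m * 1) = - 1"
    "(-1 :: 'a grassmann) ^ (0 * 0 + m * 0) = 1" "(-1 :: 'a grassmann) ^ (0 * 1 + m * 1) = - 1"
    "(-1 :: 'a grassmann) ^ (1 * 0 + m * 0) = 1" "(-1 :: 'a grassmann) ^ (1 * 1 + m * 1) = 1"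
    using odd_m by simp_all
  have "parity_ext (\<lambda>a b f g x.
     (-1) ^ (m * a) * U f x * sf_integral k m g
     - (-1) ^ (a * b + m * b) * U g x * sf_integral k m f) f g
   = (U ?f0 * J ?g0 - U ?g0 * J ?f0) + (U ?f0 * J ?g1 + U ?g1 * J ?f0)
      + (- (U ?f1 * J ?g0) - U ?g0 * J ?f1) + (- (U ?f1 * J ?g1) - U ?g1 * J ?f1)"
    (is "?lhs = ?rhs")
  proof (rule ext)
    fix x
    have two: "(\<Sum>a\<in>{0, 1::nat}. h a) = h 0 + h 1" for h :: "nat \<Rightarrow> 'a grassmann"
      by simp
    show "?lhs x = ?rhs x"
      unfolding parity_ext_def two signs by simp
  qed
  also have "\<dots> = U (?f0 - ?f1) * J (?g0 + ?g1) + (if b then J (?f0 - ?f1) * U (?g0 + ?g1)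
      else - (J (?f0 + ?f1) * U (?g0 + ?g1)))"
    by (rule graded_extension_sum[OF f(1,2) g(1,2) f(3,4) g(3,4) U_add gam_U])
  finally show ?thesis
    unfolding f(5,6) g(5) .
qed

lemma mu_eq:
  assumes fg: "f \<in> sf_D k m" "g \<in> sf_D k m"
  shows "mu k m f g = J (gam f) * J g"
proof -
  note f = gpart_parts[OF fg(1)] and g = gpart_parts[OF fg(2)]
  have Jf: "sf_integral k m (gam f)
      = sf_integral k m (\<lambda>y. gpart 0 (f y)) - sf_integral k m (\<lambda>y. gpart 1 (f y))"
    using fun_cong[OF J_diff[OF f(1,2)]] unfolding f(6) by simp
  have Jg: "sf_integral k m g
      = sf_integral k m (\<lambda>y. gpart 0 (g y)) + sf_integral k m (\<lambda>y. gpart 1 (g y))"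
    using fun_cong[OF J_add[OF g(1,2)]] unfolding g(5) by simp
  show ?thesis
    by (rule ext) (simp add: mu_def parity_ext_def Jf Jg distrib_left left_diff_distrib del: One_nat_def)
qed

end

section \<open>The value at \<open>\<theta> = 0\<close>\<close>

lemma gcoeff_at_theta_0: "gcoeff (at_theta_0 k a) S = (if S \<inter> {..<k} = {} then gcoeff a S else 0)"
  by (simp add: at_theta_0_def)

lemma at_theta_0_add: "at_theta_0 k (a + b) = at_theta_0 k a + at_theta_0 k b"
  and at_theta_0_minus: "at_theta_0 k (- a) = - at_theta_0 k a"
  and at_theta_0_diff: "at_theta_0 k (a - b) = at_theta_0 k a - at_theta_0 k b"
  and at_theta_0_0: "at_theta_0 k 0 = 0"
  by (rule grassmann_eqI; simp add: gcoeff_at_theta_0)+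

lemma at_theta_0_sum: "at_theta_0 k (sum f X) = (\<Sum>x\<in>X. at_theta_0 k (f x))"
  by (induction X rule: infinite_finite_induct) (simp_all add: at_theta_0_0 at_theta_0_add)

text \<open>
  A monomial without outer generators only has factors without outer generators, so the elements
  that vanish at \<open>\<theta> = 0\<close> form an ideal.
\<close>

lemma at_theta_0_mult_0:
  assumes "at_theta_0 k a = 0 \<or> at_theta_0 k b = 0" shows "at_theta_0 k (a * b) = 0"
proof (rule grassmann_eqI)
  fix S :: "nat set" assume S: "finite S"
  have z: "gcoeff c T = 0" if "at_theta_0 k c = 0" "T \<inter> {..<k} = {}" for c :: "'a grassmann" and T
    using that gcoeff_at_theta_0[of k c T] by simp
  show "gcoeff (at_theta_0 k (a * b)) S = gcoeff 0 S"
  proof (cases "S \<inter> {..<k} = {}")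
    case True
    have zero: "gcoeff a T = 0 \<or> gcoeff b (S - T) = 0" if "T \<subseteq> S" for T
    proof -
      have "T \<inter> {..<k} = {}" "(S - T) \<inter> {..<k} = {}" using True that by auto
      then show ?thesis using assms z by blast
    qed
    have "(-1) ^ inversions T (S - T) * gcoeff a T * gcoeff b (S - T) = 0" if "T \<subseteq> S" for T
      using zero[OF that] by auto
    then show ?thesis
      using True by (simp add: gcoeff_at_theta_0 gcoeff_mult[OF S])
  qed (simp add: gcoeff_at_theta_0)
qed

lemma at_theta_0_ggen: "i < k \<Longrightarrow> at_theta_0 k (ggen i) = 0"
  by (rule grassmann_eqI) (auto simp: gcoeff_at_theta_0 ggen_def)

lemma at_theta_0_sign: "at_theta_0 k ((-1) ^ n * a) = (-1) ^ n * at_theta_0 k a"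
  by (cases "even n") (simp_all add: at_theta_0_minus)

lemma at_theta_0_dright:
  assumes "\<And>x. at_theta_0 k (f x) = 0" shows "at_theta_0 k (dright k A f x) = 0"
proof (rule grassmann_eqI)
  have z: "gcoeff (f x) T = 0" if "T \<inter> {..<k} = {}" for x T
    using that assms[of x] gcoeff_at_theta_0[of k "f x" T] by simp
  fix S :: "nat set" assume S: "finite S"
  show "gcoeff (at_theta_0 k (dright k A f x)) S = gcoeff 0 S"
  proof (cases "S \<inter> {..<k} = {}")
    case True
    show ?thesis
    proof (cases A)
      case (Inl i)
      show ?thesis
        using S by (simp add: Inl gcoeff_at_theta_0 True z partial_deriv_const)
    next
      case (Inr \<alpha>)
      have "insert (k + \<alpha>) S \<inter> {..<k} = {}" using True by auto
      then show ?thesis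
        using S by (simp add: Inr gcoeff_at_theta_0 True gderiv_right_def z)
    qed
  qed (simp add: gcoeff_at_theta_0)
qed

lemma at_theta_0_m0:
  assumes "\<And>x. at_theta_0 k (\<zeta> x) = 0" shows "at_theta_0 k (m0 k m lam \<zeta> f x) = 0"
  unfolding m0_def poisson_def at_theta_0_sum
  by (intro sum.neutral ballI at_theta_0_mult_0 disjI1 at_theta_0_dright assms)

lemma at_theta_0_deformed_bracket:
  fixes \<zeta> :: "('p::finite + 'p, 'a::{real_normed_field, euclidean_space}) superfield"
  assumes \<theta>: "at_theta_0 k \<theta> = 0" and \<zeta>: "\<And>x. at_theta_0 k (\<zeta> x) = 0" and \<eta>: "\<And>x. at_theta_0 k (\<eta> x) = 0"
  shows "at_theta_0 k (deformed_bracket k m lam \<theta> h\<^sub>1 \<zeta> \<eta> f g x) = at_theta_0 k (m0 k m lam f g x)"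
proof -
  have 1: "at_theta_0 k (m_zeta k m lam \<zeta> f g x) = 0"
    unfolding m_zeta_def parity_ext_def at_theta_0_sum at_theta_0_diff
    by (intro sum.neutral ballI) (simp add: at_theta_0_mult_0 at_theta_0_m0[OF \<zeta>] mult.assoc at_theta_0_sign)
  show ?thesis
    by (simp add: deformed_bracket_def at_theta_0_add 1 \<theta> \<eta> at_theta_0_mult_0 mult.assoc)
qed

text \<open>
  At \<open>\<theta> = 0\<close> all terms of the equation for \<open>\<eta>\<close> except \<open>h\<^sub>2\<close> vanish, so the coefficient of \<open>\<eta>\<close> at the
  empty monomial is a constant function with bounded support, and hence zero.
\<close>

lemma at_theta_0_eta:
  fixes \<zeta> \<eta> :: "('p::finite + 'p, 'a::{real_normed_field, euclidean_space}) superfield"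
  assumes \<theta>: "at_theta_0 k \<theta> = 0" and \<zeta>: "\<And>x. at_theta_0 k (\<zeta> x) = 0"
    and \<eta>: "\<eta> \<in> sf_D k m" and h2: "h\<^sub>2 \<in> grassmann_on {..<k}"
    and eta_eq: "\<And>x. \<eta> x = - \<theta> * a x - \<theta> * b x - c * \<zeta> x - m0 k m lam \<zeta> \<zeta> x + h\<^sub>2"
  shows "at_theta_0 k (\<eta> x) = 0"
proof -
  have eq: "at_theta_0 k (\<eta> x) = at_theta_0 k h\<^sub>2" for x
    unfolding eta_eq
    by (simp add: at_theta_0_add at_theta_0_diff at_theta_0_minus at_theta_0_mult_0 \<theta> \<zeta> at_theta_0_m0)
  have "gcoeff (\<eta> x) {} = gcoeff h\<^sub>2 {}" for x
    using arg_cong[OF eq[of x], of "\<lambda>a. gcoeff a {}"] by (simp add: gcoeff_at_theta_0)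
  then have "bounded {x :: real ^ ('p + 'p). gcoeff h\<^sub>2 {} \<noteq> 0}"
    using sf_D_test[OF \<eta>, of "{}"] by (simp add: test_function_iff)
  then have 0: "gcoeff h\<^sub>2 {} = 0"
    using not_bounded_UNIV[where 'a = "real ^ ('p + 'p)"] by (cases "gcoeff h\<^sub>2 {} = 0") auto
  have "gcoeff (at_theta_0 k h\<^sub>2) S = 0" for S
    using grassmann_onD[OF h2, of S] 0 by (cases "S \<subseteq> {..<k}"; cases "S = {}") (auto simp: gcoeff_at_theta_0)
  then show ?thesis unfolding eq by (intro grassmann_eqI) simp
qed

section \<open>The deformation of the Poisson superalgebra\<close>

theorem theorem3p2:
  fixes k m i :: nat
    and lam :: "nat \<Rightarrow> 'a::{real_normed_field, euclidean_space}"
    and \<theta> h\<^sub>1 h\<^sub>2 :: "'a grassmann"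
    and \<zeta> \<eta> :: "('p::finite + 'p, 'a) superfield"
  defines "n \<equiv> CARD('p + 'p)"
  assumes k: "k > 1"
    and m: "odd m"
    and n: "n \<ge> 4"
    and lam: "\<forall>\<alpha><m. lam \<alpha> = 1 \<or> lam \<alpha> = -1"
    and theta: "i < k" "\<theta> = ggen i"
    and zeta: "\<zeta> \<in> sf_E k m" "sf_parity 1 \<zeta>"
    and eta: "\<eta> \<in> sf_D k m" "sf_parity 0 \<eta>"
    and h1: "h\<^sub>1 \<in> grassmann_on {..<k}" "gparity 1 h\<^sub>1"
    and h2: "h\<^sub>2 \<in> grassmann_on {..<k}" "gparity 0 h\<^sub>2"
    and eta_eq: "\<forall>x. \<eta> x =
        - \<theta> * h\<^sub>1 * m1 k m lam \<zeta> \<zeta> x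
        - \<theta> * (2 * euler k m \<zeta> x - of_int (2 + int n - int m) * \<zeta> x)
        - sf_integral k m \<eta> * \<zeta> x - m0 k m lam \<zeta> \<zeta> x + h\<^sub>2"
    and theta_eta: "\<theta> * sf_integral k m \<eta> = 0"
    and h2_eq: "\<theta> * of_int (1 + int n - int m) * h\<^sub>2 - sf_integral k m \<eta> * h\<^sub>2 = 0"
  defines "C \<equiv> deformed_bracket k m lam \<theta> h\<^sub>1 \<zeta> \<eta>"
  shows "super_bilinear k m 0 C
    \<and> lie_superbracket k m C
    \<and> ((\<forall>x. at_theta_0 k (\<zeta> x) = 0) \<longrightarrow>
        (\<forall>f\<in>sf_D k m. \<forall>g\<in>sf_D k m. \<forall>x.
           at_theta_0 k (C f g x) = at_theta_0 k (m0 k m lam f g x)))"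
proof -
  note deformation_def = C_def
  interpret superfields k m lam "TYPE('p)" by (rule superfields.intro) (rule m)
  have dimn: "dim x = of_int (int n - int m)" for x :: "real ^ ('p + 'p)"
    by (simp add: dim_eq n_def)
  have two_dim: "of_int (2 + int n - int m) = 2 + dim x" "of_int (1 + int n - int m) = 1 + dim x"
    for x :: "real ^ ('p + 'p)"
    unfolding dimn by simp_all
  have const: "(\<lambda>x. t) \<in> constants k \<longleftrightarrow> t \<in> grassmann_on {..<k}" for t :: "'a grassmann"
    by (auto simp: constants_def fun_eq_iff)
  have \<theta>: "\<theta> \<in> grassmann_on {..<k}" "mirror \<theta> = - \<theta>"
    using theta by (simp_all add: grassmann_on_ggen mirror_ggen)
  interpret deformation_data "\<lambda>f x. mirror (f x)" "sf_E k m" "constants k"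
    "coords m :: (('p + 'p) + nat) set" "\<lambda>A. \<not> isl A"
    "dleft k" partner "weight lam" "sf_D k m" "\<lambda>f x. sf_integral k m f" "coord k" "\<lambda>x. gscalar (1 / 2)"
    "\<lambda>x. \<theta>" "\<lambda>x. h\<^sub>1" "\<lambda>x. h\<^sub>2" \<zeta> \<eta>
  proof
    show "(\<lambda>x. \<theta>) \<in> constants k" "(\<lambda>x. h\<^sub>1) \<in> constants k" "(\<lambda>x. h\<^sub>2) \<in> constants k"
      using \<theta> h1 h2 by (simp_all add: const)
    show "gam (\<lambda>x. \<theta>) = - (\<lambda>x. \<theta>)" "gam (\<lambda>x. h\<^sub>1) = - (\<lambda>x. h\<^sub>1)" "gam (\<lambda>x. h\<^sub>2) = (\<lambda>x. h\<^sub>2)"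
      using \<theta> h1 h2 by (simp_all add: gparity_iff_mirror fun_eq_iff)
    show "gam \<zeta> = - \<zeta>" "gam \<eta> = \<eta>"
      using zeta eta by (simp_all add: sf_parity_def gparity_iff_mirror fun_eq_iff)
    show "\<zeta> \<in> sf_E k m" "\<eta> \<in> sf_D k m" by fact+
    show "\<eta> = - (\<lambda>x. \<theta>) * (\<lambda>x. h\<^sub>1) * B 3 \<zeta> \<zeta> - (\<lambda>x. \<theta>) * (Eul \<zeta> + Eul \<zeta> - (2 + dim) * \<zeta>)
        - J \<eta> * \<zeta> - B 1 \<zeta> \<zeta> + (\<lambda>x. h\<^sub>2)"
    proof (rule ext)
      fix x
      have two: "(2 :: real ^ ('p + 'p) \<Rightarrow> 'a grassmann) x = 2"
        by (simp only: one_add_one[symmetric] plus_fun_apply one_fun_apply)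
      show "\<eta> x = (- (\<lambda>x. \<theta>) * (\<lambda>x. h\<^sub>1) * B 3 \<zeta> \<zeta> - (\<lambda>x. \<theta>) * (Eul \<zeta> + Eul \<zeta> - (2 + dim) * \<zeta>)
          - J \<eta> * \<zeta> - B 1 \<zeta> \<zeta> + (\<lambda>x. h\<^sub>2)) x"
        using eta_eq[rule_format, of x] two_dim(1)[of x]
        by (simp add: m1_eq m0_eq euler_eq mult_2 two del: of_int_add of_int_diff B.simps One_nat_def)
    qed
    show "(\<lambda>x. \<theta>) * J \<eta> = 0" using theta_eta by (simp add: fun_eq_iff)
    show "(\<lambda>x. \<theta>) * (1 + dim) * (\<lambda>x. h\<^sub>2) - J \<eta> * (\<lambda>x. h\<^sub>2) = 0"
      using h2_eq two_dim(2) by (simp add: fun_eq_iff del: of_int_add of_int_diff)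
  qed
  have C_eq: "C f g = deformed f g" if fg: "f \<in> sf_D k m" "g \<in> sf_D k m" for f g
  proof -
    have "m3 k m f g = Eul (gam f) * J g + - (J f * Eul g)"
      unfolding m3_def euler_eq
      using parity_ext_eq[OF fg, of Eul False] by (simp add: Eul_add gam_Eul D_S)
    moreover have ad: "parity_ext (\<lambda>a b f g x.
        (-1) ^ (m * a) * B r \<zeta> f x * sf_integral k m g
        - (-1) ^ (a * b + m * b) * B r \<zeta> g x * sf_integral k m f) f g
      = B r \<zeta> (gam f) * J g + J (gam f) * B r \<zeta> g" for r
    proof -
      have "gam (B r \<zeta> v) = - B r \<zeta> (gam v)" if "v \<in> sf_D k m" for v
        using gam_B[OF S_\<zeta> D_S[OF that]] B_minus_left[OF S_\<zeta> S_gam[OF D_S[OF that]]]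
        unfolding gam_\<zeta> by simp
      then show ?thesis
        using parity_ext_eq[OF fg, of "B r \<zeta>" True] by (simp add: B_add_right S_\<zeta> D_S)
    qed
    ultimately have "C f g x = deformed f g x" for x
      unfolding deformation_def deformed_bracket_def deformed_expand[OF fg] m_zeta_def j_zeta_def m0_eq m1_eq ad mu_eq[OF fg]
      by (simp add: mult.assoc del: B.simps One_nat_def)
    then show ?thesis by (rule ext)
  qed
  have "super_bilinear k m 0 C"
    unfolding super_bilinear_def
  proof (intro conjI ballI allI impI)
    fix f g :: "('p + 'p, 'a) superfield" and a b :: nat
    assume fg: "f \<in> sf_D k m" "g \<in> sf_D k m"
    show "C f g \<in> sf_D k m" by (simp add: C_eq fg D_deformed)
    show "sf_parity (a + b + 0) (C f g)" if "sf_parity a f \<and> sf_parity b g"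
      using that hom_deformed[OF fg] by (simp add: C_eq fg sf_parity_iff_hom)
  next
    fix f f' g :: "('p + 'p, 'a) superfield"
    assume D: "f \<in> sf_D k m" "f' \<in> sf_D k m" "g \<in> sf_D k m"
    have sum: "(\<lambda>x. f x + f' x) = f + f'" by (simp add: fun_eq_iff)
    show "C (\<lambda>x. f x + f' x) g = (\<lambda>x. C f g x + C f' g x)"
      unfolding sum using deformed_add_left[OF D] D by (simp add: C_eq D_add fun_eq_iff)
    show "C g (\<lambda>x. f x + f' x) = (\<lambda>x. C g f x + C g f' x)"
      unfolding sum using deformed_add_right[OF D(3,1,2)] D by (simp add: C_eq D_add fun_eq_iff)
  next
    fix f g :: "('p + 'p, 'a) superfield" and t :: "'a grassmann" and a :: nat
    assume fg: "f \<in> sf_D k m" "g \<in> sf_D k m" and "t \<in> grassmann_on {..<k}"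
    then have t: "(\<lambda>x. t) \<in> constants k" by (simp add: const)
    have mult: "(\<lambda>x. t * u x) = (\<lambda>x. t) * u" "(\<lambda>x. u x * t) = u * (\<lambda>x. t)"
      for u :: "('p + 'p, 'a) superfield"
      by (simp_all add: fun_eq_iff)
    have D: "(\<lambda>x. t) * u \<in> sf_D k m" "u * (\<lambda>x. t) \<in> sf_D k m" if "u \<in> sf_D k m"
      for u :: "('p + 'p, 'a) superfield"
      by (rule D_mult_left[OF G_S[OF t] that] D_mult_G[OF that t])+
    show "C (\<lambda>x. t * f x) g = (\<lambda>x. (-1) ^ (a * 0) * t * C f g x)"
      unfolding mult using deformed_G_left[OF t fg] D fg by (simp add: C_eq fun_eq_iff)
    show "C f (\<lambda>x. t * g x) = C (\<lambda>x. f x * t) g"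
      unfolding mult using deformed_G_middle[OF t fg] D fg by (simp add: C_eq)
    show "C f (\<lambda>x. g x * t) = (\<lambda>x. C f g x * t)"
      unfolding mult using deformed_G_right[OF t fg] D fg by (simp add: C_eq)
  qed
  moreover have "lie_superbracket k m C"
    unfolding lie_superbracket_def
  proof (intro conjI ballI allI impI)
    fix f g :: "('p + 'p, 'a) superfield" and a b :: nat
    assume fg: "f \<in> sf_D k m" "g \<in> sf_D k m" and "sf_parity a f \<and> sf_parity b g"
    then have "hom a f" "hom b g" by (simp_all add: sf_parity_iff_hom)
    from deformed_antisym[OF fg this] show "C f g = (\<lambda>x. - ((-1) ^ (a * b)) * C g f x)"
      by (simp add: C_eq fg fun_eq_iff minus_one_power_fun_apply)
  next
    fix f g h :: "('p + 'p, 'a) superfield" and a b c :: nat and x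
    assume D: "f \<in> sf_D k m" "g \<in> sf_D k m" "h \<in> sf_D k m"
      and "sf_parity a f \<and> sf_parity b g \<and> sf_parity c h"
    then have "hom a f" "hom b g" "hom c h" by (simp_all add: sf_parity_iff_hom)
    from fun_cong[OF deformed_jacobi[OF D this], of x]
    show "(-1) ^ (a * c) * C f (C g h) x + (-1) ^ (b * a) * C g (C h f) x
        + (-1) ^ (c * b) * C h (C f g) x = 0"
      by (simp add: C_eq D D_deformed cyclic_def minus_one_power_fun_apply)
  qed
  moreover have "at_theta_0 k (C f g x) = at_theta_0 k (m0 k m lam f g x)"
    if "\<forall>x. at_theta_0 k (\<zeta> x) = 0" for f g x
  proof -
    have 0: "at_theta_0 k \<theta> = 0" using theta by (simp add: at_theta_0_ggen)
    have z: "at_theta_0 k (\<zeta> x) = 0" for x using that by blast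
    have "at_theta_0 k (\<eta> x) = 0" for x
      by (rule at_theta_0_eta[OF 0 z eta(1) h2(1)])
        (use eta_eq in \<open>simp only: mult.assoc mult_minus_left\<close>)
    then show ?thesis
      unfolding deformation_def by (intro at_theta_0_deformed_bracket 0 z)
  qed
  ultimately show ?thesis by blast
qed

end
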